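(* Let $|N|=4$ or $|O|=3$. Then the random serial dictatorship mechanism RSD attains the minimal bound for at-most-$q$-agent-object-wastefulness (i) in the class of mechanisms satisfying equal treatment of almost equals, strategy-proofness and ex-post weak non-wastefulness, and (ii) in the class of mechanisms satisfying equal treatment of equals, strategy-proofness and ex-post efficiency. That is, RSD belongs to each of these classes and, for every mechanism $f$ in the class, if RSD is at-most-$q$-agent-object-wasteful and $f$ is at-most-$q'$-agent-object-wasteful, then $q\leq q'$.
   Context: Model. $N=\{1,\ldots,n\}$ is a finite set of agents and $O$ a finite set of objects. Each agent $i$ has a strict preference $R_i$, a linear order over $O\cup\{i\}$, where $i$ stands for being unassigned; $P_i$ is its asymmetric part. $A(R_i)=\{o\in O: oP_ii\}$ is the set of acceptable objects, and $R_i|O$ is the restriction of $R_i$ to $O$. $\mathcal{R}^i$ is the set of all linear orders over $O\cup\{i\}$ and $\mathcal{R}^N=\times_{i\in N}\mathcal{R}^i$ is the set of profiles. An assignment is a map $\mu$ on $N$ with $\mu_i\in O\cup\{i\}$ for all $i$ and $\mu_i\neq\mu_j$ for $i\neq j$; $\mathcal{M}$ is the set of assignments and $\Delta(\mathcal{M})$ the set of probability distributions over $\mathcal{M}$. A mechanism is a map $f:\mathcal{R}^N\to\Delta(\mathcal{M})$; $f_{ia}(R)$ is the probability that $i$ is assigned $a\in O\cup\{i\}$ under $f(R)$, $f_i(R)=(f_{ia}(R))_{a\in O\cup\{i\}}$, and $f_{oo}(R)=1-\sum_{j\in N}f_{jo}(R)$ for $o\in O$. Properties. An assignment $\mu$ is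 efficient under $R$ if there is no assignment $\mu'$ with $\mu'_iR_i\mu_i$ for all $i$ and $\mu'_jP_j\mu_j$ for some $j$. It is weakly non-wasteful under $R$ if for all $i\in N$ and $x\in O\cup\{i\}$: $xR_i\mu_i$ and $iR_i\mu_i$ together imply that $\mu_j=x$ for some $j\in N$. $f$ is ex-post efficient (resp. ex-post weakly non-wasteful) if for every $R$ every assignment in the support of $f(R)$ is efficient (resp. weakly non-wasteful) under $R$. $f$ is strategy-proof if for all $R$, $i$, $R_i'\in\mathcal{R}^i$ and $x\in O\cup\{i\}$: $\sum_{y:\,yR_ix}f_{iy}(R)\ge\sum_{y:\,yR_ix}f_{iy}(R_i',R_{-i})$. $f$ satisfies equal treatment of equals if for all $R$ and $i,j\in N$, if $R_i=R_j$ (identifying the outside options $i$ and $j$) then $f_{io}(R)=f_{jo}(R)$ for all $o\in O$. $f$ satisfies equal treatment of almost equals if for all $R$ and all $i,j\in N$ with $R_i|O=R_j|O$ and $|A(R_i)|\le|A(R_j)|\le|A(R_i)|+1$, we have $f_{iy}(R)=f_{jy}(R)$ for all $y\in A(R_i)$. RSD. For a strict priority order $\succ$ over $N$, the serial dictatorship $f^{\succ}$ lets agents choose one after another in the order $\succ$; each agent receives his most preferred element among his outside option and the objects not chosen by earlier agents. With $\Pi$ the set of all strict priority orders over $N$, $RSD(R)=\frac{1}{n!}\sum_{\succ\in\Pi}f^{\succ}(R)$ for all $R$. Waste. For $q\in[0,1]$, $f$ is $q$-agent-object-wasteful if there exist a profile $R$, $o\in O$ and $i\in N$ with $oP_ii$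 and $\min\{f_{ii}(R),f_{oo}(R)\}\ge q$. $f$ is at-most-$q$-agent-object-wasteful if $f$ is $q$-agent-object-wasteful and not $q'$-agent-object-wasteful for any $q'>q$ (such a $q$ exists and is unique for every mechanism). *)

theory Defs
  imports "HOL-Probability.Probability" "HOL-Combinatorics.Multiset_Permutations"
begin

text \<open>
  Agents and objects are the elements of the finite types \<open>'n\<close> and \<open>'o\<close>.  In the position of
  agent \<open>i\<close>, the value \<open>None\<close> stands for the outside option \<open>i\<close> of that agent, so that
  \<open>'o option\<close> encodes the set of objects extended by \<open>i\<close>, with the outside options of different
  agents identified.  A pair \<open>(x, y)\<close> in a preference means that \<open>x\<close> is at least as good as \<open>y\<close>.
\<close>

type_synonym 'o preference = "'o option rel"
type_synonym ('n, 'o) profile = "'n \<Rightarrow> 'o preference"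
type_synonym ('n, 'o) assignment = "'n \<Rightarrow> 'o option"
type_synonym ('n, 'o) mechanism = "('n, 'o) profile \<Rightarrow> ('n, 'o) assignment pmf"

definition preferences :: "'o preference set" where
  "preferences = {r. linear_order r}"

definition profiles :: "('n, 'o) profile set" where
  "profiles = {R. \<forall>i. R i \<in> preferences}"

definition strict :: "'a rel \<Rightarrow> 'a rel" where
  "strict r = {(x, y). (x, y) \<in> r \<and> (y, x) \<notin> r}"

definition acceptable :: "'o preference \<Rightarrow> 'o set" where
  "acceptable r = {a. (Some a, None) \<in> strict r}"

definition restrict_objects :: "'o preference \<Rightarrow> 'o rel" where
  "restrict_objects r = {(a, b). (Some a, Some b) \<in> r}"

text \<open>
  Distinct agents have distinct outside options, so only the objects have to be assigned injectively.
\<close>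

definition assignments :: "('n, 'o) assignment set" where
  "assignments = {\<mu>. \<forall>i j a. \<mu> i = Some a \<longrightarrow> \<mu> j = Some a \<longrightarrow> i = j}"

text \<open>
  Values outside \<open>profiles\<close> are unconstrained; no property below refers to them.
\<close>

definition is_mechanism :: "('n, 'o) mechanism \<Rightarrow> bool" where
  "is_mechanism f \<longleftrightarrow> (\<forall>R\<in>profiles. set_pmf (f R) \<subseteq> assignments)"

definition assign_prob :: "('n, 'o) mechanism \<Rightarrow> ('n, 'o) profile \<Rightarrow> 'n \<Rightarrow> 'o option \<Rightarrow> real" where
  "assign_prob f R i x = measure_pmf.prob (f R) {\<mu>. \<mu> i = x}"

definition unassigned_prob :: "('n::finite, 'o) mechanism \<Rightarrow> ('n, 'o) profile \<Rightarrow> 'o \<Rightarrow> real" where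
  "unassigned_prob f R a = 1 - (\<Sum>j\<in>UNIV. assign_prob f R j (Some a))"

definition efficient :: "('n, 'o) profile \<Rightarrow> ('n, 'o) assignment \<Rightarrow> bool" where
  "efficient R \<mu> \<longleftrightarrow>
     \<not> (\<exists>\<mu>'\<in>assignments. (\<forall>i. (\<mu>' i, \<mu> i) \<in> R i) \<and> (\<exists>j. (\<mu>' j, \<mu> j) \<in> strict (R j)))"

text \<open>
  The condition that the element \<open>x\<close> of \<open>i\<close>'s choice set is assigned to some agent.  The outside
  option of \<open>i\<close> can only be assigned to \<open>i\<close>, hence the first case does not quantify over agents.
\<close>

definition taken :: "('n, 'o) assignment \<Rightarrow> 'n \<Rightarrow> 'o option \<Rightarrow> bool" where
  "taken \<mu> i x = (case x of None \<Rightarrow> \<mu> i = None | Some a \<Rightarrow> (\<exists>j. \<mu> j = Some a))"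

definition weakly_nonwasteful :: "('n, 'o) profile \<Rightarrow> ('n, 'o) assignment \<Rightarrow> bool" where
  "weakly_nonwasteful R \<mu> \<longleftrightarrow>
     (\<forall>i x. (x, \<mu> i) \<in> R i \<longrightarrow> (None, \<mu> i) \<in> R i \<longrightarrow> taken \<mu> i x)"

definition ex_post_efficient :: "('n, 'o) mechanism \<Rightarrow> bool" where
  "ex_post_efficient f \<longleftrightarrow> (\<forall>R\<in>profiles. \<forall>\<mu>\<in>set_pmf (f R). efficient R \<mu>)"

definition ex_post_weakly_nonwasteful :: "('n, 'o) mechanism \<Rightarrow> bool" where
  "ex_post_weakly_nonwasteful f \<longleftrightarrow> (\<forall>R\<in>profiles. \<forall>\<mu>\<in>set_pmf (f R). weakly_nonwasteful R \<mu>)"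

definition strategy_proof :: "('n, 'o) mechanism \<Rightarrow> bool" where
  "strategy_proof f \<longleftrightarrow>
     (\<forall>R\<in>profiles. \<forall>i. \<forall>r\<in>preferences. \<forall>x.
        (\<Sum>y | (y, x) \<in> R i. assign_prob f R i y)
          \<ge> (\<Sum>y | (y, x) \<in> R i. assign_prob f (R(i := r)) i y))"

definition equal_treatment_of_equals :: "('n, 'o) mechanism \<Rightarrow> bool" where
  "equal_treatment_of_equals f \<longleftrightarrow>
     (\<forall>R\<in>profiles. \<forall>i j. R i = R j \<longrightarrow>
        (\<forall>a. assign_prob f R i (Some a) = assign_prob f R j (Some a)))"

definition equal_treatment_of_almost_equals :: "('n, 'o) mechanism \<Rightarrow> bool" where
  "equal_treatment_of_almost_equals f \<longleftrightarrow>
     (\<forall>R\<in>profiles. \<forall>i j.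
        restrict_objects (R i) = restrict_objects (R j) \<longrightarrow>
        card (acceptable (R i)) \<le> card (acceptable (R j)) \<longrightarrow>
        card (acceptable (R j)) \<le> card (acceptable (R i)) + 1 \<longrightarrow>
        (\<forall>a\<in>acceptable (R i). assign_prob f R i (Some a) = assign_prob f R j (Some a)))"

definition best :: "'a rel \<Rightarrow> 'a set \<Rightarrow> 'a" where
  "best r X = (THE x. x \<in> X \<and> (\<forall>y\<in>X. (x, y) \<in> r))"

text \<open>
  A priority order is given as the list of all agents, highest priority first; the last argument of
  \<open>serial_choice\<close> is the set of objects that are still available.
\<close>

fun serial_choice :: "'n list \<Rightarrow> ('n, 'o) profile \<Rightarrow> 'o set \<Rightarrow> ('n, 'o) assignment" where
  "serial_choice [] R S = (\<lambda>i. None)"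
| "serial_choice (i # p) R S =
     (let x = best (R i) (insert None (Some ` S))
      in (serial_choice p R (S - set_option x))(i := x))"

definition serial_dictatorship :: "'n list \<Rightarrow> ('n, 'o) profile \<Rightarrow> ('n, 'o) assignment" where
  "serial_dictatorship p R = serial_choice p R UNIV"

definition priorities :: "'n list set" where
  "priorities = permutations_of_set UNIV"

definition RSD :: "('n::finite, 'o) mechanism" where
  "RSD R = map_pmf (\<lambda>p. serial_dictatorship p R) (pmf_of_set priorities)"

lemma pmf_RSD:
  fixes R :: "('n::finite, 'o) profile"
  shows "pmf (RSD R) \<mu> =
    1 / fact CARD('n) * (\<Sum>p\<in>priorities. pmf (return_pmf (serial_dictatorship p R)) \<mu>)"
proof -
  have fin: "finite (priorities :: 'n list set)" "(priorities :: 'n list set) \<noteq> {}"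
    and card: "card (priorities :: 'n list set) = fact CARD('n)"
    by (simp_all add: priorities_def)
  show ?thesis
    using fin by (simp add: RSD_def map_pmf_def pmf_bind_pmf_of_set card)
qed

definition agent_object_wasteful :: "real \<Rightarrow> ('n::finite, 'o) mechanism \<Rightarrow> bool" where
  "agent_object_wasteful q f \<longleftrightarrow>
     q \<in> {0..1} \<and>
     (\<exists>R\<in>profiles. \<exists>a i. (Some a, None) \<in> strict (R i) \<and>
        min (assign_prob f R i None) (unassigned_prob f R a) \<ge> q)"

definition at_most_agent_object_wasteful :: "real \<Rightarrow> ('n::finite, 'o) mechanism \<Rightarrow> bool" where
  "at_most_agent_object_wasteful q f \<longleftrightarrow>
     agent_object_wasteful q f \<and> (\<forall>q'>q. \<not> agent_object_wasteful q' f)"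

definition attains_minimal_waste_bound ::
  "('n::finite, 'o) mechanism \<Rightarrow> ('n, 'o) mechanism set \<Rightarrow> bool" where
  "attains_minimal_waste_bound g C \<longleftrightarrow>
     g \<in> C \<and>
     (\<forall>f\<in>C. \<forall>q q'. at_most_agent_object_wasteful q g \<longrightarrow>
        at_most_agent_object_wasteful q' f \<longrightarrow> q \<le> q')"

end

theory Submission
  imports Defs
begin

text \<open>
  The waste of RSD is at most \<open>1/6\<close>.  Suppose that \<open>i\<close> is unassigned under the priority order \<open>p\<close> and
  that \<open>w\<close>, acceptable to \<open>i\<close>, is left over under \<open>q\<close>.  Then every agent who accepts \<open>w\<close> receives
  something better under \<open>q\<close>, while under \<open>p\<close> some \<open>b\<close> takes \<open>w\<close> because the object that \<open>b\<close> receives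
  under \<open>q\<close> was chosen before by some \<open>c\<close>, and the object that \<open>i\<close> receives under \<open>q\<close> is held by a fourth
  agent.  With four agents this forces \<open>i\<close> to come last in \<open>p\<close>, and at least two of the six such orders
  serve \<open>i\<close>.  With three objects, one of the two events is contained in an event on the relative order
  of a few agents that has six disjoint relabelled copies.

  Conversely, with four agents and three objects there is a profile, with the preferences \<open>xzy\<close>, \<open>xy\<close>,
  \<open>xy\<close> and \<open>yxz\<close> (acceptable objects only), at which every mechanism of either class has the
  same probabilities of waste as RSD, which wastes \<open>z\<close> at the last agent with probability exactly
  \<open>1/6\<close>.  Strategy-proofness preserves the probability of receiving one of the best \<open>k\<close> objects when an agent permutes the
  objects within and outside this set; together with the equal treatment axiom and with objects or
  agents that are always assigned, these equations pin down the needed probabilities one by one.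
\<close>

section \<open>Random serial dictatorship\<close>

text \<open>Only the constant 1/6 links RSD to its competitors: it bounds the waste of RSD from
  above and that of every member of either class from below. If RSD wastes nothing, there is nothing
  to compare. If it wastes something, the configuration of agents and objects behind the waste
  contains four different agents and three different objects, and this is what makes it possible to
  form the bad profile, with all further agents accepting nothing and all further objects acceptable
  to nobody. The obstacle on the lower side is that a competitor is known only through its axioms.
  Strategy-proofness yields equalities rather than inequalities because two profiles differing in
  one ranking are deviations from each other. These equalities carry only sums over top sets, so
  each step must find a profile at which the carried sums, together with the sums over agents that
  are forced to be 1, have a unique solution. The two classes need different chains: in the first,
  agents whose acceptable sets differ by one object are treated alike; in the second, this is
  replaced by the trades that efficiency rules out, which force some probabilities to be
  zero.\<close>

lemma linear_orderD:
  assumes "linear_order r"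
  shows "(a, a) \<in> r" "(a, b) \<in> r \<Longrightarrow> (b, c) \<in> r \<Longrightarrow> (a, c) \<in> r"
    "(a, b) \<in> r \<Longrightarrow> (b, a) \<in> r \<Longrightarrow> a = b" "(a, b) \<in> r \<or> (b, a) \<in> r"
proof -
  have r: "refl r" "trans r" "antisym r" "total r"
    using assms by (auto simp: linear_order_on_def partial_order_on_def preorder_on_def)
  show "(a, a) \<in> r" using r(1) by (simp add: refl_on_def)
  show "(a, b) \<in> r \<Longrightarrow> (b, c) \<in> r \<Longrightarrow> (a, c) \<in> r" using r(2) by (rule transD)
  show "(a, b) \<in> r \<Longrightarrow> (b, a) \<in> r \<Longrightarrow> a = b" using r(3) by (rule antisymD)
  show "(a, b) \<in> r \<or> (b, a) \<in> r" using r(1,4) by (cases "a = b") (auto simp: refl_on_def total_on_def)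
qed

lemma strict_linear_order_iff:
  assumes "linear_order r"
  shows "(a, b) \<in> strict r \<longleftrightarrow> (a, b) \<in> r \<and> a \<noteq> b"
  using linear_orderD[OF assms] by (auto simp: strict_def)

lemma linear_order_profile: "R \<in> profiles \<Longrightarrow> linear_order (R i)"
  by (simp add: profiles_def preferences_def)

lemma best_unique:
  assumes r: "linear_order r" and x: "x \<in> X" "\<And>y. y \<in> X \<Longrightarrow> (x, y) \<in> r"
  shows "best r X = x"
  unfolding best_def using x linear_orderD(3)[OF r] by (intro the_equality) blast+

lemma best_exists:
  assumes r: "linear_order r" and "finite X" "X \<noteq> {}"
  shows "\<exists>x\<in>X. \<forall>y\<in>X. (x, y) \<in> r"
  using assms(2,3)
proof (induction X rule: finite_ne_induct)
  case (singleton x)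
  then show ?case using linear_orderD(1)[OF r] by auto
next
  case (insert z X)
  then obtain x where x: "x \<in> X" "\<forall>y\<in>X. (x, y) \<in> r" by blast
  show ?case
  proof (cases "(x, z) \<in> r")
    case True
    with x show ?thesis by auto
  next
    case False
    then have "(z, x) \<in> r" using linear_orderD(4)[OF r] by blast
    then have "\<forall>y\<in>insert z X. (z, y) \<in> r"
      using x linear_orderD(1,2)[OF r] by blast
    then show ?thesis by blast
  qed
qed

lemma best_in:
  assumes "linear_order r" "finite X" "X \<noteq> {}"
  shows "best r X \<in> X"
  using best_exists[OF assms] best_unique[OF assms(1)] by metis

lemma best_least:
  assumes "linear_order r" "finite X" "y \<in> X"
  shows "(best r X, y) \<in> r"
proof -
  obtain x where "x \<in> X" "\<forall>y\<in>X. (x, y) \<in> r" using best_exists[OF assms(1,2)] assms(3) by blast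
  then show ?thesis using best_unique[OF assms(1), of x X] assms(3) by auto
qed

definition position :: "'a list \<Rightarrow> 'a \<Rightarrow> nat" where
  "position p a = length (takeWhile (\<lambda>b. b \<noteq> a) p)"

lemma position_Nil [simp]: "position [] a = 0"
  and position_Cons [simp]: "position (b # p) a = (if b = a then 0 else Suc (position p a))"
  by (simp_all add: position_def)

lemma position_inj:
  "a \<in> set p \<Longrightarrow> b \<in> set p \<Longrightarrow> position p a = position p b \<longleftrightarrow> a = b"
  by (induction p) auto

lemma position_map:
  "inj s \<Longrightarrow> position (map s p) (s a) = position p a"
  by (induction p) (auto simp: inj_eq)

lemma finite_priorities [simp]: "finite (priorities :: 'n::finite list set)"
  by (simp add: priorities_def)

lemma priorities_iff: "p \<in> priorities \<longleftrightarrow> distinct p \<and> set p = UNIV"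
  by (auto simp: priorities_def permutations_of_set_def)

lemma card_priorities: "card (priorities :: 'n::finite list set) = fact CARD('n)"
  by (simp add: priorities_def)

lemma priorities_nonempty [simp]: "priorities \<noteq> ({} :: 'n::finite list set)"
  by (simp add: priorities_def)

lemma map_priorities:
  fixes s :: "'n::finite \<Rightarrow> 'n"
  assumes "bij s" "p \<in> priorities"
  shows "map s p \<in> priorities"
  using assms by (auto simp: priorities_iff distinct_map bij_def inj_on_def surj_def)

section \<open>Serial dictatorships: feasibility, envy and efficiency\<close>

lemma serial_choice_SomeD:
  fixes R :: "('n, 'o::finite) profile"
  assumes "R \<in> profiles"
  shows "serial_choice p R S i = Some a \<Longrightarrow> a \<in> S \<and> i \<in> set p"
proof (induction p arbitrary: S)
  case (Cons j p)
  have "best (R j) (insert None (Some ` S)) \<in> insert None (Some ` S)"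
    using best_in[OF linear_order_profile[OF assms], of "insert None (Some ` S)"] by simp
  with Cons show ?case by (auto simp: Let_def split: if_splits)
qed simp

lemma serial_choice_rational:
  fixes R :: "('n, 'o::finite) profile"
  assumes "R \<in> profiles"
  shows "(serial_choice p R S i, None) \<in> R i"
proof (induction p arbitrary: S)
  case Nil
  then show ?case using linear_orderD(1)[OF linear_order_profile[OF assms]] by simp
next
  case (Cons j p)
  then show ?case
    using best_least[OF linear_order_profile[OF assms], of "insert None (Some ` S)" None]
    by (auto simp: Let_def)
qed

lemma serial_choice_inj:
  fixes R :: "('n, 'o::finite) profile"
  assumes "R \<in> profiles"
  shows "serial_choice p R S \<in> assignments"
proof (induction p arbitrary: S)
  case Nil
  then show ?case by (simp add: assignments_def)
next
  case (Cons j p)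
  define x where "x = best (R j) (insert None (Some ` S))"
  have "serial_choice p R (S - set_option x) k \<noteq> x \<or> x = None" for k
    using serial_choice_SomeD[OF assms, of p "S - set_option x" k] by (cases x) auto
  with Cons[of "S - set_option x"] show ?case
    by (auto simp: assignments_def Let_def x_def[symmetric])
qed

text \<open>Objects leave the available set only by being chosen. If \<open>a\<close> were still
  there at the turn of \<open>i\<close>, the choice of \<open>i\<close> would be at least as good as
  \<open>a\<close>; so an earlier agent has taken it.\<close>

lemma serial_choice_envy:
  fixes R :: "('n, 'o::finite) profile"
  assumes "R \<in> profiles"
  shows "i \<in> set p \<Longrightarrow> distinct p \<Longrightarrow> a \<in> S \<Longrightarrow> (serial_choice p R S i, Some a) \<notin> R i \<Longrightarrow>
     \<exists>j. position p j < position p i \<and> serial_choice p R S j = Some a"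
proof (induction p arbitrary: S)
  case (Cons j p)
  define x where "x = best (R j) (insert None (Some ` S))"
  show ?case
  proof (cases "j = i")
    case True
    then have "serial_choice (j # p) R S i = x" by (simp add: Let_def x_def)
    then show ?thesis
      using best_least[OF linear_order_profile[OF assms], of "insert None (Some ` S)" "Some a" j]
        Cons.prems True by (simp add: x_def)
  next
    case False
    show ?thesis
    proof (cases "x = Some a")
      case True
      then have "serial_choice (j # p) R S j = Some a" by (simp add: Let_def x_def)
      then show ?thesis using False by (intro exI[of _ j]) auto
    next
      case neq: False
      then have "a \<in> S - set_option x" using Cons.prems by (cases x) auto
      with Cons.IH[of "S - set_option x"] Cons.prems False
      obtain k where k: "position p k < position p i" "serial_choice p R (S - set_option x) k = Some a"
        by (auto simp: Let_def x_def)
      \<comment> \<open>Only agents of the list receive objects, and \<open>j\<close> does not occur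
        in \<open>p\<close>.\<close>
      moreover have "k \<noteq> j"
        using serial_choice_SomeD[OF assms k(2)] Cons.prems by auto
      ultimately show ?thesis using False by (intro exI[of _ k]) (auto simp: Let_def x_def)
    qed
  qed
qed simp

lemma serial_dictatorship_assignment:
  fixes R :: "('n, 'o::finite) profile"
  shows "R \<in> profiles \<Longrightarrow> serial_dictatorship p R \<in> assignments"
  by (simp add: serial_dictatorship_def serial_choice_inj)

lemma serial_dictatorship_inj:
  fixes R :: "('n, 'o::finite) profile"
  assumes "R \<in> profiles" "serial_dictatorship p R i = Some a" "serial_dictatorship p R j = Some a"
  shows "i = j"
  using serial_dictatorship_assignment[OF assms(1), of p] assms(2,3) by (auto simp: assignments_def)

lemma serial_dictatorship_rational:
  fixes R :: "('n, 'o::finite) profile"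
  shows "R \<in> profiles \<Longrightarrow> (serial_dictatorship p R i, None) \<in> R i"
  by (simp add: serial_dictatorship_def serial_choice_rational)

lemma serial_dictatorship_envy:
  fixes R :: "('n::finite, 'o::finite) profile"
  assumes "R \<in> profiles" "p \<in> priorities" "(serial_dictatorship p R i, Some a) \<notin> R i"
  obtains j where "position p j < position p i" "serial_dictatorship p R j = Some a"
  using serial_choice_envy[OF assms(1), of i p a UNIV] assms(2,3)
  by (auto simp: serial_dictatorship_def priorities_iff)

lemma serial_dictatorship_efficient:
  fixes R :: "('n::finite, 'o::finite) profile"
  assumes R: "R \<in> profiles" and p: "p \<in> priorities"
  shows "efficient R (serial_dictatorship p R)"
  unfolding efficient_def
proof (intro notI)
  let ?m = "serial_dictatorship p R"
  assume "\<exists>\<mu>'\<in>assignments. (\<forall>i. (\<mu>' i, ?m i) \<in> R i) \<and> (\<exists>j. (\<mu>' j, ?m j) \<in> strict (R j))"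
  then obtain \<mu>' j0 where m: "\<mu>' \<in> assignments" "\<And>i. (\<mu>' i, ?m i) \<in> R i" "\<mu>' j0 \<noteq> ?m j0"
    using strict_linear_order_iff[OF linear_order_profile[OF R]] by blast
  \<comment> \<open>\<open>j\<close> is the agent of highest priority whose assignment changes.
    Everyone before \<open>j\<close> keeps the same object, so what \<open>j\<close> would gain has
    an owner who does not give it up.\<close>
  define j where "j = arg_min (position p) (\<lambda>j. \<mu>' j \<noteq> ?m j)"
  have j: "\<mu>' j \<noteq> ?m j" "\<And>k. position p k < position p j \<Longrightarrow> \<mu>' k = ?m k"
    using arg_min_nat_lemma[of "\<lambda>j. \<mu>' j \<noteq> ?m j" j0 "position p", OF m(3)]
    unfolding j_def[symmetric] by (auto simp: not_less[symmetric])
  note lo = linear_orderD[OF linear_order_profile[OF R]]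
  have better: "(?m j, \<mu>' j) \<notin> R j" using m(2)[of j] j(1) lo(3) by metis
  then obtain a where a: "\<mu>' j = Some a"
    using serial_dictatorship_rational[OF R, of p j] by (cases "\<mu>' j") auto
  then obtain k where k: "position p k < position p j" "?m k = Some a"
    using serial_dictatorship_envy[OF R p] better by metis
  then have "\<mu>' k = Some a" using j(2) by simp
  then have "k = j" using m(1) a by (auto simp: assignments_def)
  then show False using k(1) by simp
qed

lemma serial_dictatorship_weakly_nonwasteful:
  fixes R :: "('n::finite, 'o::finite) profile"
  assumes R: "R \<in> profiles" and p: "p \<in> priorities"
  shows "weakly_nonwasteful R (serial_dictatorship p R)"
  unfolding weakly_nonwasteful_def
proof (intro allI impI)
  fix i x
  let ?m = "serial_dictatorship p R"
  assume x: "(x, ?m i) \<in> R i" "(None, ?m i) \<in> R i"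
  note lo = linear_orderD[OF linear_order_profile[OF R]]
  have none: "?m i = None" using x serial_dictatorship_rational[OF R, of p i] lo(3) by metis
  show "taken ?m i x"
  proof (cases x)
    case None
    then show ?thesis using none by (simp add: taken_def)
  next
    case (Some a)
    then have "(?m i, Some a) \<notin> R i" using x none lo(3) by (metis option.distinct(1))
    then obtain j where "?m j = Some a" using serial_dictatorship_envy[OF R p] by metis
    then show ?thesis using Some by (auto simp: taken_def)
  qed
qed

section \<open>RSD probabilities as counts of priority orders\<close>

lemma set_pmf_RSD: "set_pmf (RSD R) = (\<lambda>p. serial_dictatorship p R) ` priorities"
  by (simp add: RSD_def)

lemma prob_RSD:
  fixes R :: "('n::finite, 'o) profile"
  shows "measure_pmf.prob (RSD R) {\<mu>. Q \<mu>} =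
     card {p \<in> priorities. Q (serial_dictatorship p R)} / fact CARD('n)"
proof -
  have "measure_pmf.prob (RSD R) {\<mu>. Q \<mu>} =
      measure_pmf.prob (pmf_of_set priorities) {p. Q (serial_dictatorship p R)}"
    by (simp add: RSD_def vimage_def)
  also have "\<dots> = card (priorities \<inter> {p :: 'n list. Q (serial_dictatorship p R)}) / fact CARD('n)"
    by (subst measure_pmf_of_set) (simp_all add: card_priorities)
  also have "priorities \<inter> {p :: 'n list. Q (serial_dictatorship p R)} =
      {p \<in> priorities. Q (serial_dictatorship p R)}" by auto
  finally show ?thesis .
qed

lemma sum_assign_prob:
  fixes f :: "('n, 'o::finite) mechanism"
  shows "(\<Sum>y\<in>Y. assign_prob f R i y) = measure_pmf.prob (f R) {\<mu>. \<mu> i \<in> Y}"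
proof -
  have "(\<Sum>y\<in>Y. assign_prob f R i y) = measure_pmf.prob (f R) (\<Union>y\<in>Y. {\<mu>. \<mu> i = y})"
    unfolding assign_prob_def
    by (rule measure_pmf.finite_measure_finite_Union[symmetric]) (auto simp: disjoint_family_on_def)
  also have "(\<Union>y\<in>Y. {\<mu>. \<mu> i = y}) = {\<mu>. \<mu> i \<in> Y}" by auto
  finally show ?thesis .
qed

lemma unassigned_prob_eq:
  fixes f :: "('n::finite, 'o) mechanism"
  assumes "is_mechanism f" "R \<in> profiles"
  shows "unassigned_prob f R a = measure_pmf.prob (f R) {\<mu>. \<forall>j. \<mu> j \<noteq> Some a}"
proof -
  let ?M = "measure_pmf.prob (f R)"
  have inj: "\<mu> \<in> assignments" if "\<mu> \<in> set_pmf (f R)" for \<mu>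
    using that assms by (auto simp: is_mechanism_def)
  \<comment> \<open>Injectivity is known only on the support, so the events are cut down to it
    before they are added as disjoint ones.\<close>
  have "(\<Sum>j\<in>UNIV. assign_prob f R j (Some a)) =
      (\<Sum>j\<in>UNIV. ?M ({\<mu>. \<mu> j = Some a} \<inter> set_pmf (f R)))"
    by (simp add: assign_prob_def measure_Int_set_pmf)
  also have "\<dots> = ?M (\<Union>j. {\<mu>. \<mu> j = Some a} \<inter> set_pmf (f R))"
    by (rule measure_pmf.finite_measure_finite_Union[symmetric])
      (use inj in \<open>auto simp: disjoint_family_on_def assignments_def\<close>)
  also have "(\<Union>j. {\<mu>. \<mu> j = Some a} \<inter> set_pmf (f R)) =
      (- {\<mu>. \<forall>j. \<mu> j \<noteq> Some a}) \<inter> set_pmf (f R)" by auto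
  also have "?M \<dots> = ?M (- {\<mu>. \<forall>j. \<mu> j \<noteq> Some a})" by (simp add: measure_Int_set_pmf)
  also have "\<dots> = 1 - ?M {\<mu>. \<forall>j. \<mu> j \<noteq> Some a}"
    using measure_pmf.prob_compl[of "{\<mu>. \<forall>j. \<mu> j \<noteq> Some a}" "f R"] by (simp add: Compl_eq_Diff_UNIV)
  finally show ?thesis by (simp add: unassigned_prob_def)
qed

lemma is_mechanism_RSD: "is_mechanism (RSD :: ('n::finite, 'o::finite) mechanism)"
  by (auto simp: is_mechanism_def set_pmf_RSD serial_dictatorship_assignment)

lemma ex_post_efficient_RSD: "ex_post_efficient (RSD :: ('n::finite, 'o::finite) mechanism)"
  by (auto simp: ex_post_efficient_def set_pmf_RSD serial_dictatorship_efficient)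

lemma ex_post_weakly_nonwasteful_RSD:
  "ex_post_weakly_nonwasteful (RSD :: ('n::finite, 'o::finite) mechanism)"
  by (auto simp: ex_post_weakly_nonwasteful_def set_pmf_RSD serial_dictatorship_weakly_nonwasteful)

text \<open>The agents before \<open>i\<close> determine what is left for \<open>i\<close>, whatever
  \<open>i\<close> reports: the report only picks from a fixed menu.\<close>

lemma serial_choice_option_set:
  "i \<in> set p \<Longrightarrow> \<exists>X. \<forall>r. serial_choice p (R(i := r)) S i = best r (insert None (Some ` X))"
proof (induction p arbitrary: S)
  case (Cons j p)
  show ?case
  proof (cases "j = i")
    case True
    then show ?thesis by (auto simp: Let_def)
  next
    case False
    then show ?thesis
      using Cons.IH[of "S - set_option (best (R j) (insert None (Some ` S)))"] Cons.prems
      by (auto simp: Let_def)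
  qed
qed simp

text \<open>The truth picks the best element of the menu under each order separately, so every upper
  set is reached under at least as many orders as after a deviation.\<close>

lemma strategy_proof_RSD: "strategy_proof (RSD :: ('n::finite, 'o::finite) mechanism)"
  unfolding strategy_proof_def
proof (intro ballI allI)
  fix R :: "('n, 'o) profile" and i and r :: "'o preference" and x
  assume R: "R \<in> profiles" and r: "r \<in> preferences"
  note lo = linear_order_profile[OF R, of i]
  have "(serial_dictatorship p R i, x) \<in> R i"
    if p: "p \<in> priorities" and dev: "(serial_dictatorship p (R(i := r)) i, x) \<in> R i" for p
  proof -
    have "i \<in> set p" using p by (simp add: priorities_iff)
    then obtain X where X: "\<And>r. serial_choice p (R(i := r)) UNIV i = best r (insert None (Some ` X))"
      using serial_choice_option_set[of i p R UNIV] by blast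
    have truth: "serial_dictatorship p R i = best (R i) (insert None (Some ` X))"
      using X[of "R i"] by (simp add: serial_dictatorship_def fun_upd_triv)
    have "best r (insert None (Some ` X)) \<in> insert None (Some ` X)"
      using best_in[of r "insert None (Some ` X)"] r by (simp add: preferences_def)
    then have "(best (R i) (insert None (Some ` X)), best r (insert None (Some ` X))) \<in> R i"
      by (intro best_least[OF lo]) simp_all
    moreover have "serial_dictatorship p (R(i := r)) i = best r (insert None (Some ` X))"
      by (simp only: serial_dictatorship_def X)
    ultimately show ?thesis using dev unfolding truth by (metis linear_orderD(2)[OF lo])
  qed
  then have "card {p \<in> priorities. (serial_dictatorship p (R(i := r)) i, x) \<in> R i}
      \<le> card {p \<in> priorities. (serial_dictatorship p R i, x) \<in> R i}"
    by (intro card_mono) auto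
  then show "(\<Sum>y | (y, x) \<in> R i. assign_prob RSD (R(i := r)) i y)
      \<le> (\<Sum>y | (y, x) \<in> R i. assign_prob RSD R i y)"
    unfolding sum_assign_prob prob_RSD mem_Collect_eq by (intro divide_right_mono) simp_all
qed

section \<open>Equal treatment of almost equals under RSD\<close>

text \<open>
  On the objects in \<open>A\<close> the agents \<open>i\<close> and \<open>j\<close> choose alike.  Once neither of them chooses
  from \<open>A\<close>, the set \<open>A\<close> is exhausted, so different choices outside of \<open>A\<close> do no harm.
\<close>

definition choice :: "'o preference \<Rightarrow> 'o set \<Rightarrow> 'o option" where
  "choice r S = best r (insert None (Some ` S))"

definition choose_alike :: "('n, 'o) profile \<Rightarrow> 'o set \<Rightarrow> 'n \<Rightarrow> 'n \<Rightarrow> bool" where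
  "choose_alike R A i j \<longleftrightarrow>
     (\<forall>S. choice (R i) S = choice (R j) S \<and> choice (R i) S \<in> Some ` A \<or>
        choice (R i) S \<notin> Some ` A \<and> choice (R j) S \<notin> Some ` A \<and> A \<inter> S = {})"

lemma choose_alikeD:
  "choose_alike R A i j \<Longrightarrow> choice (R i) S = choice (R j) S \<and> choice (R i) S \<in> Some ` A \<or>
    choice (R i) S \<notin> Some ` A \<and> choice (R j) S \<notin> Some ` A \<and> A \<inter> S = {}"
  by (simp add: choose_alike_def)

lemma choose_alike_sym:
  assumes "choose_alike R A i j" shows "choose_alike R A j i"
  unfolding choose_alike_def
proof (rule allI)
  fix S
  show "choice (R j) S = choice (R i) S \<and> choice (R j) S \<in> Some ` A \<or>
      choice (R j) S \<notin> Some ` A \<and> choice (R i) S \<notin> Some ` A \<and> A \<inter> S = {}"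
    using choose_alikeD[OF assms, of S] by (cases "choice (R i) S = choice (R j) S") simp_all
qed

lemma serial_choice_Cons:
  "serial_choice (k # p) R S =
    (serial_choice p R (S - set_option (choice (R k) S)))(k := choice (R k) S)"
  by (simp add: Let_def choice_def)

text \<open>This treats the rest of an order after \<open>i\<close> has chosen: the transposition
  lets \<open>i\<close> stand where \<open>j\<close> stood.\<close>

lemma serial_choice_replace:
  fixes R :: "('n, 'o::finite) profile"
  assumes alike: "choose_alike R A i j" and a: "a \<in> A"
  shows "i \<notin> set p \<Longrightarrow>
    serial_choice (map (Transposition.transpose i j) p) R S i = Some a \<longleftrightarrow>
    serial_choice p R S j = Some a"
proof (induction p arbitrary: S)
  case (Cons k p)
  show ?case
  proof (cases "k = j")
    case True
    have "choice (R i) S = Some a \<longleftrightarrow> choice (R j) S = Some a"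
      using choose_alikeD[OF alike, of S] a by auto
    then show ?thesis using True by (simp add: serial_choice_Cons del: serial_choice.simps(2))
  next
    case False
    then have "Transposition.transpose i j k = k"
      using Cons.prems by (auto simp: Transposition.transpose_def)
    then show ?thesis
      using False Cons.IH Cons.prems by (simp add: serial_choice_Cons del: serial_choice.simps(2))
  qed
qed simp

text \<open>Both runs coincide until the first of \<open>i\<close> and \<open>j\<close> chooses.
  Then either the same object is removed in both, or \<open>A\<close> is exhausted and
  \<open>a\<close> goes to neither of them later.\<close>

lemma serial_choice_swap:
  fixes R :: "('n, 'o::finite) profile"
  assumes alike: "choose_alike R A i j" and a: "a \<in> A" and R: "R \<in> profiles" and ij: "i \<noteq> j"
  shows "distinct p \<Longrightarrow>
    (serial_choice (map (Transposition.transpose i j) p) R S j = Some a \<longleftrightarrow>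
      serial_choice p R S i = Some a) \<and>
    (serial_choice (map (Transposition.transpose i j) p) R S i = Some a \<longleftrightarrow>
      serial_choice p R S j = Some a)"
proof (induction p arbitrary: S)
  case (Cons k p)
  let ?t = "Transposition.transpose i j"
  let ?x = "choice (R i) S" and ?y = "choice (R j) S"
  have alikeS: "?x = ?y \<and> ?x \<in> Some ` A \<or> ?x \<notin> Some ` A \<and> ?y \<notin> Some ` A \<and> A \<inter> S = {}"
    by (rule choose_alikeD[OF alike])
  then have same: "?x = Some a \<longleftrightarrow> ?y = Some a" using a by auto
  \<comment> \<open>Different choices leave different sets behind, but then \<open>a\<close> is in
    neither of them and nobody in the rest of the order receives it.\<close>
  have rest: "serial_choice q R (S - set_option ?x) l = Some a \<longleftrightarrow>
      serial_choice q R (S - set_option ?y) l = Some a" for q l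
  proof (cases "?x = ?y")
    case False
    then have "a \<notin> S" using alikeS a by blast
    then show ?thesis
      using serial_choice_SomeD[OF R, of q _ l a] by blast
  qed simp
  consider "k = i" | "k = j" | "k \<noteq> i" "k \<noteq> j" by blast
  then show ?case
  proof cases
    case 1
    moreover have "serial_choice (map ?t p) R (S - set_option ?x) i = Some a \<longleftrightarrow>
        serial_choice p R (S - set_option ?x) j = Some a"
      using serial_choice_replace[OF alike a] Cons.prems 1 by simp
    ultimately show ?thesis
      using same rest ij by (simp add: serial_choice_Cons del: serial_choice.simps(2))
  next
    case 2
    moreover have "serial_choice (map ?t p) R (S - set_option ?x) j = Some a \<longleftrightarrow>
        serial_choice p R (S - set_option ?x) i = Some a"
      using serial_choice_replace[OF choose_alike_sym[OF alike] a] Cons.prems 2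
      by (simp add: Transposition.transpose_commute)
    ultimately show ?thesis
      using same rest ij by (simp add: serial_choice_Cons del: serial_choice.simps(2))
  next
    case 3
    then have "?t k = k" by (simp add: Transposition.transpose_def)
    then show ?thesis using 3 Cons.IH Cons.prems by (simp add: serial_choice_Cons del: serial_choice.simps(2))
  qed
qed simp

text \<open>Exchanging \<open>i\<close> and \<open>j\<close> is an involution of the priority
  orders; it matches the orders that give \<open>a\<close> to \<open>i\<close> with those that give
  \<open>a\<close> to \<open>j\<close>.\<close>

lemma RSD_choose_alike:
  fixes R :: "('n::finite, 'o::finite) profile"
  assumes alike: "choose_alike R A i j" and a: "a \<in> A" and R: "R \<in> profiles"
  shows "assign_prob RSD R i (Some a) = assign_prob RSD R j (Some a)"
proof (cases "i = j")
  case False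
  let ?s = "map (Transposition.transpose i j)"
  have "bij_betw ?s {p \<in> priorities. serial_dictatorship p R i = Some a}
      {p \<in> priorities. serial_dictatorship p R j = Some a}"
    using serial_choice_swap[OF alike a R False]
    by (intro bij_betw_byWitness[where f' = ?s])
      (auto simp: serial_dictatorship_def map_priorities comp_def priorities_iff[THEN iffD1])
  then show ?thesis
    unfolding assign_prob_def prob_RSD by (simp add: bij_betw_same_card)
qed simp

lemma acceptable_iff:
  assumes "linear_order r" shows "a \<in> acceptable r \<longleftrightarrow> (Some a, None) \<in> r"
  using strict_linear_order_iff[OF assms] by (simp add: acceptable_def)

text \<open>Both acceptable sets are initial segments of one order of the objects, hence nested; the
  cardinalities decide the direction.\<close>

lemma acceptable_nested:
  assumes r: "linear_order r" and s: "linear_order s"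
    and eq: "restrict_objects r = restrict_objects s"
    and card: "card (acceptable r) \<le> card (acceptable s)"
  shows "acceptable r \<subseteq> acceptable (s :: 'o::finite preference)"
proof (rule ccontr)
  assume "\<not> ?thesis"
  then obtain a where a: "a \<in> acceptable r" "a \<notin> acceptable s" by blast
  have "acceptable s \<subset> acceptable r"
  proof
    show "acceptable s \<subseteq> acceptable r"
    proof
      fix b assume b: "b \<in> acceptable s"
      have "(Some a, Some b) \<notin> s"
        using a b linear_orderD(2)[OF s] by (auto simp: acceptable_iff s)
      then have "(Some b, Some a) \<in> s" using linear_orderD(4)[OF s] by blast
      then have "(Some b, Some a) \<in> r" using eq by (auto simp: restrict_objects_def)
      then show "b \<in> acceptable r"
        using a linear_orderD(2)[OF r] by (auto simp: acceptable_iff r)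
    qed
  qed (use a in blast)
  then have "card (acceptable s) < card (acceptable r)" by (simp add: psubset_card_mono)
  then show False using card by simp
qed

text \<open>If an object acceptable to \<open>i\<close> is available, the best available object is
  acceptable to both agents and is chosen by both; otherwise neither can choose from that
  set.\<close>

lemma choose_alike_if_almost_equal:
  fixes R :: "('n, 'o::finite) profile"
  assumes R: "R \<in> profiles" and eq: "restrict_objects (R i) = restrict_objects (R j)"
    and card: "card (acceptable (R i)) \<le> card (acceptable (R j))"
  shows "choose_alike R (acceptable (R i)) i j"
proof -
  note loi = linear_order_profile[OF R, of i] and loj = linear_order_profile[OF R, of j]
  note sub = acceptable_nested[OF loi loj eq card]
  have "choice (R i) S = choice (R j) S \<and> choice (R i) S \<in> Some ` acceptable (R i) \<or>
      choice (R i) S \<notin> Some ` acceptable (R i) \<and> choice (R j) S \<notin> Some ` acceptable (R i) \<and>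
      acceptable (R i) \<inter> S = {}" (is "?x = ?y \<and> _ \<or> _") for S
  proof (cases "acceptable (R i) \<inter> S = {}")
    case True
    have "?x \<in> insert None (Some ` S)" "?y \<in> insert None (Some ` S)"
      using best_in[OF loi, of "insert None (Some ` S)"] best_in[OF loj, of "insert None (Some ` S)"]
      by (simp_all add: choice_def)
    then show ?thesis using True by auto
  next
    case False
    then obtain b where b: "b \<in> acceptable (R i)" "b \<in> S" by blast
    have xb: "(?x, Some b) \<in> R i" using best_least[OF loi] b by (simp add: choice_def)
    then have "(?x, None) \<in> R i" using b linear_orderD(2)[OF loi] by (auto simp: acceptable_iff loi)
    moreover have "?x \<noteq> None"
      using xb b linear_orderD(3)[OF loi, of None "Some b"] by (metis acceptable_iff loi option.distinct(1))
    moreover have "?x \<in> insert None (Some ` S)" using best_in[OF loi, of "insert None (Some ` S)"]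
      by (simp add: choice_def)
    ultimately obtain c where c: "?x = Some c" "c \<in> acceptable (R i)" "c \<in> S"
      by (auto simp: acceptable_iff loi)
    have "?y = Some c"
      unfolding choice_def
    proof (rule best_unique[OF loj])
      fix u assume "u \<in> insert None (Some ` S)"
      then consider "u = None" | d where "u = Some d" "d \<in> S" by blast
      then show "(Some c, u) \<in> R j"
      proof cases
        case 1
        then show ?thesis using c sub by (auto simp: acceptable_iff loj)
      next
        case 2
        then have "(Some c, Some d) \<in> R i" using best_least[OF loi, of "insert None (Some ` S)" u] c
            by (simp add: choice_def)
        then show ?thesis using eq 2 by (auto simp: restrict_objects_def)
      qed
    qed (use c in auto)
    then show ?thesis using c by auto
  qed
  then show ?thesis unfolding choose_alike_def by blast
qed

lemma equal_treatment_of_almost_equals_RSD: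
  "equal_treatment_of_almost_equals (RSD :: ('n::finite, 'o::finite) mechanism)"
  unfolding equal_treatment_of_almost_equals_def
  by (auto intro!: RSD_choose_alike[OF choose_alike_if_almost_equal])

section \<open>Relations between the axioms\<close>

text \<open>Individual rationality is the instance \<open>x = None\<close> of weak non-wastefulness,
  where \<open>taken\<close> says that \<open>i\<close> is unassigned.\<close>

lemma weakly_nonwasteful_rational:
  assumes R: "R \<in> profiles" and "weakly_nonwasteful R \<mu>"
  shows "(\<mu> i, None) \<in> R i"
proof (rule ccontr)
  assume "(\<mu> i, None) \<notin> R i"
  then have "(None, \<mu> i) \<in> R i" "\<mu> i \<noteq> None"
    using linear_orderD(1,4)[OF linear_order_profile[OF R, of i]] by metis+
  moreover have "taken \<mu> i None"
    using assms(2) \<open>(None, \<mu> i) \<in> R i\<close> unfolding weakly_nonwasteful_def by blast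
  ultimately show False by (simp add: taken_def)
qed

lemma assign_prob_unacceptable:
  assumes "ex_post_weakly_nonwasteful f" "R \<in> profiles" "(u, None) \<notin> R i"
  shows "assign_prob f R i u = 0"
  unfolding assign_prob_def
proof -
  have "\<mu> i \<noteq> u" if "\<mu> \<in> set_pmf (f R)" for \<mu>
  proof -
    have "weakly_nonwasteful R \<mu>"
      using assms(1,2) that by (simp add: ex_post_weakly_nonwasteful_def)
    then show ?thesis using weakly_nonwasteful_rational[OF assms(2)] assms(3) by blast
  qed
  then show "measure_pmf.prob (f R) {\<mu>. \<mu> i = u} = 0"
    by (auto simp: measure_pmf_zero_iff)
qed

text \<open>Acceptable objects fall under the stronger axiom; unacceptable ones have probability
  zero by individual rationality.\<close>

lemma equal_treatment_of_equals_if_almost_equals: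
  fixes f :: "('n, 'o::finite) mechanism"
  assumes "equal_treatment_of_almost_equals f" "ex_post_weakly_nonwasteful f"
  shows "equal_treatment_of_equals f"
  unfolding equal_treatment_of_equals_def
proof (intro ballI allI impI)
  fix R :: "('n, 'o) profile" and i j a
  assume R: "R \<in> profiles" and eq: "R i = R j"
  show "assign_prob f R i (Some a) = assign_prob f R j (Some a)"
  proof (cases "a \<in> acceptable (R i)")
    case True
    then show ?thesis
      using assms(1)[unfolded equal_treatment_of_almost_equals_def, rule_format, OF R, of i j a] eq
      by simp
  next
    case False
    then have "(Some a, None) \<notin> R i" "(Some a, None) \<notin> R j"
      using eq by (simp_all add: acceptable_iff linear_order_profile[OF R])
    then show ?thesis using assign_prob_unacceptable[OF assms(2) R] by simp
  qed
qed

text \<open>Handing a free element \<open>x\<close> to \<open>i\<close> would be a Pareto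
  improvement.\<close>

lemma efficient_weakly_nonwasteful:
  fixes R :: "('n, 'o) profile"
  assumes R: "R \<in> profiles" and m: "\<mu> \<in> assignments" and eff: "efficient R \<mu>"
  shows "weakly_nonwasteful R \<mu>"
  unfolding weakly_nonwasteful_def
proof (intro allI impI, rule ccontr)
  fix i x
  assume x: "(x, \<mu> i) \<in> R i" "(None, \<mu> i) \<in> R i" and free: "\<not> taken \<mu> i x"
  note lo = linear_orderD[OF linear_order_profile[OF R]]
  have "x \<noteq> \<mu> i" using free by (auto simp: taken_def split: option.splits)
  then have "(x, \<mu> i) \<in> strict (R i)"
    using x strict_linear_order_iff[OF linear_order_profile[OF R, of i]] by simp
  moreover have "\<mu>(i := x) \<in> assignments"
    using m free by (auto simp: assignments_def taken_def split: option.splits)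
  moreover have "((\<mu>(i := x)) j, \<mu> j) \<in> R j" for j
    using x(1) lo(1) by simp
  moreover have "((\<mu>(i := x)) i, \<mu> i) \<in> strict (R i)" using calculation(1) by simp
  ultimately show False
    using eff unfolding efficient_def by blast
qed

lemma ex_post_efficient_weakly_nonwasteful:
  assumes "is_mechanism f" "ex_post_efficient f"
  shows "ex_post_weakly_nonwasteful f"
  unfolding ex_post_weakly_nonwasteful_def
proof (intro ballI)
  fix R \<mu> assume R: "R \<in> profiles" "\<mu> \<in> set_pmf (f R)"
  then have "\<mu> \<in> assignments" "efficient R \<mu>"
    using assms by (auto simp: is_mechanism_def ex_post_efficient_def)
  then show "weakly_nonwasteful R \<mu>" using efficient_weakly_nonwasteful R(1) by blast
qed

section \<open>The waste of random serial dictatorship\<close>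

text \<open>Renaming the agents by \<open>inv s\<close> permutes the priority orders and turns
  \<open>position p\<close> into its composition with \<open>s\<close>.\<close>

lemma card_priorities_relabel:
  fixes s :: "'n::finite \<Rightarrow> 'n"
  assumes "bij s"
  shows "card {p \<in> priorities. Q (position p \<circ> s)} = card {p \<in> priorities. Q (position p)}"
proof -
  have inv: "bij (inv s)" using assms by (rule bij_imp_bij_inv)
  have pos: "position (map (inv s) p) = position p \<circ> s" for p
  proof
    fix a
    have "position (map (inv s) p) (inv s (s a)) = position p (s a)"
      by (rule position_map) (use inv in \<open>simp add: bij_def\<close>)
    then show "position (map (inv s) p) a = (position p \<circ> s) a"
      using assms by (simp add: bij_def inv_f_f)
  qed
  have pos': "position (map s p) \<circ> s = position p" for p
    using position_map[of s p] assms by (auto simp: bij_def fun_eq_iff)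
  have id: "map s (map (inv s) p) = p" "map (inv s) (map s p) = p" for p
    using assms by (simp_all add: comp_def bij_def surj_f_inv_f inv_f_f)
  have "bij_betw (map (inv s)) {p \<in> priorities. Q (position p \<circ> s)} {p \<in> priorities. Q (position p)}"
    by (rule bij_betw_byWitness[where f' = "map s"])
      (use id pos pos' map_priorities[OF assms] map_priorities[OF inv] in auto)
  then show ?thesis by (rule bij_betw_same_card)
qed

text \<open>Relabelled copies of an event are equally large, so \<open>length ss\<close> disjoint
  copies fit into the set of all orders. Disjointness is required for arbitrary injective rank
  functions, which leaves only comparisons of a few natural numbers to be checked.\<close>

lemma card_priorities_copies:
  fixes Q :: "('n::finite \<Rightarrow> nat) \<Rightarrow> bool" and ss :: "('n \<Rightarrow> 'n) list"
  assumes bij: "\<And>s. s \<in> set ss \<Longrightarrow> bij s"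
    and disj: "sorted_wrt (\<lambda>s t. \<forall>r. inj r \<longrightarrow> \<not> (Q (r \<circ> s) \<and> Q (r \<circ> t))) ss"
  shows "length ss * card {p \<in> priorities. Q (position p)} \<le> fact CARD('n)"
proof -
  have inj: "inj (position p)" if "p \<in> priorities" for p :: "'n list"
    using that position_inj[of _ p] by (auto simp: priorities_iff inj_def)
  let ?E = "\<lambda>s. {p \<in> priorities. Q (position p \<circ> s)}"
  have "sum_list (map (\<lambda>s. card (?E s)) ts) = card (\<Union>s\<in>set ts. ?E s)"
    if "sorted_wrt (\<lambda>s t. \<forall>r. inj r \<longrightarrow> \<not> (Q (r \<circ> s) \<and> Q (r \<circ> t))) ts"
    for ts :: "('n \<Rightarrow> 'n) list"
    using that
  proof (induction ts)
    case (Cons t ts)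
    have "\<not> (Q (position p \<circ> t) \<and> Q (position p \<circ> s))" if "p \<in> priorities" "s \<in> set ts"
      for p :: "'n list" and s
      using Cons.prems that inj[OF that(1)] unfolding sorted_wrt.simps by blast
    then have "?E t \<inter> (\<Union>s\<in>set ts. ?E s) = {}" by blast
    then have "card (?E t \<union> (\<Union>s\<in>set ts. ?E s)) = card (?E t) + card (\<Union>s\<in>set ts. ?E s)"
      by (intro card_Un_disjoint) auto
    then show ?case using Cons by (simp add: comp_def)
  qed simp
  moreover have "card (\<Union>s\<in>set ss. ?E s) \<le> card (priorities :: 'n list set)"
    by (rule card_mono) auto
  ultimately have "sum_list (map (\<lambda>s. card (?E s)) ss) \<le> card (priorities :: 'n list set)"
    using disj by simp
  moreover have "sum_list (map (\<lambda>s. card (?E s)) ts) = length ts * card {p \<in> priorities. Q (position p)}"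
    if "set ts \<subseteq> set ss" for ts
    using that by (induction ts) (auto simp: card_priorities_relabel bij)
  ultimately show ?thesis by (simp add: card_priorities)
qed

abbreviation swap :: "'a \<Rightarrow> 'a \<Rightarrow> 'a \<Rightarrow> 'a" where "swap \<equiv> Transposition.transpose"

text \<open>Six copies: \<open>?ss\<close> lists all permutations of the three agents.\<close>

lemma card_chain:
  fixes a b c :: "'n::finite"
  assumes "distinct [a, b, c]"
    and "\<And>p. p \<in> S \<Longrightarrow> p \<in> priorities \<and> position p a < position p b \<and> position p b < position p c"
  shows "6 * card S \<le> fact CARD('n)"
proof -
  let ?Q = "\<lambda>r. r a < r b \<and> r b < (r c :: nat)"
  let ?ss = "[id, swap a b, swap a c, swap b c, swap a b \<circ> swap b c,
        swap b c \<circ> swap a b]"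
  have "\<And>s. s \<in> set ?ss \<Longrightarrow> bij s" by (auto simp: bij_comp)
  moreover have "sorted_wrt (\<lambda>s t. \<forall>r. inj r \<longrightarrow> \<not> (?Q (r \<circ> s) \<and> ?Q (r \<circ> t))) ?ss"
    using assms(1) by (auto simp: Transposition.transpose_def)
  ultimately have "length ?ss * card {p \<in> priorities. ?Q (position p)} \<le> fact CARD('n)"
    by (rule card_priorities_copies)
  then have "6 * card {p \<in> priorities. ?Q (position p)} \<le> fact CARD('n)" by (simp only: list.size) simp
  moreover have "card S \<le> card {p \<in> priorities. ?Q (position p)}"
    using assms(2) by (intro card_mono) auto
  ultimately show ?thesis by linarith
qed

text \<open>Six copies: three choices for the first of \<open>a\<close>, \<open>b\<close>,
  \<open>c\<close> times two orders of \<open>d\<close> and \<open>e\<close>.\<close>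

lemma card_fork_and_edge:
  fixes a b c d e :: "'n::finite"
  assumes "distinct [a, b, c, d, e]"
    and "\<And>p. p \<in> S \<Longrightarrow> p \<in> priorities \<and> position p a < position p b \<and> position p a < position p c \<and>
      position p d < position p e"
  shows "6 * card S \<le> fact CARD('n)"
proof -
  let ?Q = "\<lambda>r. r a < r b \<and> r a < r c \<and> r d < (r e :: nat)"
  let ?ss = "[id, swap a b, swap a c, swap d e, swap a b \<circ> swap d e,
        swap a c \<circ> swap d e]"
  have "\<And>s. s \<in> set ?ss \<Longrightarrow> bij s" by (auto simp: bij_comp)
  moreover have "sorted_wrt (\<lambda>s t. \<forall>r. inj r \<longrightarrow> \<not> (?Q (r \<circ> s) \<and> ?Q (r \<circ> t))) ?ss"
    using assms(1) by (auto simp: Transposition.transpose_def)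
  ultimately have "length ?ss * card {p \<in> priorities. ?Q (position p)} \<le> fact CARD('n)"
    by (rule card_priorities_copies)
  then have "6 * card {p \<in> priorities. ?Q (position p)} \<le> fact CARD('n)" by (simp only: list.size) simp
  moreover have "card S \<le> card {p \<in> priorities. ?Q (position p)}"
    using assms(2) by (intro card_mono) auto
  ultimately show ?thesis by linarith
qed

text \<open>Six copies: one for each choice of the leading pair among four agents.\<close>

lemma card_two_before_two:
  fixes a b c d :: "'n::finite"
  assumes "distinct [a, b, c, d]"
    and "\<And>p. p \<in> S \<Longrightarrow> p \<in> priorities \<and> position p a < position p c \<and> position p a < position p d \<and>
      position p b < position p c \<and> position p b < position p d"
  shows "6 * card S \<le> fact CARD('n)"
proof -
  let ?Q = "\<lambda>r. r a < r c \<and> r a < r d \<and> r b < r c \<and> r b < (r d :: nat)"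
  let ?ss = "[id, swap a c, swap a d, swap b c, swap b d,
        swap a c \<circ> swap b d]"
  have "\<And>s. s \<in> set ?ss \<Longrightarrow> bij s" by (auto simp: bij_comp)
  moreover have "sorted_wrt (\<lambda>s t. \<forall>r. inj r \<longrightarrow> \<not> (?Q (r \<circ> s) \<and> ?Q (r \<circ> t))) ?ss"
    using assms(1) by (auto simp: Transposition.transpose_def)
  ultimately have "length ?ss * card {p \<in> priorities. ?Q (position p)} \<le> fact CARD('n)"
    by (rule card_priorities_copies)
  then have "6 * card {p \<in> priorities. ?Q (position p)} \<le> fact CARD('n)" by (simp only: list.size) simp
  moreover have "card S \<le> card {p \<in> priorities. ?Q (position p)}"
    using assms(2) by (intro card_mono) auto
  ultimately show ?thesis by linarith
qed

section \<open>The configuration behind waste\<close>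

context
  fixes R :: "('n::finite, 'o::finite) profile"
  assumes R: "R \<in> profiles"
begin

abbreviation "sd p \<equiv> serial_dictatorship p R"

abbreviation "better i u v \<equiv> (u, v) \<in> strict (R i)"

lemma better_iff: "better i u v \<longleftrightarrow> (u, v) \<in> R i \<and> u \<noteq> v"
  by (rule strict_linear_order_iff[OF linear_order_profile[OF R]])

lemma better_trans: "better i u v \<Longrightarrow> better i v w \<Longrightarrow> better i u w"
  using linear_orderD(2,3)[OF linear_order_profile[OF R, of i]] unfolding better_iff by metis

lemma better_asym: "better i u v \<Longrightarrow> \<not> better i v u"
  using linear_orderD(3)[OF linear_order_profile[OF R, of i]] unfolding better_iff by metis

lemma better_total: "u \<noteq> v \<Longrightarrow> better i u v \<or> better i v u"
  using linear_orderD(4)[OF linear_order_profile[OF R, of i]] unfolding better_iff by metis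

lemma sd_inj: "sd p a = Some u \<Longrightarrow> sd p b = Some u \<Longrightarrow> a = b"
  using serial_dictatorship_inj[OF R] .

lemma sd_acceptable: "sd p a = Some u \<Longrightarrow> better a (Some u) None"
  using serial_dictatorship_rational[OF R, of p a] by (simp add: better_iff)

lemma sd_envy:
  assumes "p \<in> priorities" "better i (Some u) (sd p i)"
  obtains j where "position p j < position p i" "sd p j = Some u"
proof -
  have "(sd p i, Some u) \<notin> R i" using assms(2) by (simp add: strict_def)
  then show ?thesis using serial_dictatorship_envy[OF R assms(1)] that by blast
qed

lemma sd_left_over:
  assumes "q \<in> priorities" "\<And>j. sd q j \<noteq> Some w" "better i (Some w) None"
  obtains u where "sd q i = Some u" "better i (Some u) (Some w)" "u \<noteq> w"
proof -
  have "\<not> better i (Some w) (sd q i)" using sd_envy[OF assms(1), where i = i and u = w] assms(2) by metis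
  then have b: "better i (sd q i) (Some w)" using better_total assms(2) by metis
  then have "sd q i \<noteq> None" using better_asym assms(3) by metis
  then show ?thesis using b that assms(2) by force
qed

text \<open>
  The configuration behind any waste: when \<open>i\<close> is unassigned under the order \<open>p\<close>, the object \<open>w\<close> that
  is left over under the order \<open>q\<close> is taken by some \<open>b\<close>, who must have been preceded by a taker \<open>c\<close>
  of the object that \<open>b\<close> receives under \<open>q\<close>.
\<close>

lemma waste_configuration:
  assumes p: "p \<in> priorities" "sd p i = None"
    and q: "q \<in> priorities" "\<And>j. sd q j \<noteq> Some w"
    and w: "better i (Some w) None"
  obtains x s a b c where
    "sd q i = Some x" "better i (Some x) (Some w)" "sd q b = Some s" "better b (Some s) (Some w)"
    "sd p a = Some x" "sd p b = Some w" "sd p c = Some s"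
    "position p c < position p b" "position p b < position p i" "position p a < position p i"
    "distinct [a, b, c, i]" "distinct [x, s, w]"
proof -
  obtain x where x: "sd q i = Some x" "better i (Some x) (Some w)" "x \<noteq> w"
    using sd_left_over[OF q w] by metis
  obtain b where b: "position p b < position p i" "sd p b = Some w"
    using sd_envy[OF p(1), where i = i and u = w] w p(2) by metis
  have "better i (Some x) None" using better_trans x(2) w by blast
  then obtain a where a: "position p a < position p i" "sd p a = Some x"
    using sd_envy[OF p(1), where i = i and u = x] p(2) by metis
  obtain s where s: "sd q b = Some s" "better b (Some s) (Some w)" "s \<noteq> w"
    using sd_left_over[OF q sd_acceptable[OF b(2)]] by metis
  obtain c where c: "position p c < position p b" "sd p c = Some s"
    using sd_envy[OF p(1), where i = b and u = s] s(2) b(2) by metis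
  have bi: "b \<noteq> i" using b(1) by auto
  then have sx: "s \<noteq> x" using sd_inj s(1) x(1) by metis
  \<comment> \<open>Under \<open>p\<close> the agents \<open>a\<close>, \<open>b\<close>,
    \<open>c\<close> hold the different objects \<open>x\<close>, \<open>w\<close>,
    \<open>s\<close>, while \<open>i\<close> holds nothing.\<close>
  have "distinct [a, b, c, i]" using a b c bi sx x(3) s(3) p(2) by auto
  moreover have "distinct [x, s, w]" using sx x(3) s(3) by auto
  ultimately show ?thesis using that x s a b c by blast
qed

lemma choice_best:
  assumes "choice (R a) UNIV \<noteq> u"
  shows "better a (choice (R a) UNIV) u"
proof -
  have "u \<in> insert None (Some ` UNIV)" by (cases u) auto
  then have "(choice (R a) UNIV, u) \<in> R a"
    unfolding choice_def by (intro best_least[OF linear_order_profile[OF R]]) simp_all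
  then show ?thesis using assms by (simp add: better_iff)
qed

lemma sd_first: "sd (a # p) a = choice (R a) UNIV"
  by (simp add: serial_dictatorship_def Let_def choice_def)

section \<open>Bounding the waste with four agents\<close>

context
  fixes i q w
  assumes four: "CARD('n) = 4"
    and q: "q \<in> priorities" "\<And>j. sd q j \<noteq> Some w"
    and w: "better i (Some w) None"
begin

lemma four_agents: "distinct [a, b, c, i] \<Longrightarrow> j \<in> {a, b, c, i}"
proof (rule ccontr)
  assume "distinct [a, b, c, i]" "j \<notin> {a, b, c, i}"
  then have "card {a, b, c, i, j} = 5" by auto
  moreover have "card {a, b, c, i, j} \<le> CARD('n)" by (rule card_mono) auto
  ultimately show False using four by simp
qed

lemma four_priorities: "distinct [a, b, c, i] \<Longrightarrow> [a, b, c, i] \<in> priorities"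
  using four_agents[of a b c] by (auto simp: priorities_iff)

text \<open>The holders of the three objects in the configuration all precede \<open>i\<close>,
  which leaves nobody to come after \<open>i\<close>.\<close>

lemma unassigned_last:
  assumes p: "p \<in> priorities" "sd p i = None"
  obtains a b c where "p = [a, b, c, i]" "distinct [a, b, c, i]"
proof -
  obtain a b c where abc: "distinct [a, b, c, i]" "position p a < position p i"
      "position p b < position p i" "position p c < position p b"
    by (rule waste_configuration[OF p q w]) blast
  have "length p = 4" using p(1) four by (metis distinct_card priorities_iff)
  then obtain p0 p1 p2 p3 where p4: "p = [p0, p1, p2, p3]"
    by (auto simp: numeral_eq_Suc length_Suc_conv)
  have dist: "distinct [p0, p1, p2, p3]" using p(1) p4 by (simp add: priorities_iff)
  have mem: "k \<in> {p0, p1, p2, p3}" for k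
    using p(1) p4 by (auto simp: priorities_iff)
  have "p3 = i"
    using mem[of a] mem[of b] mem[of c] mem[of i] abc dist unfolding p4 by auto
  then show ?thesis using that[of p0 p1 p2] p4 dist by simp
qed

text \<open>The holder of \<open>w\<close> comes after the holder of \<open>s\<close>. Of the six
  ways to distribute the three roles over the first three places, these three remain.\<close>

lemma unassigned_cases:
  assumes abc: "distinct [a, b, c, i]" and none: "sd [a, b, c, i] i = None"
  obtains
      s where "sd [a, b, c, i] a = sd q i" "sd [a, b, c, i] b = Some s" "sd [a, b, c, i] c = Some w"
      "sd q c = Some s" "better c (Some s) (Some w)"
    | s where "sd [a, b, c, i] a = Some s" "sd [a, b, c, i] b = Some w" "sd [a, b, c, i] c = sd q i"
      "sd q b = Some s" "better b (Some s) (Some w)"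
    | s where "sd [a, b, c, i] a = Some s" "sd [a, b, c, i] b = sd q i" "sd [a, b, c, i] c = Some w"
      "sd q c = Some s" "better c (Some s) (Some w)"
proof -
  note p = four_priorities[OF abc]
  obtain x s a' b' c' where *: "sd q i = Some x" "sd q b' = Some s" "better b' (Some s) (Some w)"
    "sd [a, b, c, i] a' = Some x" "sd [a, b, c, i] b' = Some w" "sd [a, b, c, i] c' = Some s"
    "position [a, b, c, i] c' < position [a, b, c, i] b'" "distinct [a', b', c', i]"
    by (rule waste_configuration[OF p none q w]) blast
  have "a' \<in> {a, b, c, i}" "b' \<in> {a, b, c, i}" "c' \<in> {a, b, c, i}"
    using four_agents[OF abc] by blast+
  then consider "a' = a" "c' = b" "b' = c" | "a' = b" "c' = a" "b' = c" | "a' = c" "c' = a" "b' = b"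
    using * abc by (auto split: if_splits)
  then show ?thesis
    by cases (use that * in auto)
qed

lemma sd_q_i: "\<exists>x. sd q i = Some x"
  using sd_left_over[OF q w] by metis

lemma sd_third:
  assumes "distinct [a, b, c, i]" "sd [a, b, c, i] a \<noteq> Some u" "sd [a, b, c, i] b \<noteq> Some u"
  shows "\<not> better c (Some u) (sd [a, b, c, i] c)"
proof
  assume "better c (Some u) (sd [a, b, c, i] c)"
  then obtain j where "position [a, b, c, i] j < position [a, b, c, i] c" "sd [a, b, c, i] j = Some u"
    by (rule sd_envy[OF four_priorities[OF assms(1)]])
  then show False using assms by (auto split: if_splits)
qed

lemma sd_second:
  assumes "distinct [a, b, c, i]" "sd [a, b, c, i] a \<noteq> Some u"
  shows "\<not> better b (Some u) (sd [a, b, c, i] b)"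
proof
  assume "better b (Some u) (sd [a, b, c, i] b)"
  then obtain j where "position [a, b, c, i] j < position [a, b, c, i] b" "sd [a, b, c, i] j = Some u"
    by (rule sd_envy[OF four_priorities[OF assms(1)]])
  then show False using assms by (auto split: if_splits)
qed

lemma sd_q_neq: "k \<noteq> l \<Longrightarrow> sd q k = Some u \<Longrightarrow> sd q l \<noteq> Some u"
  using sd_inj by blast

text \<open>Once \<open>a\<close> has taken what \<open>i\<close> receives under \<open>q\<close>,
  the second agent must take what the third receives under \<open>q\<close>. So \<open>c\<close>,
  choosing second, prefers \<open>t\<close> to the available \<open>s\<close>; choosing third,
  \<open>c\<close> settles for \<open>w\<close>, worse than \<open>s\<close>, although
  \<open>t\<close> is free.\<close>

lemma first_takes_i:
  assumes abc: "distinct [a, b, c, i]" and top: "choice (R a) UNIV = sd q i"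
    and none: "sd [a, b, c, i] i = None" "sd [a, c, b, i] i = None"
  shows False
proof -
  have acb: "distinct [a, c, b, i]" using abc by auto
  obtain x where x: "sd q i = Some x" using sd_q_i by blast
  have ne: "sd q k \<noteq> Some x" if "k \<noteq> i" for k using sd_inj x that by metis
  have a: "sd [a, b, c, i] a = Some x" "sd [a, c, b, i] a = Some x" using top x by (simp_all add: sd_first)
  obtain s where s: "sd [a, b, c, i] b = Some s" "sd [a, b, c, i] c = Some w" "sd q c = Some s"
      "better c (Some s) (Some w)"
    by (rule unassigned_cases[OF abc none(1)]) (use a(1) ne[of b] ne[of c] abc in auto)
  obtain t where t: "sd [a, c, b, i] c = Some t" "sd q b = Some t"
    by (rule unassigned_cases[OF acb none(2)]) (use a(2) ne[of b] ne[of c] abc in auto)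
  have neq: "s \<noteq> x" "t \<noteq> x" "s \<noteq> t"
    using ne[of b] ne[of c] sd_inj[of q b s c] s(3) t(2) abc by auto
  have "\<not> better c (Some s) (Some t)" using sd_second[OF acb, of s] a(2) t(1) neq by simp
  then have "better c (Some t) (Some s)" using better_total neq by blast
  then have "better c (Some t) (Some w)" using better_trans s(4) by blast
  then show False using sd_third[OF abc, of t] a(1) s(1,2) neq by simp
qed

text \<open>Here \<open>a\<close> takes what \<open>b\<close> receives under \<open>q\<close>, and
  \<open>b\<close> settles for \<open>w\<close>. Any other first choice of \<open>b\<close> would
  still have been available.\<close>

lemma first_takes_second:
  assumes abc: "distinct [a, b, c, i]" and top: "choice (R a) UNIV = sd q b"
    and none: "sd [a, b, c, i] i = None"
  shows "choice (R b) UNIV = sd q b" "sd q b \<noteq> None"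
proof -
  obtain x where x: "sd q i = Some x" using sd_q_i by blast
  have a: "sd [a, b, c, i] a = sd q b" using top by (simp add: sd_first)
  obtain s where s: "sd [a, b, c, i] a = Some s" "sd [a, b, c, i] b = Some w" "sd q b = Some s"
      "better b (Some s) (Some w)"
    by (rule unassigned_cases[OF abc none]) (use a x sd_q_neq[of b i] sd_q_neq[of b c] abc in auto)
  show "choice (R b) UNIV = sd q b"
  proof (rule ccontr)
    assume ne: "choice (R b) UNIV \<noteq> sd q b"
    then have b: "better b (choice (R b) UNIV) (Some w)" using choice_best s(3,4) better_trans by metis
    then have "choice (R b) UNIV \<noteq> None"
      using sd_acceptable[OF s(2)] better_asym by metis
    then obtain t where "choice (R b) UNIV = Some t" by blast
    then show False using sd_second[OF abc, of t] b s ne by simp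
  qed
  show "sd q b \<noteq> None" using s by simp
qed

text \<open>Here \<open>a\<close> and \<open>b\<close> take what \<open>c\<close> and
  \<open>i\<close> receive under \<open>q\<close>, and \<open>c\<close> settles for
  \<open>w\<close>. Any first choice of \<open>c\<close> besides these two objects would still have
  been available.\<close>

lemma first_takes_third:
  assumes abc: "distinct [a, b, c, i]" and top: "choice (R a) UNIV = sd q c"
    and none: "sd [a, b, c, i] i = None"
  shows "choice (R c) UNIV = sd q c \<or> choice (R c) UNIV = sd q i" "sd q c \<noteq> None"
proof -
  obtain x where x: "sd q i = Some x" using sd_q_i by blast
  have a: "sd [a, b, c, i] a = sd q c" using top by (simp add: sd_first)
  obtain s where s: "sd [a, b, c, i] a = Some s" "sd [a, b, c, i] b = sd q i"
      "sd [a, b, c, i] c = Some w" "sd q c = Some s" "better c (Some s) (Some w)"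
    by (rule unassigned_cases[OF abc none]) (use a x sd_q_neq[of c i] sd_q_neq[of b c] abc in auto)
  show "choice (R c) UNIV = sd q c \<or> choice (R c) UNIV = sd q i"
  proof (rule ccontr)
    assume ne: "\<not> ?thesis"
    then have b: "better c (choice (R c) UNIV) (Some w)" using choice_best s(4,5) better_trans by metis
    then have "choice (R c) UNIV \<noteq> None"
      using sd_acceptable[OF s(3)] better_asym by metis
    then obtain t where t: "choice (R c) UNIV = Some t" by blast
    have "sd q i \<noteq> Some t" "s \<noteq> t" using ne t s(4) by metis+
    then show False using sd_third[OF abc, of t] b s t by simp
  qed
  show "sd q c \<noteq> None" using s by simp
qed

text \<open>In all three cases that leave \<open>i\<close> out, the first agent takes what somebody
  else receives under \<open>q\<close>.\<close>

lemma first_takes_own: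
  assumes abc: "distinct [a, b, c, i]" and top: "choice (R a) UNIV = sd q a" "sd q a \<noteq> None"
  shows "sd [a, b, c, i] i \<noteq> None"
proof
  assume none: "sd [a, b, c, i] i = None"
  have "sd [a, b, c, i] a = sd q a" using top by (simp add: sd_first)
  with top show False
    by - (rule unassigned_cases[OF abc none], use sd_q_i sd_q_neq[of a i] sd_q_neq[of a b] sd_q_neq[of a c] abc in auto)
qed

text \<open>Suppose that at most one order with \<open>i\<close> last serves \<open>i\<close>. Then
  some \<open>a0\<close> has as first choice what another agent \<open>b\<close> receives under
  \<open>q\<close>, and the first choice of \<open>b\<close> is what \<open>b\<close> or
  \<open>i\<close> receives under \<open>q\<close>. Either alternative leads to two orders that
  serve \<open>i\<close>.\<close>

lemma two_orders_assign:
  obtains a b c a' b' c' where "distinct [a, b, c, i]" "distinct [a', b', c', i]"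
    "[a, b, c, i] \<noteq> [a', b', c', i]" "sd [a, b, c, i] i \<noteq> None" "sd [a', b', c', i] i \<noteq> None"
proof (rule ccontr)
  assume "\<not> thesis"
  then have H: "sd [a, b, c, i] i = None \<or> sd [a', b', c', i] i = None"
    if "distinct [a, b, c, i]" "distinct [a', b', c', i]" "[a, b, c, i] \<noteq> [a', b', c', i]" for a b c a' b' c'
    using that \<open>\<And>a b c a' b' c'. distinct [a, b, c, i] \<Longrightarrow> distinct [a', b', c', i] \<Longrightarrow>
      [a, b, c, i] \<noteq> [a', b', c', i] \<Longrightarrow> sd [a, b, c, i] i \<noteq> None \<Longrightarrow> sd [a', b', c', i] i \<noteq> None \<Longrightarrow> thesis\<close>
    by blast
  have "card (UNIV - {i}) = 3" using four by simp
  then obtain j k l where "UNIV - {i} = {j, k, l}" "distinct [j, k, l]"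
    unfolding card_3_iff by auto
  then have jkl: "distinct [j, k, l, i]" by auto
  \<comment> \<open>Otherwise \<open>first_takes_i\<close>, applied with \<open>j\<close> and with
    \<open>k\<close> in the lead, gives two orders that serve \<open>i\<close>.\<close>
  have "\<exists>a. a \<noteq> i \<and> choice (R a) UNIV \<noteq> sd q i"
  proof (rule ccontr)
    assume "\<not> ?thesis"
    then have "choice (R j) UNIV = sd q i" "choice (R k) UNIV = sd q i" using jkl by auto
    then have "sd [j, k, l, i] i \<noteq> None \<or> sd [j, l, k, i] i \<noteq> None"
      "sd [k, j, l, i] i \<noteq> None \<or> sd [k, l, j, i] i \<noteq> None"
      using first_takes_i[of j k l] first_takes_i[of k j l] jkl by auto
    then show False
      using H[of j k l k j l] H[of j k l k l j] H[of j l k k j l] H[of j l k k l j] jkl by auto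
  qed
  then obtain a0 where a0: "a0 \<noteq> i" "choice (R a0) UNIV \<noteq> sd q i" by blast
  have "\<exists>b c. distinct [a0, b, c, i]" using jkl four_agents[OF jkl, of a0] a0(1) by auto
  then obtain b0 c0 where 0: "distinct [a0, b0, c0, i]" by blast
  have "\<exists>b c. distinct [a0, b, c, i] \<and> choice (R a0) UNIV = sd q b"
  proof -
    have first: "sd [a0, b, c, i] a0 = choice (R a0) UNIV" for b c by (rule sd_first)
    have "sd [a0, b0, c0, i] i = None \<or> sd [a0, c0, b0, i] i = None"
      using H[of a0 b0 c0 a0 c0 b0] 0 by auto
    then have "choice (R a0) UNIV = sd q b0 \<or> choice (R a0) UNIV = sd q c0"
    proof
      assume none: "sd [a0, b0, c0, i] i = None"
      show ?thesis by (rule unassigned_cases[OF 0 none]) (use first[of b0 c0] a0(2) in auto)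
    next
      assume none: "sd [a0, c0, b0, i] i = None"
      have "distinct [a0, c0, b0, i]" using 0 by auto
      then show ?thesis
        by - (rule unassigned_cases[OF _ none], use first[of c0 b0] a0(2) in auto)
    qed
    moreover have "distinct [a0, c0, b0, i]" using 0 by auto
    ultimately show ?thesis using 0 by blast
  qed
  then obtain b c where abc: "distinct [a0, b, c, i]" and top: "choice (R a0) UNIV = sd q b" by blast
  have dist: "distinct [a0, c, b, i]" "distinct [b, a0, c, i]" "distinct [b, c, a0, i]" using abc by auto
  \<comment> \<open>By \<open>first_takes_own\<close>, both orders that start with \<open>b\<close>
    would serve \<open>i\<close>.\<close>
  have own: False if "choice (R b) UNIV = sd q b" "sd q b \<noteq> None"
    using first_takes_own[OF dist(2) that] first_takes_own[OF dist(3) that]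
      H[OF dist(2,3)] abc by auto
  show False
  proof (cases "sd [a0, b, c, i] i = None")
    case True
    then show False using first_takes_second[OF abc top] own by blast
  next
    case False
    then have "sd [a0, c, b, i] i = None" using H[OF abc dist(1)] abc by auto
    from first_takes_third[OF dist(1) top this] own have top_b: "choice (R b) UNIV = sd q i" by blast
    \<comment> \<open>One of these orders and \<open>[a0, b, c, i]\<close> are the two orders
      sought.\<close>
    have "sd [b, a0, c, i] i \<noteq> None \<or> sd [b, c, a0, i] i \<noteq> None"
      using first_takes_i[OF dist(2) top_b] by blast
    then show False using H[OF abc dist(2)] H[OF abc dist(3)] False abc by auto
  qed
qed

lemma card_unassigned_four: "6 * card {p \<in> priorities. sd p i = None} \<le> fact CARD('n)"
proof -
  let ?O = "(\<lambda>l. l @ [i]) ` permutations_of_set (UNIV - {i})"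
  obtain a b c a' b' c' where two: "distinct [a, b, c, i]" "distinct [a', b', c', i]"
    "[a, b, c, i] \<noteq> [a', b', c', i]" "sd [a, b, c, i] i \<noteq> None" "sd [a', b', c', i] i \<noteq> None"
    by (rule two_orders_assign)
  have mem: "[a, b, c, i] \<in> ?O" if abc: "distinct [a, b, c, i]" for a b c
  proof -
    have "[a, b, c] \<in> permutations_of_set (UNIV - {i})"
      using abc four_agents[OF abc] by (auto simp: permutations_of_set_def)
    then show ?thesis by (intro image_eqI[of _ _ "[a, b, c]"]) simp_all
  qed
  have "{p \<in> priorities. sd p i = None} \<subseteq> ?O - {[a, b, c, i], [a', b', c', i]}"
  proof
    fix p assume p: "p \<in> {p \<in> priorities. sd p i = None}"
    then obtain d e g where "p = [d, e, g, i]" "distinct [d, e, g, i]"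
      by (auto elim: unassigned_last)
    then show "p \<in> ?O - {[a, b, c, i], [a', b', c', i]}" using mem p two by auto
  qed
  then have "card {p \<in> priorities. sd p i = None} \<le> card (?O - {[a, b, c, i], [a', b', c', i]})"
    by (intro card_mono) auto
  \<comment> \<open>The count just suffices: \<open>6 * (6 - 2)\<close> is
    \<open>4!\<close>.\<close>
  also have "\<dots> = card ?O - 2"
    using two mem[OF two(1)] mem[OF two(2)] by (subst card_Diff_subset) auto
  also have "card ?O = 6"
    using four by (subst card_image) (auto simp: inj_on_def fact_numeral)
  finally show ?thesis using four by (simp add: fact_numeral)
qed

end

section \<open>Bounding the waste with three objects\<close>

context
  fixes i q0 p0 w
  assumes three: "CARD('o) = 3"
    and q0: "q0 \<in> priorities" "\<And>j. sd q0 j \<noteq> Some w"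
    and p0: "p0 \<in> priorities" "sd p0 i = None"
    and w: "better i (Some w) None"
begin

lemma waste_bound_three:
  "6 * card {p \<in> priorities. sd p i = None} \<le> fact CARD('n) \<or>
   6 * card {q \<in> priorities. \<forall>j. sd q j \<noteq> Some w} \<le> fact CARD('n)"
proof -
  let ?U = "{p \<in> priorities. sd p i = None}" and ?V = "{q \<in> priorities. \<forall>j. sd q j \<noteq> Some w}"
  obtain x y k0 j l0 where
    x: "sd q0 i = Some x" "better i (Some x) (Some w)" and
    y: "sd q0 j = Some y" "better j (Some y) (Some w)" and
    p0': "sd p0 k0 = Some x" "sd p0 j = Some w" "sd p0 l0 = Some y" and
    agents: "distinct [k0, j, l0, i]" and objects: "distinct [x, y, w]"
    by (rule waste_configuration[OF p0 q0 w]) blast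
  have "card {x, y, w} = CARD('o)" using objects three by simp
  then have UNIV: "{x, y, w} = UNIV" by (intro card_subset_eq) auto
  have jw: "better j (Some w) None" using sd_acceptable[OF p0'(2)] .
  \<comment> \<open>Under \<open>q0\<close> whoever accepts \<open>w\<close> holds one of the other
    two objects, and these belong to \<open>i\<close> and \<open>j\<close>.\<close>
  have likers: "c = i \<or> c = j" if c: "better c (Some w) None" for c
  proof -
    obtain u where "sd q0 c = Some u" "u \<noteq> w" using sd_left_over[OF q0 c] by metis
    moreover have "u \<in> {x, y, w}" using UNIV by blast
    ultimately show ?thesis using sd_inj x(1) y(1) by blast
  qed
  \<comment> \<open>The rivals for \<open>x\<close> and \<open>y\<close>. When \<open>i\<close> is
    unassigned, \<open>x\<close> and \<open>y\<close> are held by members of \<open>X\<close> and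
    \<open>Y\<close>; when \<open>w\<close> is left over, all rivals are unassigned.\<close>
  define X where "X = {c. c \<noteq> i \<and> c \<noteq> j \<and> better c (Some x) None}"
  define Y where "Y = {c. c \<noteq> i \<and> c \<noteq> j \<and> better c (Some y) None}"
  have U: "\<exists>k l. k \<in> X \<and> l \<in> Y \<and> k \<noteq> l \<and> position p k < position p i \<and>
      position p l < position p j \<and> position p j < position p i \<and>
      (better j (Some x) (Some w) \<longrightarrow> position p k < position p j)" if p: "p \<in> ?U" for p
  proof -
    have pp: "p \<in> priorities" "sd p i = None" using p by auto
    obtain x' s k b l where *: "sd q0 i = Some x'" "sd q0 b = Some s"
      "sd p k = Some x'" "sd p b = Some w" "sd p l = Some s"
      "position p l < position p b" "position p b < position p i" "position p k < position p i"
      "distinct [k, b, l, i]"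
      by (rule waste_configuration[OF pp q0 w]) blast
    have "b = j" using likers[OF sd_acceptable[OF *(4)]] *(9) by auto
    then have **: "x' = x" "s = y" using * x y by auto
    have "position p k < position p j" if b: "better j (Some x) (Some w)"
    proof -
      obtain k' where "position p k' < position p j" "sd p k' = Some x"
        using sd_envy[OF pp(1), where i = j and u = x] b * \<open>b = j\<close> by metis
      then show ?thesis using sd_inj *(3) ** by metis
    qed
    then show ?thesis
      using * ** \<open>b = j\<close> sd_acceptable[OF *(3)] sd_acceptable[OF *(5)]
      by (intro exI[of _ k] exI[of _ l]) (auto simp: X_def Y_def)
  qed
  have V: "sd q i = Some x \<and> sd q j = Some y \<or> sd q i = Some y \<and> sd q j = Some x \<and>
      better i (Some y) (Some w) \<and> better j (Some x) (Some w)" if q: "q \<in> ?V" for q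
  proof -
    have qq: "q \<in> priorities" "\<And>j. sd q j \<noteq> Some w" using q by auto
    obtain u where u: "sd q i = Some u" "better i (Some u) (Some w)" "u \<noteq> w"
      using sd_left_over[OF qq w] by metis
    obtain v where v: "sd q j = Some v" "better j (Some v) (Some w)" "v \<noteq> w"
      using sd_left_over[OF qq jw] by metis
    have "u \<in> {x, y, w}" "v \<in> {x, y, w}" using UNIV by blast+
    moreover have "u \<noteq> v" using sd_inj[of q i u j] u(1) v(1) agents by auto
    ultimately show ?thesis using u v by auto
  qed
  \<comment> \<open>A rival is unassigned under \<open>q\<close>, so every object acceptable to it
    was chosen before its turn.\<close>
  have after: "position q h < position q c"
    if q: "q \<in> ?V" and u: "sd q h = Some u" "c \<noteq> i" "c \<noteq> j" "better c (Some u) None" for q h c u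
  proof -
    have none: "sd q c = None"
    proof (rule ccontr)
      assume "sd q c \<noteq> None"
      then obtain v where v: "sd q c = Some v" by blast
      then have "v \<in> {x, y, w}" "v \<noteq> w" using UNIV q by auto
      then have "sd q i = Some v \<or> sd q j = Some v" using V[OF q] by auto
      then show False using sd_inj v u(2,3) by metis
    qed
    have "q \<in> priorities" using q by simp
    then obtain h' where "position q h' < position q c" "sd q h' = Some u"
      using sd_envy[where p = q and i = c and u = u] none u(4) by metis
    then show ?thesis using sd_inj u(1) by metis
  qed
  have p0U: "p0 \<in> ?U" using p0 by simp
  show ?thesis
  \<comment> \<open>The question is whether \<open>i\<close> and \<open>j\<close> can also hold the
    two objects the other way round while \<open>w\<close> is left over.\<close>
  proof (cases "\<exists>q1\<in>?V. sd q1 i = Some y")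
    case False
    then have type_A: "sd q i = Some x" "sd q j = Some y" if "q \<in> ?V" for q using V[OF that] that by blast+
    have beforeX: "position q i < position q c" if "q \<in> ?V" "c \<in> X" for q c
      using after[OF that(1) type_A(1)[OF that(1)]] that(2) by (auto simp: X_def)
    have beforeY: "position q j < position q c" if "q \<in> ?V" "c \<in> Y" for q c
      using after[OF that(1) type_A(2)[OF that(1)]] that(2) by (auto simp: Y_def)
    obtain k l where kl: "k \<in> X" "l \<in> Y" "k \<noteq> l" using U[OF p0U] by blast
    have dist: "distinct [i, k, j, l]" using kl agents by (auto simp: X_def Y_def)
    \<comment> \<open>A further rival, or two agents that are rivals for both objects, give enough
      constraints on \<open>?V\<close>. Otherwise \<open>l\<close> is the only possible taker of
      \<open>y\<close>, and \<open>?U\<close> is constrained instead.\<close>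
    consider c where "c \<in> X" "c \<noteq> k" "c \<noteq> l" | c where "c \<in> Y" "c \<noteq> k" "c \<noteq> l"
      | "k \<in> Y" "l \<in> X" | "X \<subseteq> {k, l}" "Y \<subseteq> {k, l}" "\<not> (k \<in> Y \<and> l \<in> X)" by blast
    then show ?thesis
    proof cases
      case 1
      have "6 * card ?V \<le> fact CARD('n)"
        by (rule card_fork_and_edge[of i k c j l])
          (use dist 1 kl beforeX beforeY in \<open>auto simp: X_def\<close>)
      then show ?thesis by simp
    next
      case 2
      have "6 * card ?V \<le> fact CARD('n)"
        by (rule card_fork_and_edge[of j l c i k])
          (use dist 2 kl beforeX beforeY in \<open>auto simp: Y_def\<close>)
      then show ?thesis by simp
    next
      case 3
      have "6 * card ?V \<le> fact CARD('n)"
        by (rule card_two_before_two[of i j k l]) (use dist 3 kl beforeX beforeY in auto)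
      then show ?thesis by simp
    next
      case 4
      have "position p l < position p j \<and> position p j < position p i" if p: "p \<in> ?U" for p
      proof -
        obtain k' l' where "k' \<in> X" "l' \<in> Y" "k' \<noteq> l'" "position p l' < position p j"
            "position p j < position p i" using U[OF p] by blast
        \<comment> \<open>If \<open>l'\<close> were \<open>k\<close>, then \<open>k\<close> would
          lie in \<open>Y\<close> and \<open>k'\<close>, being different, would be \<open>l\<close>
          and lie in \<open>X\<close>; this is excluded.\<close>
        moreover have "l' = l" using calculation(1-3) 4 by blast
        ultimately show ?thesis by simp
      qed
      then have "6 * card ?U \<le> fact CARD('n)"
        by (intro card_chain[of l j i]) (use dist in auto)
      then show ?thesis by simp
    qed
  next
    case True
    then obtain q1 where q1: "q1 \<in> ?V" "sd q1 i = Some y" by blast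
    have type_B: "sd q1 j = Some x" "better i (Some y) (Some w)" "better j (Some x) (Some w)"
      using V[OF q1(1)] q1(2) objects by auto
    have q0V: "q0 \<in> ?V" using q0 by simp
    have swapped: "position q b < position q a"
      if "q \<in> ?V" "sd q a = Some u" "sd q b = Some v" "better a (Some v) (Some u)" for q a b u v
    proof -
      have "q \<in> priorities" "better a (Some v) (sd q a)" using that by simp_all
      then obtain b' where "position q b' < position q a" "sd q b' = Some v" by (rule sd_envy)
      then show ?thesis using sd_inj that(3) by metis
    qed
    have xy: "Some x \<noteq> Some y" using objects by simp
    \<comment> \<open>With opposite tastes \<open>i\<close> and \<open>j\<close> would envy each
      other, at \<open>q1\<close> or at \<open>q0\<close>, and each would come after the
      other.\<close>
    have "better i (Some x) (Some y) \<longleftrightarrow> better j (Some x) (Some y)"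
    proof -
      have "\<not> (better i (Some x) (Some y) \<and> better j (Some y) (Some x))"
        using swapped[OF q1(1,2) type_B(1)] swapped[OF q1(1) type_B(1) q1(2)] by force
      moreover have "\<not> (better i (Some y) (Some x) \<and> better j (Some x) (Some y))"
        using swapped[OF q0V x(1) y(1)] swapped[OF q0V y(1) x(1)] by force
      ultimately show ?thesis using better_total[OF xy] better_asym by blast
    qed
    then consider "better i (Some x) (Some y)" "better j (Some x) (Some y)"
      | "better i (Some y) (Some x)" "better j (Some y) (Some x)"
      using better_total[OF xy] by blast
    then show ?thesis
    proof cases
      case 1
      \<comment> \<open>Both prefer \<open>x\<close>, so the later of the two holds
        \<open>y\<close>, and rivals for \<open>y\<close> come later still.\<close>
      have before: "position q i < position q c \<and> position q j < position q c"
        if q: "q \<in> ?V" and c: "c \<in> Y" for q c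
        using V[OF q]
      proof (elim disjE conjE)
        assume a: "sd q i = Some x" "sd q j = Some y"
        have "position q i < position q j" using swapped[OF q a(2,1) 1(2)] .
        moreover have "position q j < position q c" using after[OF q a(2)] c by (auto simp: Y_def)
        ultimately show ?thesis by simp
      next
        assume a: "sd q i = Some y" "sd q j = Some x"
        have "position q j < position q i" using swapped[OF q a 1(1)] .
        moreover have "position q i < position q c" using after[OF q a(1)] c by (auto simp: Y_def)
        ultimately show ?thesis by simp
      qed
      obtain l where l: "l \<in> Y" using U[OF p0U] by blast
      show ?thesis
      proof (cases "\<exists>c\<in>Y. c \<noteq> l")
        case True
        then obtain c where "c \<in> Y" "c \<noteq> l" by blast
        then have "6 * card ?V \<le> fact CARD('n)"
          by (intro card_two_before_two[of i j l c]) (use l agents before in \<open>auto simp: Y_def\<close>)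
        then show ?thesis by simp
      next
        case False
        have "position p l < position p j \<and> position p j < position p i" if p: "p \<in> ?U" for p
          using U[OF p] False by metis
        then have "6 * card ?U \<le> fact CARD('n)"
          by (intro card_chain[of l j i]) (use l agents in \<open>auto simp: Y_def\<close>)
        then show ?thesis by simp
      qed
    next
      case 2
      \<comment> \<open>The same with \<open>x\<close> and \<open>y\<close> exchanged: the later of
        the two holds \<open>x\<close>.\<close>
      have before: "position q i < position q c \<and> position q j < position q c"
        if q: "q \<in> ?V" and c: "c \<in> X" for q c
        using V[OF q]
      proof (elim disjE conjE)
        assume a: "sd q i = Some x" "sd q j = Some y"
        have "position q j < position q i" using swapped[OF q a 2(1)] .
        moreover have "position q i < position q c" using after[OF q a(1)] c by (auto simp: X_def)
        ultimately show ?thesis by simp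
      next
        assume a: "sd q i = Some y" "sd q j = Some x"
        have "position q i < position q j" using swapped[OF q a(2,1) 2(2)] .
        moreover have "position q j < position q c" using after[OF q a(2)] c by (auto simp: X_def)
        ultimately show ?thesis by simp
      qed
      obtain k where k: "k \<in> X" using U[OF p0U] by blast
      show ?thesis
      proof (cases "\<exists>c\<in>X. c \<noteq> k")
        case True
        then obtain c where "c \<in> X" "c \<noteq> k" by blast
        then have "6 * card ?V \<le> fact CARD('n)"
          by (intro card_two_before_two[of i j k c]) (use k agents before in \<open>auto simp: X_def\<close>)
        then show ?thesis by simp
      next
        case False
        \<comment> \<open>Here \<open>j\<close> prefers \<open>x\<close> to \<open>w\<close>, so the
          taker of \<open>x\<close> precedes \<open>j\<close> as well.\<close>
        have "position p k < position p j \<and> position p j < position p i" if p: "p \<in> ?U" for p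
          using U[OF p] False type_B(3) by metis
        then have "6 * card ?U \<le> fact CARD('n)"
          by (intro card_chain[of k j i]) (use k agents in \<open>auto simp: X_def\<close>)
        then show ?thesis by simp
      qed
    qed
  qed
qed

end

end

section \<open>Strategy-proof mechanisms on profiles of rankings\<close>

fun earlier_eq :: "'a list \<Rightarrow> 'a \<Rightarrow> 'a \<Rightarrow> bool" where
  "earlier_eq [] u v \<longleftrightarrow> False"
| "earlier_eq (w # l) u v \<longleftrightarrow> (if u = w then v \<in> set (w # l) else earlier_eq l u v)"

definition remaining :: "'a set \<Rightarrow> 'a list" where
  "remaining S = (SOME l. distinct l \<and> set l = - S)"

text \<open>
  The ranking with acceptable objects \<open>A\<close> and unacceptable objects \<open>B\<close>, each in descending
  order; the remaining objects come last in an order that depends only on the set of the listed ones.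
\<close>

definition full_list :: "'o list \<Rightarrow> 'o list \<Rightarrow> 'o option list" where
  "full_list A B = map Some A @ None # map Some B @ remaining (set (map Some (A @ B)) \<union> {None})"

definition ranking :: "'o list \<times> 'o list \<Rightarrow> 'o preference" where
  "ranking t = {(u, v). earlier_eq (full_list (fst t) (snd t)) u v}"

lemma earlier_eqD: "earlier_eq l u v \<Longrightarrow> u \<in> set l \<and> v \<in> set l"
  by (induction l) (auto split: if_splits)

lemma earlier_eq_refl: "u \<in> set l \<Longrightarrow> earlier_eq l u u"
  by (induction l) auto

lemma earlier_eq_total: "u \<in> set l \<Longrightarrow> v \<in> set l \<Longrightarrow> earlier_eq l u v \<or> earlier_eq l v u"
  by (induction l) auto

lemma earlier_eq_antisym: "distinct l \<Longrightarrow> earlier_eq l u v \<Longrightarrow> earlier_eq l v u \<Longrightarrow> u = v"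
  by (induction l) (auto split: if_splits dest: earlier_eqD)

lemma earlier_eq_trans:
  "distinct l \<Longrightarrow> earlier_eq l u v \<Longrightarrow> earlier_eq l v w \<Longrightarrow> earlier_eq l u w"
  by (induction l) (auto split: if_splits dest: earlier_eqD)

lemma earlier_eq_append:
  "earlier_eq (l @ m) u v \<longleftrightarrow> earlier_eq l u v \<or> u \<in> set l \<and> v \<in> set m \<or> u \<notin> set l \<and> earlier_eq m u v"
  by (induction l) (auto dest: earlier_eqD)

lemma earlier_eq_map: "inj g \<Longrightarrow> earlier_eq (map g l) (g u) (g v) \<longleftrightarrow> earlier_eq l u v"
  by (induction l) (auto simp: inj_eq)

lemma remaining:
  fixes S :: "'a::finite set"
  shows "distinct (remaining S)" "set (remaining S) = - S"
proof -
  have "\<exists>l. distinct l \<and> set l = - S" using finite_distinct_list[of "- S"] by auto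
  from someI_ex[OF this] show "distinct (remaining S)" "set (remaining S) = - S"
    by (simp_all add: remaining_def)
qed

lemma full_list:
  fixes A B :: "'o::finite list"
  assumes "distinct (A @ B)"
  shows "distinct (full_list A B)" "set (full_list A B) = UNIV"
  using assms remaining[of "set (map Some (A @ B)) \<union> {None}"]
  by (auto simp: full_list_def distinct_map)

lemma ranking_linear_order:
  fixes t :: "'o::finite list \<times> 'o list"
  assumes "distinct (fst t @ snd t)"
  shows "linear_order (ranking t)"
  unfolding linear_order_on_def partial_order_on_def preorder_on_def
proof (intro conjI)
  note full = full_list[OF assms]
  show "refl (ranking t)"
    by (auto intro!: refl_onI simp: ranking_def full earlier_eq_refl)
  show "ranking t \<subseteq> UNIV \<times> UNIV" by simp
  show "trans (ranking t)"
    unfolding ranking_def using earlier_eq_trans[OF full(1)] by (auto intro!: transI)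
  show "antisym (ranking t)"
    unfolding ranking_def using earlier_eq_antisym[OF full(1)] by (auto intro!: antisymI)
  show "total (ranking t)"
    unfolding ranking_def total_on_def using earlier_eq_total[of _ "full_list (fst t) (snd t)"] full(2)
    by auto
qed

lemma ranking_acceptable:
  fixes t :: "'o::finite list \<times> 'o list"
  assumes "distinct (fst t @ snd t)"
  shows "(Some u, None) \<in> ranking t \<longleftrightarrow> u \<in> set (fst t)"
  using assms remaining[of "set (map Some (fst t @ snd t)) \<union> {None}"]
  by (auto simp: ranking_def full_list_def earlier_eq_append dest!: earlier_eqD)

lemma ranking_Some:
  fixes t :: "'o::finite list \<times> 'o list"
  assumes "distinct (fst t @ snd t)" "u \<in> set (fst t)" "v \<in> set (fst t)"
  shows "(Some u, Some v) \<in> ranking t \<longleftrightarrow> earlier_eq (fst t) u v"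
  using assms remaining[of "set (map Some (fst t @ snd t)) \<union> {None}"]
    earlier_eq_map[of Some "fst t" u v]
  by (auto simp: ranking_def full_list_def earlier_eq_append)

text \<open>Upper sets at acceptable objects are initial segments of the first list;
  strategy-proofness is used in this form.\<close>

lemma ranking_upper_set:
  fixes t :: "'o::finite list \<times> 'o list"
  assumes "distinct (fst t @ snd t)" "fst t = us @ v # vs"
  shows "{y. (y, Some v) \<in> ranking t} = Some ` set (us @ [v])"
  using assms remaining[of "set (map Some (fst t @ snd t)) \<union> {None}"]
  by (auto simp: ranking_def full_list_def earlier_eq_append image_iff dest!: earlier_eqD)

text \<open>Without \<open>None\<close> the boundary between the two lists is invisible, so moving
  it keeps the order of the objects.\<close>

lemma restrict_objects_ranking:
  fixes t :: "'o::finite list \<times> 'o list"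
  assumes "distinct (fst t @ snd t)" "fst t @ snd t = fst t' @ snd t'"
  shows "restrict_objects (ranking t) = restrict_objects (ranking t')"
proof -
  have "restrict_objects (ranking t) = {(u, v). earlier_eq (map Some (fst t @ snd t) @
      remaining (set (map Some (fst t @ snd t)) \<union> {None})) (Some u) (Some v)}"
    if "distinct (fst t @ snd t)" for t :: "'o list \<times> 'o list"
    using that by (auto simp: restrict_objects_def ranking_def full_list_def earlier_eq_append)
  from this[of t] this[of t'] show ?thesis using assms by simp
qed

definition ranked_profile :: "('n \<Rightarrow> 'o list \<times> 'o list) \<Rightarrow> ('n, 'o) profile" where
  "ranked_profile T = (\<lambda>i. ranking (T i))"

definition proper :: "('n \<Rightarrow> 'o list \<times> 'o list) \<Rightarrow> bool" where
  "proper T \<longleftrightarrow> (\<forall>i. distinct (fst (T i) @ snd (T i)))"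

lemma proper_distinct: "proper T \<Longrightarrow> distinct (fst (T i) @ snd (T i))"
  by (simp add: proper_def)

lemma ranked_profile_in_profiles:
  fixes T :: "'n \<Rightarrow> 'o::finite list \<times> 'o list"
  shows "proper T \<Longrightarrow> ranked_profile T \<in> profiles"
  by (simp add: profiles_def preferences_def ranked_profile_def proper_def ranking_linear_order)

section \<open>Equations implied by the axioms\<close>

text \<open>The common ground: the axioms of each class imply equal treatment of equals and ex-post
  weak non-wastefulness.\<close>

locale fair_strategy_proof =
  fixes f :: "('n::finite, 'o::finite) mechanism"
  assumes mechanism: "is_mechanism f"
    and sp: "strategy_proof f"
    and ete: "equal_treatment_of_equals f"
    and wnw: "ex_post_weakly_nonwasteful f"
begin

definition outcomes :: "('n \<Rightarrow> 'o list \<times> 'o list) \<Rightarrow> ('n, 'o) assignment set" where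
  "outcomes T = set_pmf (f (ranked_profile T))"

definition prob :: "('n \<Rightarrow> 'o list \<times> 'o list) \<Rightarrow> 'n \<Rightarrow> 'o \<Rightarrow> real" where
  "prob T i u = assign_prob f (ranked_profile T) i (Some u)"

lemma outcome_weakly_nonwasteful:
  "proper T \<Longrightarrow> m \<in> outcomes T \<Longrightarrow> weakly_nonwasteful (ranked_profile T) m"
  using wnw ranked_profile_in_profiles by (auto simp: ex_post_weakly_nonwasteful_def outcomes_def)

lemma outcome_inj:
  assumes "proper T" "m \<in> outcomes T" "m i = Some u" "m j = Some u"
  shows "i = j"
proof -
  have "m \<in> assignments"
    using mechanism ranked_profile_in_profiles[OF assms(1)] assms(2)
    unfolding is_mechanism_def outcomes_def by blast
  then show ?thesis using assms(3,4) by (auto simp: assignments_def)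
qed

lemma outcome_acceptable:
  assumes "proper T" "m \<in> outcomes T" "m i = Some u"
  shows "u \<in> set (fst (T i))"
proof -
  have "(m i, None) \<in> ranked_profile T i"
    using weakly_nonwasteful_rational[OF ranked_profile_in_profiles outcome_weakly_nonwasteful]
      assms(1,2) by blast
  then show ?thesis
    using assms ranking_acceptable[of "T i" u] by (simp add: ranked_profile_def proper_def)
qed

lemma outcome_unassigned:
  assumes "proper T" "m \<in> outcomes T" "m i = None" "u \<in> set (fst (T i))"
  shows "\<exists>j. m j = Some u"
proof -
  have "(Some u, m i) \<in> ranked_profile T i"
    using assms ranking_acceptable[of "T i" u] by (simp add: ranked_profile_def proper_def)
  moreover have "(None, m i) \<in> ranked_profile T i"
    using assms(1,3) linear_orderD(1)[OF ranking_linear_order[of "T i"]]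
    by (simp add: ranked_profile_def proper_def)
  ultimately have "taken m i (Some u)"
    using outcome_weakly_nonwasteful[OF assms(1,2)] by (simp add: weakly_nonwasteful_def)
  then show ?thesis by (simp add: taken_def)
qed

lemma prob_zeroI: "(\<And>m. m \<in> outcomes T \<Longrightarrow> m i \<noteq> Some u) \<Longrightarrow> prob T i u = 0"
  by (auto simp: prob_def assign_prob_def outcomes_def measure_pmf_zero_iff)

lemma prob_zeroD: "prob T i u = 0 \<Longrightarrow> m \<in> outcomes T \<Longrightarrow> m i \<noteq> Some u"
  by (auto simp: prob_def assign_prob_def outcomes_def measure_pmf_zero_iff)

lemma sum_prob: "(\<Sum>u\<in>U. prob T i u) = measure_pmf.prob (f (ranked_profile T)) {m. m i \<in> Some ` U}"
proof -
  have "(\<Sum>u\<in>U. prob T i u) = (\<Sum>y\<in>Some ` U. assign_prob f (ranked_profile T) i y)"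
    by (simp add: prob_def sum.reindex)
  then show ?thesis by (simp add: sum_assign_prob)
qed

lemma sum_prob_eq_1I:
  assumes "\<And>m. m \<in> outcomes T \<Longrightarrow> m i \<in> Some ` U"
  shows "(\<Sum>u\<in>U. prob T i u) = 1"
  unfolding sum_prob
  using assms by (intro measure_pmf.prob_eq_1[THEN iffD2]) (auto simp: outcomes_def AE_measure_pmf_iff)

lemma object_probI:
  assumes T: "proper T" and J: "\<And>i. u \<in> set (fst (T i)) \<Longrightarrow> i \<in> J"
    and all: "\<And>m. m \<in> outcomes T \<Longrightarrow> \<exists>j. m j = Some u"
  shows "(\<Sum>i\<in>J. prob T i u) = 1"
proof -
  let ?R = "ranked_profile T"
  have "unassigned_prob f ?R u = measure_pmf.prob (f ?R) {m. \<forall>j. m j \<noteq> Some u}"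
    using unassigned_prob_eq[OF mechanism ranked_profile_in_profiles[OF T]] .
  also have "\<dots> = 0" using all by (auto simp: measure_pmf_zero_iff outcomes_def)
  finally have "(\<Sum>i\<in>UNIV. prob T i u) = 1" by (simp add: unassigned_prob_def prob_def)
  moreover have "(\<Sum>i\<in>UNIV. prob T i u) = (\<Sum>i\<in>J. prob T i u)"
    using J outcome_acceptable[OF T] by (intro sum.mono_neutral_right) (auto intro!: prob_zeroI)
  ultimately show ?thesis by simp
qed

text \<open>
  If \<open>u\<close> is left over, the agents in \<open>I\<close> all receive objects, and different ones, in \<open>V - {u}\<close>.
\<close>

lemma object_assigned:
  assumes T: "proper T" and J: "\<And>i. u \<in> set (fst (T i)) \<Longrightarrow> i \<in> J"
    and I: "\<And>i. i \<in> I \<Longrightarrow> u \<in> set (fst (T i)) \<and> set (fst (T i)) \<subseteq> V"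
    and fin: "u \<in> V" "card V \<le> card I"
  shows "(\<Sum>i\<in>J. prob T i u) = 1"
proof (rule object_probI)
  fix m assume m: "m \<in> outcomes T"
  show "\<exists>j. m j = Some u"
  proof (rule ccontr)
    assume left: "\<not> (\<exists>j. m j = Some u)"
    have "\<exists>v. m i = Some v \<and> v \<in> V - {u}" if "i \<in> I" for i
      using outcome_unassigned[OF T m, of i u] outcome_acceptable[OF T m, of i] I[OF that] left
      by (cases "m i") auto
    then obtain g where g: "\<And>i. i \<in> I \<Longrightarrow> m i = Some (g i) \<and> g i \<in> V - {u}" by metis
    have "inj_on g I" using g outcome_inj[OF T m] by (metis inj_onI)
    then have "card I \<le> card (V - {u})" using g by (intro card_inj_on_le[of g]) auto
    also have "\<dots> < card V" by (rule card_Diff1_less) (use fin(1) in simp_all)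
    finally show False using fin(2) by simp
  qed
qed (use T J in auto)

text \<open>
  If \<open>i\<close> is unassigned, the objects in \<open>V\<close> are held by different agents in \<open>J\<close>.
\<close>

lemma agent_assigned:
  assumes T: "proper T" and V: "V \<subseteq> set (fst (T i))"
    and J: "\<And>j. j \<noteq> i \<Longrightarrow> set (fst (T j)) \<inter> V \<noteq> {} \<Longrightarrow> j \<in> J"
    and card: "card J < card V" and U: "U = set (fst (T i))"
  shows "(\<Sum>u\<in>U. prob T i u) = 1"
  unfolding U
proof (rule sum_prob_eq_1I)
  fix m assume m: "m \<in> outcomes T"
  have "m i \<noteq> None"
  proof
    assume none: "m i = None"
    then have "\<exists>j. m j = Some v" if "v \<in> V" for v
      using outcome_unassigned[OF T m] V that by blast
    then obtain g where g: "\<And>v. v \<in> V \<Longrightarrow> m (g v) = Some v" by metis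
    have "inj_on g V" using g by (metis inj_onI option.inject)
    moreover have "g v \<in> J" if v: "v \<in> V" for v
    proof (rule J)
      show "g v \<noteq> i" using g[OF v] none by auto
      show "set (fst (T (g v))) \<inter> V \<noteq> {}" using outcome_acceptable[OF T m g[OF v]] v by blast
    qed
    ultimately have "card V \<le> card J" by (intro card_inj_on_le[of g]) auto
    then show False using card by simp
  qed
  then show "m i \<in> Some ` set (fst (T i))" using outcome_acceptable[OF T m, of i] by auto
qed

lemma equals: "proper T \<Longrightarrow> T i = T j \<Longrightarrow> prob T i u = prob T j u"
  using ete[unfolded equal_treatment_of_equals_def, rule_format, OF ranked_profile_in_profiles, of T i j u]
  by (simp add: prob_def ranked_profile_def)

text \<open>Each profile is a deviation of \<open>i\<close> from the other one, and the two rankings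
  share the upper set \<open>set us\<close>; strategy-proofness gives one inequality in each
  direction.\<close>

lemma transfer:
  assumes T: "proper T" and T': "proper T'" and eq: "\<And>j. j \<noteq> i \<Longrightarrow> T j = T' j"
    and us: "fst (T i) = us @ us'" and vs: "fst (T' i) = vs @ vs'" and set: "set us = set vs"
    and ne: "us \<noteq> []"
  shows "(\<Sum>u\<in>set us. prob T i u) = (\<Sum>u\<in>set us. prob T' i u)"
proof -
  have le: "(\<Sum>u\<in>set us. prob T' i u) \<le> (\<Sum>u\<in>set us. prob T i u)"
    if T: "proper T" and T': "proper T'" and eq: "\<And>j. j \<noteq> i \<Longrightarrow> T j = T' j"
      and us: "fst (T i) = us @ us'" and ne: "us \<noteq> []" for T T' us us'
  proof -
    \<comment> \<open>The threshold for strategy-proofness is the last object of the initial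
      segment.\<close>
    obtain ws w where us_eq: "us = ws @ [w]" using ne by (metis rev_exhaust)
    have upper: "{y. (y, Some w) \<in> ranked_profile T i} = Some ` set us"
      using ranking_upper_set[of "T i" ws w us', OF proper_distinct[OF T]] us us_eq
      by (simp add: ranked_profile_def)
    have upd: "(ranked_profile T)(i := ranked_profile T' i) = ranked_profile T'"
      by (rule ext) (simp add: ranked_profile_def eq)
    have "ranked_profile T' i \<in> preferences"
      using ranked_profile_in_profiles[OF T'] by (simp add: profiles_def)
    from sp[unfolded strategy_proof_def, rule_format, OF ranked_profile_in_profiles[OF T] this,
        of i "Some w"]
    have "(\<Sum>y | (y, Some w) \<in> ranked_profile T i. assign_prob f (ranked_profile T') i y)
        \<le> (\<Sum>y | (y, Some w) \<in> ranked_profile T i. assign_prob f (ranked_profile T) i y)"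
      unfolding upd .
    then show ?thesis unfolding upper by (simp add: prob_def sum.reindex)
  qed
  have "vs \<noteq> []" using ne set by auto
  have "(\<Sum>u\<in>set us. prob T' i u) \<le> (\<Sum>u\<in>set us. prob T i u)"
    by (rule le[OF T T' eq us ne])
  moreover have "(\<Sum>u\<in>set vs. prob T i u) \<le> (\<Sum>u\<in>set vs. prob T' i u)"
    by (rule le[OF T' T eq[symmetric] vs \<open>vs \<noteq> []\<close>])
  ultimately show ?thesis by (simp add: set)
qed

text \<open>The working form: a value already known at \<open>T'\<close> is carried over to
  \<open>T\<close>.\<close>

lemma transfer_take:
  assumes "(\<Sum>u\<in>U. prob T' i u) = r" "proper T" "proper T'" "\<And>j. j \<noteq> i \<Longrightarrow> T j = T' j"
    and "U = set (take n (fst (T i)))" "U = set (take n (fst (T' i)))" "U \<noteq> {}"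
  shows "(\<Sum>u\<in>U. prob T i u) = r"
proof -
  have "(\<Sum>u\<in>set (take n (fst (T i))). prob T i u) = (\<Sum>u\<in>set (take n (fst (T i))). prob T' i u)"
    by (rule transfer[OF assms(2-4), where us' = "drop n (fst (T i))" and vs' = "drop n (fst (T' i))"
          and vs = "take n (fst (T' i))"]) (use assms(5-7) in auto)
  then show ?thesis using assms(1,5) by simp
qed

end

section \<open>Profiles of four agents and the two classes\<close>

lemma distinct3: "distinct [a, b, c] \<Longrightarrow> a \<noteq> b \<and> b \<noteq> a \<and> a \<noteq> c \<and> c \<noteq> a \<and> b \<noteq> c \<and> c \<noteq> b"
  by auto

lemma distinct4:
  "distinct [a, b, c, d] \<Longrightarrow> a \<noteq> b \<and> b \<noteq> a \<and> a \<noteq> c \<and> c \<noteq> a \<and> a \<noteq> d \<and> d \<noteq> a \<and>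
    b \<noteq> c \<and> c \<noteq> b \<and> b \<noteq> d \<and> d \<noteq> b \<and> c \<noteq> d \<and> d \<noteq> c"
  by auto

text \<open>Agents beyond the four accept nothing, so computations with four agents cover every
  larger set of agents.\<close>

definition quad ::
  "'n \<Rightarrow> 'o list \<times> 'o list \<Rightarrow> 'n \<Rightarrow> 'o list \<times> 'o list \<Rightarrow> 'n \<Rightarrow> 'o list \<times> 'o list \<Rightarrow>
    'n \<Rightarrow> 'o list \<times> 'o list \<Rightarrow> 'n \<Rightarrow> 'o list \<times> 'o list" where
  "quad a A b B c C d D = (\<lambda>i. if i = a then A else if i = b then B else if i = c then C
     else if i = d then D else ([], []))"

lemma quad_apply:
  "quad a A b B c C d D i = (if i = a then A else if i = b then B else if i = c then C
     else if i = d then D else ([], []))"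
  by (simp add: quad_def)

lemma proper_quad:
  "distinct (fst A @ snd A) \<Longrightarrow> distinct (fst B @ snd B) \<Longrightarrow> distinct (fst C @ snd C) \<Longrightarrow>
    distinct (fst D @ snd D) \<Longrightarrow> proper (quad a A b B c C d D)"
  by (simp add: proper_def quad_def)

locale fair_strategy_proof_almost = fair_strategy_proof f
  for f :: "('n::finite, 'o::finite) mechanism" +
  assumes etae: "equal_treatment_of_almost_equals f"
begin

lemma almost_equals:
  assumes T: "proper T" and eq: "fst (T i) @ snd (T i) = fst (T j) @ snd (T j)"
    and len: "length (fst (T i)) \<le> length (fst (T j))" "length (fst (T j)) \<le> length (fst (T i)) + 1"
    and u: "u \<in> set (fst (T i))"
  shows "prob T i u = prob T j u"
proof -
  have acc: "acceptable (ranked_profile T k) = set (fst (T k))" for k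
    using acceptable_iff[OF linear_order_profile[OF ranked_profile_in_profiles[OF T]]]
      ranking_acceptable[OF proper_distinct[OF T]]
    by (auto simp: ranked_profile_def)
  have card: "card (acceptable (ranked_profile T k)) = length (fst (T k))" for k
    using proper_distinct[OF T, of k] by (simp add: acc distinct_card)
  have "restrict_objects (ranked_profile T i) = restrict_objects (ranked_profile T j)"
    unfolding ranked_profile_def by (rule restrict_objects_ranking[OF proper_distinct[OF T] eq])
  from etae[unfolded equal_treatment_of_almost_equals_def, rule_format,
      OF ranked_profile_in_profiles[OF T] this]
  show ?thesis unfolding prob_def card unfolding acc using len u by blast
qed

end

locale fair_strategy_proof_efficient = fair_strategy_proof f
  for f :: "('n::finite, 'o::finite) mechanism" +
  assumes efficient: "ex_post_efficient f"
begin

lemma outcome_efficient: "proper T \<Longrightarrow> m \<in> outcomes T \<Longrightarrow> efficient (ranked_profile T) m"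
  using efficient ranked_profile_in_profiles[of T]
  unfolding ex_post_efficient_def outcomes_def by blast

lemma ranked_better:
  fixes T :: "'n \<Rightarrow> 'o list \<times> 'o list"
  assumes "proper T" "u \<in> set (fst (T i))" "v \<in> set (fst (T i))" "earlier_eq (fst (T i)) v u" "v \<noteq> u"
  shows "(Some v, Some u) \<in> strict (ranked_profile T i)"
  using strict_linear_order_iff[OF ranking_linear_order[OF proper_distinct[OF assms(1), of i]]]
    ranking_Some[OF proper_distinct[OF assms(1), of i] assms(3,2)] assms(4,5)
  by (simp add: ranked_profile_def)

lemma no_improvement:
  assumes T: "proper T" and m: "m \<in> outcomes T" and m': "m' \<in> assignments"
    and better: "\<And>j. m' j = m j \<or> (m' j, m j) \<in> strict (ranked_profile T j)"
  shows "m' = m"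
proof (rule ccontr)
  assume "m' \<noteq> m"
  then obtain j where "(m' j, m j) \<in> strict (ranked_profile T j)" using better by blast
  moreover have "(m' k, m k) \<in> ranked_profile T k" for k
    using better[of k] linear_orderD(1)[OF ranking_linear_order[OF proper_distinct[OF T]]]
    by (auto simp: strict_def ranked_profile_def)
  ultimately show False using outcome_efficient[OF T m] m' unfolding efficient_def by blast
qed

text \<open>Moving \<open>i\<close> to a better object that is free would be a Pareto
  improvement.\<close>

lemma better_taken:
  assumes T: "proper T" and m: "m \<in> outcomes T" and mi: "m i = Some u"
    and v: "v \<in> set (fst (T i))" "earlier_eq (fst (T i)) v u" "v \<noteq> u"
  shows "\<exists>j. m j = Some v"
proof (rule ccontr)
  assume free: "\<not> ?thesis"
  have "m(i := Some v) = m"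
  proof (rule no_improvement[OF T m])
    show "m(i := Some v) \<in> assignments"
      using free outcome_inj[OF T m] by (auto simp: assignments_def)
    show "(m(i := Some v)) j = m j \<or> ((m(i := Some v)) j, m j) \<in> strict (ranked_profile T j)" for j
      using ranked_better[OF T outcome_acceptable[OF T m mi] v] mi by simp
  qed
  then show False using mi v(3) by (metis fun_upd_same option.inject)
qed

text \<open>Efficiency sharpens the counting of \<open>object_assigned\<close>: if \<open>u\<close>
  is left over, each agent in \<open>I\<close> holds something better than \<open>u\<close>, so
  \<open>V\<close> has to cover only the objects ranked at or above \<open>u\<close>.\<close>

lemma efficient_object_assigned:
  assumes T: "proper T" and J: "\<And>i. u \<in> set (fst (T i)) \<Longrightarrow> i \<in> J"
    and I: "\<And>i. i \<in> I \<Longrightarrow> u \<in> set (fst (T i)) \<and> {v \<in> set (fst (T i)). earlier_eq (fst (T i)) v u} \<subseteq> V"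
    and fin: "u \<in> V" "card V \<le> card I"
  shows "(\<Sum>i\<in>J. prob T i u) = 1"
proof (rule object_probI)
  fix m assume m: "m \<in> outcomes T"
  show "\<exists>j. m j = Some u"
  proof (rule ccontr)
    assume left: "\<not> (\<exists>j. m j = Some u)"
    have "\<exists>v. m i = Some v \<and> v \<in> V - {u}" if i: "i \<in> I" for i
    proof -
      obtain v where v: "m i = Some v" using outcome_unassigned[OF T m, of i u] I[OF i] left by fastforce
      then have "v \<noteq> u" using left by blast
      moreover have "\<not> earlier_eq (fst (T i)) u v"
        using better_taken[OF T m v] I[OF i] left \<open>v \<noteq> u\<close> by blast
      then have "earlier_eq (fst (T i)) v u"
        using earlier_eq_total[of u "fst (T i)" v] outcome_acceptable[OF T m v] I[OF i] by blast
      ultimately show ?thesis using v outcome_acceptable[OF T m v] I[OF i] by blast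
    qed
    then obtain g where g: "\<And>i. i \<in> I \<Longrightarrow> m i = Some (g i) \<and> g i \<in> V - {u}" by metis
    have "inj_on g I" using g outcome_inj[OF T m] by (metis inj_onI)
    then have "card I \<le> card (V - {u})" using g by (intro card_inj_on_le[of g]) auto
    also have "\<dots> < card V" by (rule card_Diff1_less) (use fin(1) in simp_all)
    finally show False using fin(2) by simp
  qed
qed (use T J in auto)

text \<open>
  If \<open>i\<close> receives \<open>u\<close>, then the better object \<open>v\<close> is taken, and its owner would swap with \<open>i\<close>.
\<close>

lemma never_assigned:
  assumes T: "proper T" and v: "v \<in> set (fst (T i))" "earlier_eq (fst (T i)) v u" "v \<noteq> u"
    and swap: "\<And>j. j \<noteq> i \<Longrightarrow> v \<in> set (fst (T j)) \<Longrightarrow>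
      prob T j v = 0 \<or> u \<in> set (fst (T j)) \<and> earlier_eq (fst (T j)) u v"
  shows "prob T i u = 0"
proof (rule prob_zeroI, rule notI)
  fix m assume m: "m \<in> outcomes T" and mi: "m i = Some u"
  obtain j where mj: "m j = Some v" using better_taken[OF T m mi v] by blast
  have ij: "j \<noteq> i" using mi mj v(3) by auto
  note vj = outcome_acceptable[OF T m mj]
  \<comment> \<open>In this outcome \<open>j\<close> holds \<open>v\<close>, which rules out the
    alternative of probability zero.\<close>
  have uj: "u \<in> set (fst (T j))" "earlier_eq (fst (T j)) u v"
    using swap[OF ij vj] prob_zeroD[of T j v] m mj by auto
  have "m(i := Some v, j := Some u) = m"
  proof (rule no_improvement[OF T m])
    show "m(i := Some v, j := Some u) \<in> assignments"
      using outcome_inj[OF T m] mi mj ij unfolding assignments_def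
      by (auto simp: fun_upd_def split: if_splits)
    show "(m(i := Some v, j := Some u)) k = m k \<or>
        ((m(i := Some v, j := Some u)) k, m k) \<in> strict (ranked_profile T k)" for k
      using ranked_better[OF T outcome_acceptable[OF T m mi] v]
        ranked_better[OF T vj uj(1,2)] v(3) mi mj by auto
  qed
  then show False using mj v(3) by (metis fun_upd_same option.inject)
qed

end

section \<open>Four agents and three objects\<close>

text \<open>
  In the names below, \<open>XZ_XZY_XY_XY_share2_XZY\<close> refers to the probability of receiving one of the two
  best objects, for an agent with acceptable objects \<open>x\<close>, \<open>z\<close>, \<open>y\<close> at the profile with rankings
  \<open>xz\<close>, \<open>xzy\<close>, \<open>xy\<close>, \<open>xy\<close>.  All values are those of RSD; the
  order of the steps was found by computer search.
\<close>

context fair_strategy_proof_almost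
begin

context
  fixes x y z :: 'o
  assumes xyz: "distinct [x, y, z]"
begin

text \<open>The second list is chosen so that rankings like \<open>X\<close>, \<open>XY\<close>,
  \<open>XYZ\<close> or \<open>XZ\<close>, \<open>XZY\<close> order the objects alike; neighbours in
  such a family are almost equal.\<close>

abbreviation "Z \<equiv> ([z], [x, y])"
abbreviation "Z_YX \<equiv> ([z], [y, x])"
abbreviation "X \<equiv> ([x], [y, z])"
abbreviation "Y \<equiv> ([y], [z, x])"
abbreviation "ZX \<equiv> ([z, x], [y])"
abbreviation "XZ \<equiv> ([x, z], [y])"
abbreviation "XY \<equiv> ([x, y], [z])"
abbreviation "YX \<equiv> ([y, x], [z])"
abbreviation "ZYX \<equiv> ([z, y, x], [])"
abbreviation "XZY \<equiv> ([x, z, y], [])"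
abbreviation "XYZ \<equiv> ([x, y, z], [])"
abbreviation "YXZ \<equiv> ([y, x, z], [])"

lemmas objects = distinct3[OF xyz]

lemma sums:
  fixes g :: "'o \<Rightarrow> real"
  shows "(\<Sum>u\<in>{x}. g u) = g x"
    "(\<Sum>u\<in>{y}. g u) = g y"
    "(\<Sum>u\<in>{z}. g u) = g z"
    "(\<Sum>u\<in>{x, y}. g u) = g x + g y"
    "(\<Sum>u\<in>{x, z}. g u) = g x + g z"
    "(\<Sum>u\<in>{y, z}. g u) = g y + g z"
    "(\<Sum>u\<in>{x, y, z}. g u) = g x + g y + g z"
  using xyz by (simp_all add: add.assoc)

lemma almost_X_X_X_Y_share1_Y:
  assumes agents: "distinct [a, b, c, d]"
  shows "(\<Sum>u\<in>{y}. prob (quad a X b X c X d Y) d u) = 1"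
proof -
  note [simp] = distinct4[OF agents] objects quad_apply proper_def
  let ?P = "quad a X b X c X d Y"
  have P: "proper ?P" by simp
  have O1: "(\<Sum>i\<in>{d}. prob ?P i y) = 1"
    by (rule object_assigned[OF P, where I = "{d}" and V = "{y}"]) (auto split: if_splits)
  show ?thesis using O1 by (simp add: sums; linarith)
qed

text \<open>All four agents receive the same share of \<open>x\<close>, which is always
  assigned.\<close>

lemma almost_XY_XYZ_XYZ_XYZ_share1_XYZ:
  assumes agents: "distinct [a, b, c, d]"
  shows "(\<Sum>u\<in>{x}. prob (quad a XY b XYZ c XYZ d XYZ) b u) = 1 / 4"
proof -
  note [simp] = distinct4[OF agents] objects quad_apply proper_def
  let ?P = "quad a XY b XYZ c XYZ d XYZ"
  have P: "proper ?P" by simp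
  have O1: "(\<Sum>i\<in>{a, b, c, d}. prob ?P i x) = 1"
    by (rule object_assigned[OF P, where I = "{a, b, c}" and V = "{x, y, z}"])
      (auto split: if_splits)
  have E2: "prob ?P a x = prob ?P b x" by (rule almost_equals[OF P]) simp_all
  have E: "prob ?P c u = prob ?P b u" "prob ?P d u = prob ?P b u" for u
    by (rule equals[OF P], simp)+
  show ?thesis using O1 E2 E by (simp add: sums; linarith)
qed

text \<open>All four receive 1/4 of \<open>x\<close> and 1/4 of \<open>y\<close>; the three who
  accept \<open>z\<close> receive 1/3 of it.\<close>

lemma almost_XY_XYZ_XYZ_XYZ_share3_XYZ:
  assumes agents: "distinct [a, b, c, d]"
  shows "(\<Sum>u\<in>{x, y, z}. prob (quad a XY b XYZ c XYZ d XYZ) b u) = 5 / 6"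
proof -
  note [simp] = distinct4[OF agents] objects quad_apply proper_def
  let ?P = "quad a XY b XYZ c XYZ d XYZ"
  have P: "proper ?P" by simp
  have O1: "(\<Sum>i\<in>{a, b, c, d}. prob ?P i x) = 1"
    by (rule object_assigned[OF P, where I = "{a, b, c}" and V = "{x, y, z}"])
      (auto split: if_splits)
  have O2: "(\<Sum>i\<in>{a, b, c, d}. prob ?P i y) = 1"
    by (rule object_assigned[OF P, where I = "{a, b, c}" and V = "{x, y, z}"])
      (auto split: if_splits)
  have O3: "(\<Sum>i\<in>{b, c, d}. prob ?P i z) = 1"
    by (rule object_assigned[OF P, where I = "{b, c, d}" and V = "{x, y, z}"])
      (auto split: if_splits)
  have E4: "prob ?P a x = prob ?P b x" by (rule almost_equals[OF P]) simp_all
  have E5: "prob ?P a y = prob ?P b y" by (rule almost_equals[OF P]) simp_all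
  have E: "prob ?P c u = prob ?P b u" "prob ?P d u = prob ?P b u" for u
    by (rule equals[OF P], simp)+
  show ?thesis using O1 O2 O3 E4 E5 E by (simp add: sums; linarith)
qed

lemma almost_Z_XY_XY_XY_share1_Z:
  assumes agents: "distinct [a, b, c, d]"
  shows "(\<Sum>u\<in>{z}. prob (quad a Z b XY c XY d XY) a u) = 1"
proof -
  note [simp] = distinct4[OF agents] objects quad_apply proper_def
  let ?P = "quad a Z b XY c XY d XY"
  have P: "proper ?P" by simp
  have O1: "(\<Sum>i\<in>{a}. prob ?P i z) = 1"
    by (rule object_assigned[OF P, where I = "{a}" and V = "{z}"]) (auto split: if_splits)
  show ?thesis using O1 by (simp add: sums; linarith)
qed

lemma almost_Z_XY_XY_XY_share2_XY:
  assumes agents: "distinct [a, b, c, d]"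
  shows "(\<Sum>u\<in>{x, y}. prob (quad a Z b XY c XY d XY) b u) = 2 / 3"
proof -
  note [simp] = distinct4[OF agents] objects quad_apply proper_def
  let ?P = "quad a Z b XY c XY d XY"
  have P: "proper ?P" by simp
  have O1: "(\<Sum>i\<in>{b, c, d}. prob ?P i x) = 1"
    by (rule object_assigned[OF P, where I = "{b, c}" and V = "{x, y}"]) (auto split: if_splits)
  have O2: "(\<Sum>i\<in>{b, c, d}. prob ?P i y) = 1"
    by (rule object_assigned[OF P, where I = "{b, c}" and V = "{x, y}"]) (auto split: if_splits)
  have E: "prob ?P c u = prob ?P b u" "prob ?P d u = prob ?P b u" for u
    by (rule equals[OF P], simp)+
  show ?thesis using O1 O2 E by (simp add: sums; linarith)
qed

lemma almost_Z_Z_XY_XYZ_share1_Z: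
  assumes agents: "distinct [a, b, c, d]"
  shows "(\<Sum>u\<in>{z}. prob (quad a Z b Z c XY d XYZ) a u) = 1 / 2"
proof -
  note [simp] = distinct4[OF agents] objects quad_apply proper_def
  let ?P = "quad a Z b Z c XY d XYZ"
  have P: "proper ?P" by simp
  have A1: "(\<Sum>u\<in>{x, y}. prob ?P c u) = 1"
    by (rule agent_assigned[OF P, where V = "{x, y}" and J = "{d}"]) (auto split: if_splits)
  have A2: "(\<Sum>u\<in>{x, y, z}. prob ?P d u) = 1"
    by (rule agent_assigned[OF P, where V = "{x, y}" and J = "{c}"]) (auto split: if_splits)
  have O3: "(\<Sum>i\<in>{a, b, d}. prob ?P i z) = 1"
    by (rule object_assigned[OF P, where I = "{a}" and V = "{z}"]) (auto split: if_splits)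
  have E4: "prob ?P c x = prob ?P d x" by (rule almost_equals[OF P]) simp_all
  have E5: "prob ?P c y = prob ?P d y" by (rule almost_equals[OF P]) simp_all
  have E: "prob ?P b u = prob ?P a u" for u by (rule equals[OF P], simp)
  show ?thesis using A1 A2 O3 E4 E5 E by (simp add: sums; linarith)
qed

lemma almost_ZX_XY_XY_XY_share2_ZX:
  assumes agents: "distinct [a, b, c, d]"
  shows "(\<Sum>u\<in>{x, z}. prob (quad a ZX b XY c XY d XY) a u) = 1"
proof -
  note [simp] = distinct4[OF agents] objects quad_apply proper_def
  let ?P = "quad a ZX b XY c XY d XY"
  have P: "proper ?P" by simp
  have A1: "(\<Sum>u\<in>{x, z}. prob ?P a u) = 1"
    by (rule agent_assigned[OF P, where V = "{z}" and J = "{}"]) (auto split: if_splits)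
  show ?thesis using A1 by (simp add: sums; linarith)
qed

text \<open>\<open>a\<close> always receives \<open>z\<close>, which leaves \<open>x\<close> and
  \<open>y\<close> to three equal agents.\<close>

lemma almost_ZX_XY_XY_XY_share2_XY:
  assumes agents: "distinct [a, b, c, d]"
  shows "(\<Sum>u\<in>{x, y}. prob (quad a ZX b XY c XY d XY) b u) = 2 / 3"
proof -
  note [simp] = distinct4[OF agents] objects quad_apply proper_def
  let ?P = "quad a ZX b XY c XY d XY"
  have P: "proper ?P" by simp
  have S1: "(\<Sum>u\<in>{z}. prob ?P a u) = 1"
    by (rule transfer_take[OF almost_Z_XY_XY_XY_share1_Z[of a b c d] P, where n = 1]) auto
  have A2: "(\<Sum>u\<in>{x, z}. prob ?P a u) = 1"
    by (rule agent_assigned[OF P, where V = "{z}" and J = "{}"]) (auto split: if_splits)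
  have O3: "(\<Sum>i\<in>{a, b, c, d}. prob ?P i x) = 1"
    by (rule object_assigned[OF P, where I = "{b, c}" and V = "{x, y}"]) (auto split: if_splits)
  have O4: "(\<Sum>i\<in>{b, c, d}. prob ?P i y) = 1"
    by (rule object_assigned[OF P, where I = "{b, c}" and V = "{x, y}"]) (auto split: if_splits)
  have E: "prob ?P c u = prob ?P b u" "prob ?P d u = prob ?P b u" for u
    by (rule equals[OF P], simp)+
  show ?thesis using S1 A2 O3 O4 E by (simp add: sums; linarith)
qed

lemma almost_XZ_XZ_XZ_XY_share2_XY:
  assumes agents: "distinct [a, b, c, d]"
  shows "(\<Sum>u\<in>{x, y}. prob (quad a XZ b XZ c XZ d XY) d u) = 1"
proof -
  note [simp] = distinct4[OF agents] objects quad_apply proper_def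
  let ?P = "quad a XZ b XZ c XZ d XY"
  have P: "proper ?P" by simp
  have A1: "(\<Sum>u\<in>{x, y}. prob ?P d u) = 1"
    by (rule agent_assigned[OF P, where V = "{y}" and J = "{}"]) (auto split: if_splits)
  show ?thesis using A1 by (simp add: sums; linarith)
qed

lemma almost_XZY_XZY_XZY_XZY_share3_XZY:
  assumes agents: "distinct [a, b, c, d]"
  shows "(\<Sum>u\<in>{x, y, z}. prob (quad a XZY b XZY c XZY d XZY) a u) = 3 / 4"
proof -
  note [simp] = distinct4[OF agents] objects quad_apply proper_def
  let ?P = "quad a XZY b XZY c XZY d XZY"
  have P: "proper ?P" by simp
  have O1: "(\<Sum>i\<in>{a, b, c, d}. prob ?P i x) = 1"
    by (rule object_assigned[OF P, where I = "{a, b, c}" and V = "{x, y, z}"])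
      (auto split: if_splits)
  have O2: "(\<Sum>i\<in>{a, b, c, d}. prob ?P i y) = 1"
    by (rule object_assigned[OF P, where I = "{a, b, c}" and V = "{x, y, z}"])
      (auto split: if_splits)
  have O3: "(\<Sum>i\<in>{a, b, c, d}. prob ?P i z) = 1"
    by (rule object_assigned[OF P, where I = "{a, b, c}" and V = "{x, y, z}"])
      (auto split: if_splits)
  have E: "prob ?P b u = prob ?P a u" "prob ?P c u = prob ?P a u" "prob ?P d u = prob ?P a u" for u
    by (rule equals[OF P], simp)+
  show ?thesis using O1 O2 O3 E by (simp add: sums; linarith)
qed

lemma almost_X_X_X_YX_share2_YX:
  assumes agents: "distinct [a, b, c, d]"
  shows "(\<Sum>u\<in>{x, y}. prob (quad a X b X c X d YX) d u) = 1"
proof -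
  note [simp] = distinct4[OF agents] objects quad_apply proper_def
  let ?P = "quad a X b X c X d YX"
  have P: "proper ?P" by simp
  have A1: "(\<Sum>u\<in>{x, y}. prob ?P d u) = 1"
    by (rule agent_assigned[OF P, where V = "{y}" and J = "{}"]) (auto split: if_splits)
  show ?thesis using A1 by (simp add: sums; linarith)
qed

lemma almost_Z_Z_XY_XY_share1_Z:
  assumes agents: "distinct [a, b, c, d]"
  shows "(\<Sum>u\<in>{z}. prob (quad a Z b Z c XY d XY) a u) = 1 / 2"
proof -
  note [simp] = distinct4[OF agents] objects quad_apply proper_def
  let ?P = "quad a Z b Z c XY d XY"
  have P: "proper ?P" by simp
  have O1: "(\<Sum>i\<in>{a, b}. prob ?P i z) = 1"
    by (rule object_assigned[OF P, where I = "{a}" and V = "{z}"]) (auto split: if_splits)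
  have E: "prob ?P b u = prob ?P a u" for u by (rule equals[OF P], simp)
  show ?thesis using O1 E by (simp add: sums; linarith)
qed

lemma almost_XZY_XY_XYZ_XYZ_share1_XYZ:
  assumes agents: "distinct [a, b, c, d]"
  shows "(\<Sum>u\<in>{x}. prob (quad a XZY b XY c XYZ d XYZ) c u) = 1 / 4"
proof -
  note [simp] = distinct4[OF agents] objects quad_apply proper_def
  let ?P = "quad a XZY b XY c XYZ d XYZ"
  have P: "proper ?P" by simp
  have S1: "(\<Sum>u\<in>{x}. prob ?P a u) = 1 / 4"
    by (rule transfer_take[OF almost_XY_XYZ_XYZ_XYZ_share1_XYZ[of b a c d] P, where n = 1]) auto
  have O2: "(\<Sum>i\<in>{a, b, c, d}. prob ?P i x) = 1"
    by (rule object_assigned[OF P, where I = "{a, b, c}" and V = "{x, y, z}"])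
      (auto split: if_splits)
  have E3: "prob ?P b x = prob ?P c x" by (rule almost_equals[OF P]) simp_all
  have E: "prob ?P d u = prob ?P c u" for u by (rule equals[OF P], simp)
  show ?thesis using S1 O2 E3 E by (simp add: sums; linarith)
qed

lemma almost_Z_YX_XY_XY_YX_share1_Z_YX:
  assumes agents: "distinct [a, b, c, d]"
  shows "(\<Sum>u\<in>{z}. prob (quad a Z_YX b XY c XY d YX) a u) = 1"
proof -
  note [simp] = distinct4[OF agents] objects quad_apply proper_def
  let ?P = "quad a Z_YX b XY c XY d YX"
  have P: "proper ?P" by simp
  have O1: "(\<Sum>i\<in>{a}. prob ?P i z) = 1"
    by (rule object_assigned[OF P, where I = "{a}" and V = "{z}"]) (auto split: if_splits)
  show ?thesis using O1 by (simp add: sums; linarith)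
qed

lemma almost_ZX_XY_XY_YX_share2_XY:
  assumes agents: "distinct [a, b, c, d]"
  shows "(\<Sum>u\<in>{x, y}. prob (quad a ZX b XY c XY d YX) b u) = 2 / 3"
proof -
  note [simp] = distinct4[OF agents] objects quad_apply proper_def
  let ?P = "quad a ZX b XY c XY d YX"
  have P: "proper ?P" by simp
  have S1: "(\<Sum>u\<in>{x, y}. prob ?P d u) = 2 / 3"
    by (rule transfer_take[OF almost_ZX_XY_XY_XY_share2_XY[of a d b c] P, where n = 2]) auto
  have S2: "(\<Sum>u\<in>{z}. prob ?P a u) = 1"
    by (rule transfer_take[OF almost_Z_YX_XY_XY_YX_share1_Z_YX[of a b c d] P, where n = 1]) auto
  have A3: "(\<Sum>u\<in>{x, z}. prob ?P a u) = 1"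
    by (rule agent_assigned[OF P, where V = "{z}" and J = "{}"]) (auto split: if_splits)
  have O4: "(\<Sum>i\<in>{a, b, c, d}. prob ?P i x) = 1"
    by (rule object_assigned[OF P, where I = "{b, c}" and V = "{x, y}"]) (auto split: if_splits)
  have O5: "(\<Sum>i\<in>{b, c, d}. prob ?P i y) = 1"
    by (rule object_assigned[OF P, where I = "{b, c}" and V = "{x, y}"]) (auto split: if_splits)
  have E: "prob ?P c u = prob ?P b u" for u by (rule equals[OF P], simp)
  show ?thesis using S1 S2 A3 O4 O5 E by (simp add: sums; linarith)
qed

lemma almost_XZY_XZY_XY_XYZ_share1_XY:
  assumes agents: "distinct [a, b, c, d]"
  shows "(\<Sum>u\<in>{x}. prob (quad a XZY b XZY c XY d XYZ) c u) = 1 / 4"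
proof -
  note [simp] = distinct4[OF agents] objects quad_apply proper_def
  let ?P = "quad a XZY b XZY c XY d XYZ"
  have P: "proper ?P" by simp
  have S1: "(\<Sum>u\<in>{x}. prob ?P a u) = 1 / 4"
    by (rule transfer_take[OF almost_XZY_XY_XYZ_XYZ_share1_XYZ[of b c a d] P, where n = 1]) auto
  have O2: "(\<Sum>i\<in>{a, b, c, d}. prob ?P i x) = 1"
    by (rule object_assigned[OF P, where I = "{a, b, c}" and V = "{x, y, z}"])
      (auto split: if_splits)
  have E3: "prob ?P c x = prob ?P d x" by (rule almost_equals[OF P]) simp_all
  have E: "prob ?P b u = prob ?P a u" for u by (rule equals[OF P], simp)
  show ?thesis using S1 O2 E3 E by (simp add: sums; linarith)
qed

lemma almost_X_X_X_YXZ_share1_X: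
  assumes agents: "distinct [a, b, c, d]"
  shows "(\<Sum>u\<in>{x}. prob (quad a X b X c X d YXZ) a u) = 1 / 3"
proof -
  note [simp] = distinct4[OF agents] objects quad_apply proper_def
  let ?P = "quad a X b X c X d YXZ"
  have P: "proper ?P" by simp
  have S1: "(\<Sum>u\<in>{y}. prob ?P d u) = 1"
    by (rule transfer_take[OF almost_X_X_X_Y_share1_Y[of a b c d] P, where n = 1]) auto
  have S2: "(\<Sum>u\<in>{x, y}. prob ?P d u) = 1"
    by (rule transfer_take[OF almost_X_X_X_YX_share2_YX[of a b c d] P, where n = 2]) auto
  have O3: "(\<Sum>i\<in>{a, b, c, d}. prob ?P i x) = 1"
    by (rule object_assigned[OF P, where I = "{a}" and V = "{x}"]) (auto split: if_splits)
  have E: "prob ?P b u = prob ?P a u" "prob ?P c u = prob ?P a u" for u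
    by (rule equals[OF P], simp)+
  show ?thesis using S1 S2 O3 E by (simp add: sums; linarith)
qed

lemma almost_ZX_XY_XY_XYZ_share2_XY:
  assumes agents: "distinct [a, b, c, d]"
  shows "(\<Sum>u\<in>{x, y}. prob (quad a ZX b XY c XY d XYZ) b u) = 2 / 3"
proof -
  note [simp] = distinct4[OF agents] objects quad_apply proper_def
  let ?P = "quad a ZX b XY c XY d XYZ"
  have P: "proper ?P" by simp
  have S1: "(\<Sum>u\<in>{x, y}. prob ?P d u) = 2 / 3"
    by (rule transfer_take[OF almost_ZX_XY_XY_XY_share2_XY[of a d b c] P, where n = 2]) auto
  have E2: "prob ?P b x = prob ?P d x" by (rule almost_equals[OF P]) simp_all
  have E3: "prob ?P b y = prob ?P d y" by (rule almost_equals[OF P]) simp_all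
  show ?thesis using S1 E2 E3 by (simp add: sums; linarith)
qed

lemma almost_XZY_XY_XY_XYZ_share1_XYZ:
  assumes agents: "distinct [a, b, c, d]"
  shows "(\<Sum>u\<in>{x}. prob (quad a XZY b XY c XY d XYZ) d u) = 1 / 4"
proof -
  note [simp] = distinct4[OF agents] objects quad_apply proper_def
  let ?P = "quad a XZY b XY c XY d XYZ"
  have P: "proper ?P" by simp
  have S1: "(\<Sum>u\<in>{x}. prob ?P b u) = 1 / 4"
    by (rule transfer_take[OF almost_XZY_XY_XYZ_XYZ_share1_XYZ[of a c b d] P, where n = 1]) auto
  have E2: "prob ?P b x = prob ?P d x" by (rule almost_equals[OF P]) simp_all
  show ?thesis using S1 E2 by (simp add: sums; linarith)
qed

lemma almost_ZX_XY_YX_YXZ_share2_YX: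
  assumes agents: "distinct [a, b, c, d]"
  shows "(\<Sum>u\<in>{x, y}. prob (quad a ZX b XY c YX d YXZ) c u) = 2 / 3"
proof -
  note [simp] = distinct4[OF agents] objects quad_apply proper_def
  let ?P = "quad a ZX b XY c YX d YXZ"
  have P: "proper ?P" by simp
  have S1: "(\<Sum>u\<in>{x, y}. prob ?P d u) = 2 / 3"
    by (rule transfer_take[OF almost_ZX_XY_XY_YX_share2_XY[of a d b c] P, where n = 2]) auto
  have E2: "prob ?P c y = prob ?P d y" by (rule almost_equals[OF P]) simp_all
  have E3: "prob ?P c x = prob ?P d x" by (rule almost_equals[OF P]) simp_all
  show ?thesis using S1 E2 E3 by (simp add: sums; linarith)
qed

lemma almost_XZ_XZY_XZY_XYZ_share1_XZY:
  assumes agents: "distinct [a, b, c, d]"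
  shows "(\<Sum>u\<in>{x}. prob (quad a XZ b XZY c XZY d XYZ) b u) = 1 / 4"
proof -
  note [simp] = distinct4[OF agents] objects quad_apply proper_def
  let ?P = "quad a XZ b XZY c XZY d XYZ"
  have P: "proper ?P" by simp
  have S1: "(\<Sum>u\<in>{x}. prob ?P a u) = 1 / 4"
    by (rule transfer_take[OF almost_XZY_XZY_XY_XYZ_share1_XY[of b c a d] P, where n = 1]) auto
  have E2: "prob ?P a x = prob ?P b x" by (rule almost_equals[OF P]) simp_all
  show ?thesis using S1 E2 by (simp add: sums; linarith)
qed

lemma almost_X_X_XY_YXZ_share1_X:
  assumes agents: "distinct [a, b, c, d]"
  shows "(\<Sum>u\<in>{x}. prob (quad a X b X c XY d YXZ) a u) = 1 / 3"
proof -
  note [simp] = distinct4[OF agents] objects quad_apply proper_def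
  let ?P = "quad a X b X c XY d YXZ"
  have P: "proper ?P" by simp
  have S1: "(\<Sum>u\<in>{x}. prob ?P c u) = 1 / 3"
    by (rule transfer_take[OF almost_X_X_X_YXZ_share1_X[of c a b d] P, where n = 1]) auto
  have E2: "prob ?P a x = prob ?P c x" by (rule almost_equals[OF P]) simp_all
  show ?thesis using S1 E2 by (simp add: sums; linarith)
qed

text \<open>\<open>a\<close> is always served within \<open>x\<close> and \<open>z\<close>, so the
  others split \<open>y\<close>: 1/4 + 1/3.\<close>

lemma almost_XZY_XY_XY_XY_share2_XY:
  assumes agents: "distinct [a, b, c, d]"
  shows "(\<Sum>u\<in>{x, y}. prob (quad a XZY b XY c XY d XY) b u) = 7 / 12"
proof -
  note [simp] = distinct4[OF agents] objects quad_apply proper_def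
  let ?P = "quad a XZY b XY c XY d XY"
  have P: "proper ?P" by simp
  have S1: "(\<Sum>u\<in>{x, z}. prob ?P a u) = 1"
    by (rule transfer_take[OF almost_ZX_XY_XY_XY_share2_ZX[of a b c d] P, where n = 2]) auto
  have S2: "(\<Sum>u\<in>{x}. prob ?P b u) = 1 / 4"
    by (rule transfer_take[OF almost_XZY_XY_XY_XYZ_share1_XYZ[of a c d b] P, where n = 1]) auto
  have A3: "(\<Sum>u\<in>{x, y, z}. prob ?P a u) = 1"
    by (rule agent_assigned[OF P, where V = "{z}" and J = "{}"]) (auto split: if_splits)
  have O4: "(\<Sum>i\<in>{a, b, c, d}. prob ?P i y) = 1"
    by (rule object_assigned[OF P, where I = "{b, c}" and V = "{x, y}"]) (auto split: if_splits)
  have E: "prob ?P c u = prob ?P b u" "prob ?P d u = prob ?P b u" for u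
    by (rule equals[OF P], simp)+
  show ?thesis using S1 S2 A3 O4 E by (simp add: sums; linarith)
qed

lemma almost_XZ_XZY_XY_XY_share1_XZY:
  assumes agents: "distinct [a, b, c, d]"
  shows "(\<Sum>u\<in>{x}. prob (quad a XZ b XZY c XY d XY) b u) = 1 / 4"
proof -
  note [simp] = distinct4[OF agents] objects quad_apply proper_def
  let ?P = "quad a XZ b XZY c XY d XY"
  have P: "proper ?P" by simp
  have S1: "(\<Sum>u\<in>{x}. prob ?P a u) = 1 / 4"
    by (rule transfer_take[OF almost_XZY_XY_XY_XYZ_share1_XYZ[of b c d a] P, where n = 1]) auto
  have E2: "prob ?P a x = prob ?P b x" by (rule almost_equals[OF P]) simp_all
  show ?thesis using S1 E2 by (simp add: sums; linarith)
qed

lemma almost_XZ_XZ_XZY_XYZ_share1_XZY: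
  assumes agents: "distinct [a, b, c, d]"
  shows "(\<Sum>u\<in>{x}. prob (quad a XZ b XZ c XZY d XYZ) c u) = 1 / 4"
proof -
  note [simp] = distinct4[OF agents] objects quad_apply proper_def
  let ?P = "quad a XZ b XZ c XZY d XYZ"
  have P: "proper ?P" by simp
  have S1: "(\<Sum>u\<in>{x}. prob ?P a u) = 1 / 4"
    by (rule transfer_take[OF almost_XZ_XZY_XZY_XYZ_share1_XZY[of b a c d] P, where n = 1]) auto
  have E2: "prob ?P a x = prob ?P c x" by (rule almost_equals[OF P]) simp_all
  show ?thesis using S1 E2 by (simp add: sums; linarith)
qed

lemma almost_X_XY_XY_YXZ_share1_X:
  assumes agents: "distinct [a, b, c, d]"
  shows "(\<Sum>u\<in>{x}. prob (quad a X b XY c XY d YXZ) a u) = 1 / 3"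
proof -
  note [simp] = distinct4[OF agents] objects quad_apply proper_def
  let ?P = "quad a X b XY c XY d YXZ"
  have P: "proper ?P" by simp
  have S1: "(\<Sum>u\<in>{x}. prob ?P b u) = 1 / 3"
    by (rule transfer_take[OF almost_X_X_XY_YXZ_share1_X[of b a c d] P, where n = 1]) auto
  have E2: "prob ?P a x = prob ?P b x" by (rule almost_equals[OF P]) simp_all
  show ?thesis using S1 E2 by (simp add: sums; linarith)
qed

lemma almost_XZY_XY_XY_XYZ_share2_XY:
  assumes agents: "distinct [a, b, c, d]"
  shows "(\<Sum>u\<in>{x, y}. prob (quad a XZY b XY c XY d XYZ) b u) = 7 / 12"
proof -
  note [simp] = distinct4[OF agents] objects quad_apply proper_def
  let ?P = "quad a XZY b XY c XY d XYZ"
  have P: "proper ?P" by simp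
  have S1: "(\<Sum>u\<in>{x, y}. prob ?P d u) = 7 / 12"
    by (rule transfer_take[OF almost_XZY_XY_XY_XY_share2_XY[of a d b c] P, where n = 2]) auto
  have E2: "prob ?P b x = prob ?P d x" by (rule almost_equals[OF P]) simp_all
  have E3: "prob ?P b y = prob ?P d y" by (rule almost_equals[OF P]) simp_all
  show ?thesis using S1 E2 E3 by (simp add: sums; linarith)
qed

lemma almost_XZ_XZ_XY_XY_share2_XZ:
  assumes agents: "distinct [a, b, c, d]"
  shows "(\<Sum>u\<in>{x, z}. prob (quad a XZ b XZ c XY d XY) a u) = 3 / 4"
proof -
  note [simp] = distinct4[OF agents] objects quad_apply proper_def
  let ?P = "quad a XZ b XZ c XY d XY"
  have P: "proper ?P" by simp
  have S1: "(\<Sum>u\<in>{x}. prob ?P a u) = 1 / 4"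
    by (rule transfer_take[OF almost_XZ_XZY_XY_XY_share1_XZY[of b a c d] P, where n = 1]) auto
  have O2: "(\<Sum>i\<in>{a, b}. prob ?P i z) = 1"
    by (rule object_assigned[OF P, where I = "{a, b}" and V = "{x, z}"]) (auto split: if_splits)
  have E: "prob ?P b u = prob ?P a u" for u by (rule equals[OF P], simp)
  show ?thesis using S1 O2 E by (simp add: sums; linarith)
qed

text \<open>\<open>d\<close> is always served within \<open>x\<close> and \<open>y\<close>, so the
  others split \<open>z\<close>: 1/4 + 1/3.\<close>

lemma almost_XZ_XZ_XZ_XYZ_share2_XZ:
  assumes agents: "distinct [a, b, c, d]"
  shows "(\<Sum>u\<in>{x, z}. prob (quad a XZ b XZ c XZ d XYZ) a u) = 7 / 12"
proof -
  note [simp] = distinct4[OF agents] objects quad_apply proper_def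
  let ?P = "quad a XZ b XZ c XZ d XYZ"
  have P: "proper ?P" by simp
  have S1: "(\<Sum>u\<in>{x, y}. prob ?P d u) = 1"
    by (rule transfer_take[OF almost_XZ_XZ_XZ_XY_share2_XY[of a b c d] P, where n = 2]) auto
  have S2: "(\<Sum>u\<in>{x}. prob ?P a u) = 1 / 4"
    by (rule transfer_take[OF almost_XZ_XZ_XZY_XYZ_share1_XZY[of b c a d] P, where n = 1]) auto
  have A3: "(\<Sum>u\<in>{x, y, z}. prob ?P d u) = 1"
    by (rule agent_assigned[OF P, where V = "{y}" and J = "{}"]) (auto split: if_splits)
  have O4: "(\<Sum>i\<in>{a, b, c, d}. prob ?P i z) = 1"
    by (rule object_assigned[OF P, where I = "{a, b}" and V = "{x, z}"]) (auto split: if_splits)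
  have E: "prob ?P b u = prob ?P a u" "prob ?P c u = prob ?P a u" for u
    by (rule equals[OF P], simp)+
  show ?thesis using S1 S2 A3 O4 E by (simp add: sums; linarith)
qed

text \<open>\<open>b\<close>, \<open>c\<close> and \<open>d\<close> each receive 7/12 - 1/4 = 1/3 of
  \<open>y\<close>. Nothing of \<open>y\<close> is left for \<open>a\<close>, whose total is
  5/6.\<close>

lemma almost_XZY_XY_XYZ_XYZ_share2_XZY:
  assumes agents: "distinct [a, b, c, d]"
  shows "(\<Sum>u\<in>{x, z}. prob (quad a XZY b XY c XYZ d XYZ) a u) = 5 / 6"
proof -
  note [simp] = distinct4[OF agents] objects quad_apply proper_def
  let ?P = "quad a XZY b XY c XYZ d XYZ"
  have P: "proper ?P" by simp
  have S1: "(\<Sum>u\<in>{x}. prob ?P a u) = 1 / 4"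
    by (rule transfer_take[OF almost_XY_XYZ_XYZ_XYZ_share1_XYZ[of b a c d] P, where n = 1]) auto
  have S2: "(\<Sum>u\<in>{x, y, z}. prob ?P a u) = 5 / 6"
    by (rule transfer_take[OF almost_XY_XYZ_XYZ_XYZ_share3_XYZ[of b a c d] P, where n = 3]) auto
  have S3: "(\<Sum>u\<in>{x, y}. prob ?P c u) = 7 / 12"
    by (rule transfer_take[OF almost_XZY_XY_XY_XYZ_share2_XY[of a c b d] P, where n = 2]) auto
  have O4: "(\<Sum>i\<in>{a, b, c, d}. prob ?P i x) = 1"
    by (rule object_assigned[OF P, where I = "{a, b, c}" and V = "{x, y, z}"])
      (auto split: if_splits)
  have O5: "(\<Sum>i\<in>{a, b, c, d}. prob ?P i y) = 1"
    by (rule object_assigned[OF P, where I = "{a, b, c}" and V = "{x, y, z}"])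
      (auto split: if_splits)
  have E6: "prob ?P b x = prob ?P c x" by (rule almost_equals[OF P]) simp_all
  have E7: "prob ?P b y = prob ?P c y" by (rule almost_equals[OF P]) simp_all
  have E: "prob ?P d u = prob ?P c u" for u by (rule equals[OF P], simp)
  show ?thesis using S1 S2 S3 O4 O5 E6 E7 E by (simp add: sums; linarith)
qed

text \<open>All objects are always assigned, so the totals of the agents add up to 3: 5/6 + 7/12 + 2
  * 19/24.\<close>

lemma almost_XZY_XY_XYZ_XYZ_share3_XYZ:
  assumes agents: "distinct [a, b, c, d]"
  shows "(\<Sum>u\<in>{x, y, z}. prob (quad a XZY b XY c XYZ d XYZ) c u) = 19 / 24"
proof -
  note [simp] = distinct4[OF agents] objects quad_apply proper_def
  let ?P = "quad a XZY b XY c XYZ d XYZ"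
  have P: "proper ?P" by simp
  have S1: "(\<Sum>u\<in>{x, y, z}. prob ?P a u) = 5 / 6"
    by (rule transfer_take[OF almost_XY_XYZ_XYZ_XYZ_share3_XYZ[of b a c d] P, where n = 3]) auto
  have S2: "(\<Sum>u\<in>{x, y}. prob ?P c u) = 7 / 12"
    by (rule transfer_take[OF almost_XZY_XY_XY_XYZ_share2_XY[of a c b d] P, where n = 2]) auto
  have O3: "(\<Sum>i\<in>{a, b, c, d}. prob ?P i x) = 1"
    by (rule object_assigned[OF P, where I = "{a, b, c}" and V = "{x, y, z}"])
      (auto split: if_splits)
  have O4: "(\<Sum>i\<in>{a, b, c, d}. prob ?P i y) = 1"
    by (rule object_assigned[OF P, where I = "{a, b, c}" and V = "{x, y, z}"])
      (auto split: if_splits)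
  have O5: "(\<Sum>i\<in>{a, c, d}. prob ?P i z) = 1"
    by (rule object_assigned[OF P, where I = "{a, c, d}" and V = "{x, y, z}"])
      (auto split: if_splits)
  have E6: "prob ?P b x = prob ?P c x" by (rule almost_equals[OF P]) simp_all
  have E7: "prob ?P b y = prob ?P c y" by (rule almost_equals[OF P]) simp_all
  have E: "prob ?P d u = prob ?P c u" for u by (rule equals[OF P], simp)
  show ?thesis using S1 S2 O3 O4 O5 E6 E7 E by (simp add: sums; linarith)
qed

lemma almost_XZ_XZY_XY_XY_share2_XZ:
  assumes agents: "distinct [a, b, c, d]"
  shows "(\<Sum>u\<in>{x, z}. prob (quad a XZ b XZY c XY d XY) a u) = 3 / 4"
proof -
  note [simp] = distinct4[OF agents] objects quad_apply proper_def
  let ?P = "quad a XZ b XZY c XY d XY"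
  have P: "proper ?P" by simp
  have S1: "(\<Sum>u\<in>{x, z}. prob ?P b u) = 3 / 4"
    by (rule transfer_take[OF almost_XZ_XZ_XY_XY_share2_XZ[of b a c d] P, where n = 2]) auto
  have E2: "prob ?P a x = prob ?P b x" by (rule almost_equals[OF P]) simp_all
  have E3: "prob ?P a z = prob ?P b z" by (rule almost_equals[OF P]) simp_all
  show ?thesis using S1 E2 E3 by (simp add: sums; linarith)
qed

lemma almost_XZ_XZ_XZY_XYZ_share2_XZ:
  assumes agents: "distinct [a, b, c, d]"
  shows "(\<Sum>u\<in>{x, z}. prob (quad a XZ b XZ c XZY d XYZ) a u) = 7 / 12"
proof -
  note [simp] = distinct4[OF agents] objects quad_apply proper_def
  let ?P = "quad a XZ b XZ c XZY d XYZ"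
  have P: "proper ?P" by simp
  have S1: "(\<Sum>u\<in>{x, z}. prob ?P c u) = 7 / 12"
    by (rule transfer_take[OF almost_XZ_XZ_XZ_XYZ_share2_XZ[of c a b d] P, where n = 2]) auto
  have E2: "prob ?P a x = prob ?P c x" by (rule almost_equals[OF P]) simp_all
  have E3: "prob ?P a z = prob ?P c z" by (rule almost_equals[OF P]) simp_all
  show ?thesis using S1 E2 E3 by (simp add: sums; linarith)
qed

text \<open>Three agents with 2/3 each exhaust \<open>x\<close> and \<open>y\<close>, so the share
  5/6 of \<open>a\<close> in \<open>x\<close> and \<open>z\<close> consists of \<open>z\<close>
  alone.\<close>

lemma almost_ZX_XY_XYZ_XYZ_share1_ZX:
  assumes agents: "distinct [a, b, c, d]"
  shows "(\<Sum>u\<in>{z}. prob (quad a ZX b XY c XYZ d XYZ) a u) = 5 / 6"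
proof -
  note [simp] = distinct4[OF agents] objects quad_apply proper_def
  let ?P = "quad a ZX b XY c XYZ d XYZ"
  have P: "proper ?P" by simp
  have S1: "(\<Sum>u\<in>{x, y}. prob ?P c u) = 2 / 3"
    by (rule transfer_take[OF almost_ZX_XY_XY_XYZ_share2_XY[of a c b d] P, where n = 2]) auto
  have S2: "(\<Sum>u\<in>{x, z}. prob ?P a u) = 5 / 6"
    by (rule transfer_take[OF almost_XZY_XY_XYZ_XYZ_share2_XZY[of a b c d] P, where n = 2]) auto
  have O3: "(\<Sum>i\<in>{a, b, c, d}. prob ?P i x) = 1"
    by (rule object_assigned[OF P, where I = "{a, b, c}" and V = "{x, y, z}"])
      (auto split: if_splits)
  have O4: "(\<Sum>i\<in>{b, c, d}. prob ?P i y) = 1"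
    by (rule object_assigned[OF P, where I = "{b, c, d}" and V = "{x, y, z}"])
      (auto split: if_splits)
  have E5: "prob ?P b x = prob ?P c x" by (rule almost_equals[OF P]) simp_all
  have E6: "prob ?P b y = prob ?P c y" by (rule almost_equals[OF P]) simp_all
  have E: "prob ?P d u = prob ?P c u" for u by (rule equals[OF P], simp)
  show ?thesis using S1 S2 O3 O4 E5 E6 E by (simp add: sums; linarith)
qed

lemma almost_XZ_XZY_XZY_XYZ_share2_XZ:
  assumes agents: "distinct [a, b, c, d]"
  shows "(\<Sum>u\<in>{x, z}. prob (quad a XZ b XZY c XZY d XYZ) a u) = 7 / 12"
proof -
  note [simp] = distinct4[OF agents] objects quad_apply proper_def
  let ?P = "quad a XZ b XZY c XZY d XYZ"
  have P: "proper ?P" by simp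
  have S1: "(\<Sum>u\<in>{x, z}. prob ?P b u) = 7 / 12"
    by (rule transfer_take[OF almost_XZ_XZ_XZY_XYZ_share2_XZ[of b a c d] P, where n = 2]) auto
  have E2: "prob ?P a x = prob ?P b x" by (rule almost_equals[OF P]) simp_all
  have E3: "prob ?P a z = prob ?P b z" by (rule almost_equals[OF P]) simp_all
  show ?thesis using S1 E2 E3 by (simp add: sums; linarith)
qed

text \<open>Besides 2/3 from \<open>x\<close> and \<open>y\<close>, \<open>c\<close> has half of the
  1/6 of \<open>z\<close> that \<open>a\<close> leaves.\<close>

lemma almost_Z_XY_XYZ_XYZ_share3_XYZ:
  assumes agents: "distinct [a, b, c, d]"
  shows "(\<Sum>u\<in>{x, y, z}. prob (quad a Z b XY c XYZ d XYZ) c u) = 3 / 4"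
proof -
  note [simp] = distinct4[OF agents] objects quad_apply proper_def
  let ?P = "quad a Z b XY c XYZ d XYZ"
  have P: "proper ?P" by simp
  have S1: "(\<Sum>u\<in>{z}. prob ?P a u) = 5 / 6"
    by (rule transfer_take[OF almost_ZX_XY_XYZ_XYZ_share1_ZX[of a b c d] P, where n = 1]) auto
  have O2: "(\<Sum>i\<in>{b, c, d}. prob ?P i x) = 1"
    by (rule object_assigned[OF P, where I = "{b, c, d}" and V = "{x, y, z}"])
      (auto split: if_splits)
  have O3: "(\<Sum>i\<in>{b, c, d}. prob ?P i y) = 1"
    by (rule object_assigned[OF P, where I = "{b, c, d}" and V = "{x, y, z}"])
      (auto split: if_splits)
  have O4: "(\<Sum>i\<in>{a, c, d}. prob ?P i z) = 1"
    by (rule object_assigned[OF P, where I = "{a}" and V = "{z}"]) (auto split: if_splits)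
  have E5: "prob ?P b x = prob ?P c x" by (rule almost_equals[OF P]) simp_all
  have E6: "prob ?P b y = prob ?P c y" by (rule almost_equals[OF P]) simp_all
  have E: "prob ?P d u = prob ?P c u" for u by (rule equals[OF P], simp)
  show ?thesis using S1 O2 O3 O4 E5 E6 E by (simp add: sums; linarith)
qed

text \<open>The others each receive 7/12 - 1/4 = 1/3 of \<open>z\<close>, so the total 3/4 of
  \<open>d\<close> contains no \<open>z\<close>.\<close>

lemma almost_XZY_XZY_XZY_XYZ_share2_XYZ:
  assumes agents: "distinct [a, b, c, d]"
  shows "(\<Sum>u\<in>{x, y}. prob (quad a XZY b XZY c XZY d XYZ) d u) = 3 / 4"
proof -
  note [simp] = distinct4[OF agents] objects quad_apply proper_def
  let ?P = "quad a XZY b XZY c XZY d XYZ"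
  have P: "proper ?P" by simp
  have S1: "(\<Sum>u\<in>{x, y, z}. prob ?P d u) = 3 / 4"
    by (rule transfer_take[OF almost_XZY_XZY_XZY_XZY_share3_XZY[of d a b c] P, where n = 3]) auto
  have S2: "(\<Sum>u\<in>{x}. prob ?P a u) = 1 / 4"
    by (rule transfer_take[OF almost_XZY_XZY_XY_XYZ_share1_XY[of b c a d] P, where n = 1]) auto
  have S3: "(\<Sum>u\<in>{x, z}. prob ?P a u) = 7 / 12"
    by (rule transfer_take[OF almost_XZ_XZY_XZY_XYZ_share2_XZ[of a b c d] P, where n = 2]) auto
  have O4: "(\<Sum>i\<in>{a, b, c, d}. prob ?P i z) = 1"
    by (rule object_assigned[OF P, where I = "{a, b, c}" and V = "{x, y, z}"])
      (auto split: if_splits)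
  have E: "prob ?P b u = prob ?P a u" "prob ?P c u = prob ?P a u" for u
    by (rule equals[OF P], simp)+
  show ?thesis using S1 S2 S3 O4 E by (simp add: sums; linarith)
qed

text \<open>\<open>b\<close> has 3/4 - 1/2 = 1/4 of \<open>x\<close> and \<open>y\<close>; the
  remaining 7/4 is halved.\<close>

lemma almost_Z_ZYX_XY_XYZ_share2_XYZ:
  assumes agents: "distinct [a, b, c, d]"
  shows "(\<Sum>u\<in>{x, y}. prob (quad a Z b ZYX c XY d XYZ) d u) = 7 / 8"
proof -
  note [simp] = distinct4[OF agents] objects quad_apply proper_def
  let ?P = "quad a Z b ZYX c XY d XYZ"
  have P: "proper ?P" by simp
  have S1: "(\<Sum>u\<in>{z}. prob ?P b u) = 1 / 2"
    by (rule transfer_take[OF almost_Z_Z_XY_XYZ_share1_Z[of b a c d] P, where n = 1]) auto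
  have S2: "(\<Sum>u\<in>{x, y, z}. prob ?P b u) = 3 / 4"
    by (rule transfer_take[OF almost_Z_XY_XYZ_XYZ_share3_XYZ[of a c b d] P, where n = 3]) auto
  have O3: "(\<Sum>i\<in>{b, c, d}. prob ?P i x) = 1"
    by (rule object_assigned[OF P, where I = "{b, c, d}" and V = "{x, y, z}"])
      (auto split: if_splits)
  have O4: "(\<Sum>i\<in>{b, c, d}. prob ?P i y) = 1"
    by (rule object_assigned[OF P, where I = "{b, c, d}" and V = "{x, y, z}"])
      (auto split: if_splits)
  have E5: "prob ?P c x = prob ?P d x" by (rule almost_equals[OF P]) simp_all
  have E6: "prob ?P c y = prob ?P d y" by (rule almost_equals[OF P]) simp_all
  show ?thesis using S1 S2 O3 O4 E5 E6 by (simp add: sums; linarith)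
qed

lemma almost_XZY_XZY_XZY_XY_share3_XZY:
  assumes agents: "distinct [a, b, c, d]"
  shows "(\<Sum>u\<in>{x, y, z}. prob (quad a XZY b XZY c XZY d XY) a u) = 3 / 4"
proof -
  note [simp] = distinct4[OF agents] objects quad_apply proper_def
  let ?P = "quad a XZY b XZY c XZY d XY"
  have P: "proper ?P" by simp
  have S1: "(\<Sum>u\<in>{x, y}. prob ?P d u) = 3 / 4"
    by (rule transfer_take[OF almost_XZY_XZY_XZY_XYZ_share2_XYZ[of a b c d] P, where n = 2]) auto
  have O2: "(\<Sum>i\<in>{a, b, c, d}. prob ?P i x) = 1"
    by (rule object_assigned[OF P, where I = "{a, b, c}" and V = "{x, y, z}"])
      (auto split: if_splits)
  have O3: "(\<Sum>i\<in>{a, b, c, d}. prob ?P i y) = 1"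
    by (rule object_assigned[OF P, where I = "{a, b, c}" and V = "{x, y, z}"])
      (auto split: if_splits)
  have O4: "(\<Sum>i\<in>{a, b, c}. prob ?P i z) = 1"
    by (rule object_assigned[OF P, where I = "{a, b, c}" and V = "{x, y, z}"])
      (auto split: if_splits)
  have E: "prob ?P b u = prob ?P a u" "prob ?P c u = prob ?P a u" for u
    by (rule equals[OF P], simp)+
  show ?thesis using S1 O2 O3 O4 E by (simp add: sums; linarith)
qed

lemma almost_Z_ZYX_XY_XY_share3_ZYX:
  assumes agents: "distinct [a, b, c, d]"
  shows "(\<Sum>u\<in>{x, y, z}. prob (quad a Z b ZYX c XY d XY) b u) = 3 / 4"
proof -
  note [simp] = distinct4[OF agents] objects quad_apply proper_def
  let ?P = "quad a Z b ZYX c XY d XY"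
  have P: "proper ?P" by simp
  have S1: "(\<Sum>u\<in>{z}. prob ?P b u) = 1 / 2"
    by (rule transfer_take[OF almost_Z_Z_XY_XY_share1_Z[of b a c d] P, where n = 1]) auto
  have S2: "(\<Sum>u\<in>{x, y}. prob ?P c u) = 7 / 8"
    by (rule transfer_take[OF almost_Z_ZYX_XY_XYZ_share2_XYZ[of a b d c] P, where n = 2]) auto
  have O3: "(\<Sum>i\<in>{b, c, d}. prob ?P i x) = 1"
    by (rule object_assigned[OF P, where I = "{c, d}" and V = "{x, y}"]) (auto split: if_splits)
  have O4: "(\<Sum>i\<in>{b, c, d}. prob ?P i y) = 1"
    by (rule object_assigned[OF P, where I = "{c, d}" and V = "{x, y}"]) (auto split: if_splits)
  have E: "prob ?P d u = prob ?P c u" for u by (rule equals[OF P], simp)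
  show ?thesis using S1 S2 O3 O4 E by (simp add: sums; linarith)
qed

text \<open>Totals add up to 3, so \<open>c\<close> has 3 - 2 * 19/24 - 3/4 = 2/3, and
  \<open>d\<close> has the same share of \<open>x\<close> and \<open>y\<close>.\<close>

lemma almost_XZY_XZY_XY_XYZ_share2_XYZ:
  assumes agents: "distinct [a, b, c, d]"
  shows "(\<Sum>u\<in>{x, y}. prob (quad a XZY b XZY c XY d XYZ) d u) = 2 / 3"
proof -
  note [simp] = distinct4[OF agents] objects quad_apply proper_def
  let ?P = "quad a XZY b XZY c XY d XYZ"
  have P: "proper ?P" by simp
  have S1: "(\<Sum>u\<in>{x, y, z}. prob ?P a u) = 19 / 24"
    by (rule transfer_take[OF almost_XZY_XY_XYZ_XYZ_share3_XYZ[of b c a d] P, where n = 3]) auto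
  have S2: "(\<Sum>u\<in>{x, y, z}. prob ?P d u) = 3 / 4"
    by (rule transfer_take[OF almost_XZY_XZY_XZY_XY_share3_XZY[of d a b c] P, where n = 3]) auto
  have O3: "(\<Sum>i\<in>{a, b, c, d}. prob ?P i x) = 1"
    by (rule object_assigned[OF P, where I = "{a, b, c}" and V = "{x, y, z}"])
      (auto split: if_splits)
  have O4: "(\<Sum>i\<in>{a, b, c, d}. prob ?P i y) = 1"
    by (rule object_assigned[OF P, where I = "{a, b, c}" and V = "{x, y, z}"])
      (auto split: if_splits)
  have O5: "(\<Sum>i\<in>{a, b, d}. prob ?P i z) = 1"
    by (rule object_assigned[OF P, where I = "{a, b, d}" and V = "{x, y, z}"])
      (auto split: if_splits)
  have E6: "prob ?P c x = prob ?P d x" by (rule almost_equals[OF P]) simp_all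
  have E7: "prob ?P c y = prob ?P d y" by (rule almost_equals[OF P]) simp_all
  have E: "prob ?P b u = prob ?P a u" for u by (rule equals[OF P], simp)
  show ?thesis using S1 S2 O3 O4 O5 E6 E7 E by (simp add: sums; linarith)
qed

text \<open>\<open>d\<close> receives 3/4 - 2/3 = 1/12 of \<open>z\<close>, and \<open>a\<close> the
  rest.\<close>

lemma almost_Z_XY_XY_YXZ_share1_Z:
  assumes agents: "distinct [a, b, c, d]"
  shows "(\<Sum>u\<in>{z}. prob (quad a Z b XY c XY d YXZ) a u) = 11 / 12"
proof -
  note [simp] = distinct4[OF agents] objects quad_apply proper_def
  let ?P = "quad a Z b XY c XY d YXZ"
  have P: "proper ?P" by simp
  have S1: "(\<Sum>u\<in>{x, y}. prob ?P d u) = 2 / 3"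
    by (rule transfer_take[OF almost_Z_XY_XY_XY_share2_XY[of a d b c] P, where n = 2]) auto
  have S2: "(\<Sum>u\<in>{x, y, z}. prob ?P d u) = 3 / 4"
    by (rule transfer_take[OF almost_Z_ZYX_XY_XY_share3_ZYX[of a d b c] P, where n = 3]) auto
  have O3: "(\<Sum>i\<in>{a, d}. prob ?P i z) = 1"
    by (rule object_assigned[OF P, where I = "{a}" and V = "{z}"]) (auto split: if_splits)
  show ?thesis using S1 S2 O3 by (simp add: sums; linarith)
qed

text \<open>\<open>c\<close> and \<open>d\<close> leave 1/3 of \<open>x\<close> and \<open>y\<close>
  to each of \<open>a\<close> and \<open>b\<close>. Of this 1/4 is \<open>x\<close>, so 1/12 of
  \<open>y\<close> is added to the 3/4 in \<open>x\<close> and \<open>z\<close>.\<close>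

lemma almost_XZY_XZY_XY_XY_share3_XZY:
  assumes agents: "distinct [a, b, c, d]"
  shows "(\<Sum>u\<in>{x, y, z}. prob (quad a XZY b XZY c XY d XY) a u) = 5 / 6"
proof -
  note [simp] = distinct4[OF agents] objects quad_apply proper_def
  let ?P = "quad a XZY b XZY c XY d XY"
  have P: "proper ?P" by simp
  have S1: "(\<Sum>u\<in>{x}. prob ?P a u) = 1 / 4"
    by (rule transfer_take[OF almost_XZY_XY_XY_XYZ_share1_XYZ[of b c d a] P, where n = 1]) auto
  have S2: "(\<Sum>u\<in>{x, z}. prob ?P a u) = 3 / 4"
    by (rule transfer_take[OF almost_XZ_XZY_XY_XY_share2_XZ[of a b c d] P, where n = 2]) auto
  have S3: "(\<Sum>u\<in>{x, y}. prob ?P c u) = 2 / 3"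
    by (rule transfer_take[OF almost_XZY_XZY_XY_XYZ_share2_XYZ[of a b d c] P, where n = 2]) auto
  have O4: "(\<Sum>i\<in>{a, b, c, d}. prob ?P i x) = 1"
    by (rule object_assigned[OF P, where I = "{c, d}" and V = "{x, y}"]) (auto split: if_splits)
  have O5: "(\<Sum>i\<in>{a, b, c, d}. prob ?P i y) = 1"
    by (rule object_assigned[OF P, where I = "{c, d}" and V = "{x, y}"]) (auto split: if_splits)
  have E: "prob ?P b u = prob ?P a u" "prob ?P d u = prob ?P c u" for u
    by (rule equals[OF P], simp)+
  show ?thesis using S1 S2 S3 O4 O5 E by (simp add: sums; linarith)
qed

text \<open>\<open>b\<close>, \<open>c\<close> and \<open>d\<close> exhaust \<open>x\<close> and
  \<open>y\<close>, so \<open>a\<close> has only its 11/12 of \<open>z\<close>.\<close>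

lemma almost_ZX_XY_XY_YXZ_share2_ZX:
  assumes agents: "distinct [a, b, c, d]"
  shows "(\<Sum>u\<in>{x, z}. prob (quad a ZX b XY c XY d YXZ) a u) = 11 / 12"
proof -
  note [simp] = distinct4[OF agents] objects quad_apply proper_def
  let ?P = "quad a ZX b XY c XY d YXZ"
  have P: "proper ?P" by simp
  have S1: "(\<Sum>u\<in>{x, y}. prob ?P d u) = 2 / 3"
    by (rule transfer_take[OF almost_ZX_XY_XY_XY_share2_XY[of a d b c] P, where n = 2]) auto
  have S2: "(\<Sum>u\<in>{x, y}. prob ?P b u) = 2 / 3"
    by (rule transfer_take[OF almost_ZX_XY_YX_YXZ_share2_YX[of a c b d] P, where n = 2]) auto
  have S3: "(\<Sum>u\<in>{z}. prob ?P a u) = 11 / 12"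
    by (rule transfer_take[OF almost_Z_XY_XY_YXZ_share1_Z[of a b c d] P, where n = 1]) auto
  have O4: "(\<Sum>i\<in>{a, b, c, d}. prob ?P i x) = 1"
    by (rule object_assigned[OF P, where I = "{b, c}" and V = "{x, y}"]) (auto split: if_splits)
  have O5: "(\<Sum>i\<in>{b, c, d}. prob ?P i y) = 1"
    by (rule object_assigned[OF P, where I = "{b, c}" and V = "{x, y}"]) (auto split: if_splits)
  have E: "prob ?P c u = prob ?P b u" for u by (rule equals[OF P], simp)
  show ?thesis using S1 S2 S3 O4 O5 E by (simp add: sums; linarith)
qed

text \<open>When \<open>d\<close> permutes its acceptable objects, its total is unchanged; 1/6 is
  left for being unassigned.\<close>

lemma almost_wasteful_agent:
  assumes agents: "distinct [a, b, c, d]"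
  shows "(\<Sum>u\<in>{x, y, z}. prob (quad a XZY b XY c XY d YXZ) d u) = 5 / 6"
proof -
  note [simp] = distinct4[OF agents] objects quad_apply proper_def
  let ?P = "quad a XZY b XY c XY d YXZ"
  have P: "proper ?P" by simp
  have S1: "(\<Sum>u\<in>{x, y, z}. prob ?P d u) = 5 / 6"
    by (rule transfer_take[OF almost_XZY_XZY_XY_XY_share3_XZY[of d a b c] P, where n = 3]) auto
  show ?thesis using S1 by (simp add: sums; linarith)
qed

text \<open>\<open>a\<close> receives 11/12 - 1/3 = 7/12 of \<open>z\<close>, and \<open>d\<close>
  receives 5/6 - 7/12 = 1/4.\<close>

lemma almost_wasteful_object:
  assumes agents: "distinct [a, b, c, d]"
  shows "prob (quad a XZY b XY c XY d YXZ) a z + prob (quad a XZY b XY c XY d YXZ) d z = 5 / 6"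
proof -
  note [simp] = distinct4[OF agents] objects quad_apply proper_def
  let ?P = "quad a XZY b XY c XY d YXZ"
  have P: "proper ?P" by simp
  have S1: "(\<Sum>u\<in>{x, y}. prob ?P d u) = 7 / 12"
    by (rule transfer_take[OF almost_XZY_XY_XY_XY_share2_XY[of a d b c] P, where n = 2]) auto
  have S2: "(\<Sum>u\<in>{x}. prob ?P a u) = 1 / 3"
    by (rule transfer_take[OF almost_X_XY_XY_YXZ_share1_X[of a b c d] P, where n = 1]) auto
  have S3: "(\<Sum>u\<in>{x, y, z}. prob ?P d u) = 5 / 6"
    by (rule transfer_take[OF almost_XZY_XZY_XY_XY_share3_XZY[of d a b c] P, where n = 3]) auto
  have S4: "(\<Sum>u\<in>{x, z}. prob ?P a u) = 11 / 12"
    by (rule transfer_take[OF almost_ZX_XY_XY_YXZ_share2_ZX[of a b c d] P, where n = 2]) auto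
  show ?thesis using S1 S2 S3 S4 by (simp add: sums; linarith)
qed

end

end

section \<open>Forced probabilities under ex-post efficiency\<close>

context fair_strategy_proof_efficient
begin

context
  fixes x y z :: 'o
  assumes xyz: "distinct [x, y, z]"
begin

abbreviation "ZX \<equiv> ([z, x], [y])"
abbreviation "XY \<equiv> ([x, y], [z])"
abbreviation "ZYX \<equiv> ([z, y, x], [])"
abbreviation "XZY \<equiv> ([x, z, y], [])"
abbreviation "YXZ \<equiv> ([y, x, z], [])"

lemmas objects = distinct3[OF xyz]

lemma sums:
  fixes g :: "'o \<Rightarrow> real"
  shows "(\<Sum>u\<in>{x}. g u) = g x"
    "(\<Sum>u\<in>{y}. g u) = g y"
    "(\<Sum>u\<in>{z}. g u) = g z"
    "(\<Sum>u\<in>{x, y}. g u) = g x + g y"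
    "(\<Sum>u\<in>{x, z}. g u) = g x + g z"
    "(\<Sum>u\<in>{y, z}. g u) = g y + g z"
    "(\<Sum>u\<in>{x, y, z}. g u) = g x + g y + g z"
  using xyz by (simp_all add: add.assoc)

text \<open>Another owner of \<open>y\<close> would trade it for \<open>x\<close>, so
  \<open>d\<close> never holds \<open>x\<close>, which the other three split.\<close>

lemma efficient_XZY_XZY_XZY_YXZ_share1_XZY:
  assumes agents: "distinct [a, b, c, d]"
  shows "(\<Sum>u\<in>{x}. prob (quad a XZY b XZY c XZY d YXZ) a u) = 1 / 3"
proof -
  note [simp] = distinct4[OF agents] objects quad_apply proper_def
  let ?P = "quad a XZY b XZY c XZY d YXZ"
  have P: "proper ?P" by simp
  have Z1: "prob ?P d x = 0" by (rule never_assigned[OF P, where v = y]) (auto split: if_splits)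
  have O2: "(\<Sum>i\<in>{a, b, c, d}. prob ?P i x) = 1"
    by (rule object_assigned[OF P, where I = "{a, b, c}" and V = "{x, y, z}"])
      (auto split: if_splits)
  have E: "prob ?P b u = prob ?P a u" "prob ?P c u = prob ?P a u" for u
    by (rule equals[OF P], simp)+
  show ?thesis using Z1 O2 E by (simp add: sums; linarith)
qed

lemma efficient_XZY_XZY_XZY_XZY_share1_XZY:
  assumes agents: "distinct [a, b, c, d]"
  shows "(\<Sum>u\<in>{x}. prob (quad a XZY b XZY c XZY d XZY) a u) = 1 / 4"
proof -
  note [simp] = distinct4[OF agents] objects quad_apply proper_def
  let ?P = "quad a XZY b XZY c XZY d XZY"
  have P: "proper ?P" by simp
  have O1: "(\<Sum>i\<in>{a, b, c, d}. prob ?P i x) = 1"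
    by (rule object_assigned[OF P, where I = "{a, b, c}" and V = "{x, y, z}"])
      (auto split: if_splits)
  have E: "prob ?P b u = prob ?P a u" "prob ?P c u = prob ?P a u" "prob ?P d u = prob ?P a u" for u
    by (rule equals[OF P], simp)+
  show ?thesis using O1 E by (simp add: sums; linarith)
qed

lemma efficient_XZY_XZY_XZY_XZY_share2_XZY:
  assumes agents: "distinct [a, b, c, d]"
  shows "(\<Sum>u\<in>{x, z}. prob (quad a XZY b XZY c XZY d XZY) a u) = 1 / 2"
proof -
  note [simp] = distinct4[OF agents] objects quad_apply proper_def
  let ?P = "quad a XZY b XZY c XZY d XZY"
  have P: "proper ?P" by simp
  have O1: "(\<Sum>i\<in>{a, b, c, d}. prob ?P i x) = 1"
    by (rule object_assigned[OF P, where I = "{a, b, c}" and V = "{x, y, z}"])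
      (auto split: if_splits)
  have O2: "(\<Sum>i\<in>{a, b, c, d}. prob ?P i z) = 1"
    by (rule object_assigned[OF P, where I = "{a, b, c}" and V = "{x, y, z}"])
      (auto split: if_splits)
  have E: "prob ?P b u = prob ?P a u" "prob ?P c u = prob ?P a u" "prob ?P d u = prob ?P a u" for u
    by (rule equals[OF P], simp)+
  show ?thesis using O1 O2 E by (simp add: sums; linarith)
qed

lemma efficient_XZY_XZY_XZY_XZY_share3_XZY:
  assumes agents: "distinct [a, b, c, d]"
  shows "(\<Sum>u\<in>{x, y, z}. prob (quad a XZY b XZY c XZY d XZY) a u) = 3 / 4"
proof -
  note [simp] = distinct4[OF agents] objects quad_apply proper_def
  let ?P = "quad a XZY b XZY c XZY d XZY"
  have P: "proper ?P" by simp
  have O1: "(\<Sum>i\<in>{a, b, c, d}. prob ?P i x) = 1"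
    by (rule object_assigned[OF P, where I = "{a, b, c}" and V = "{x, y, z}"])
      (auto split: if_splits)
  have O2: "(\<Sum>i\<in>{a, b, c, d}. prob ?P i y) = 1"
    by (rule object_assigned[OF P, where I = "{a, b, c}" and V = "{x, y, z}"])
      (auto split: if_splits)
  have O3: "(\<Sum>i\<in>{a, b, c, d}. prob ?P i z) = 1"
    by (rule object_assigned[OF P, where I = "{a, b, c}" and V = "{x, y, z}"])
      (auto split: if_splits)
  have E: "prob ?P b u = prob ?P a u" "prob ?P c u = prob ?P a u" "prob ?P d u = prob ?P a u" for u
    by (rule equals[OF P], simp)+
  show ?thesis using O1 O2 O3 E by (simp add: sums; linarith)
qed

text \<open>Another owner of \<open>z\<close> would trade it for \<open>x\<close>, so
  \<open>x\<close> and \<open>y\<close> are split among \<open>b\<close>, \<open>c\<close> and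
  \<open>d\<close>.\<close>

lemma efficient_ZX_YXZ_YXZ_YXZ_share2_YXZ:
  assumes agents: "distinct [a, b, c, d]"
  shows "(\<Sum>u\<in>{x, y}. prob (quad a ZX b YXZ c YXZ d YXZ) b u) = 2 / 3"
proof -
  note [simp] = distinct4[OF agents] objects quad_apply proper_def
  let ?P = "quad a ZX b YXZ c YXZ d YXZ"
  have P: "proper ?P" by simp
  have Z1: "prob ?P a x = 0" by (rule never_assigned[OF P, where v = z]) (auto split: if_splits)
  have O2: "(\<Sum>i\<in>{a, b, c, d}. prob ?P i x) = 1"
    by (rule object_assigned[OF P, where I = "{a, b, c}" and V = "{x, y, z}"])
      (auto split: if_splits)
  have O3: "(\<Sum>i\<in>{b, c, d}. prob ?P i y) = 1"
    by (rule object_assigned[OF P, where I = "{b, c, d}" and V = "{x, y, z}"])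
      (auto split: if_splits)
  have E: "prob ?P c u = prob ?P b u" "prob ?P d u = prob ?P b u" for u
    by (rule equals[OF P], simp)+
  show ?thesis using Z1 O2 O3 E by (simp add: sums; linarith)
qed

lemma efficient_XZY_XZY_XZY_XY_share1_XZY:
  assumes agents: "distinct [a, b, c, d]"
  shows "(\<Sum>u\<in>{x}. prob (quad a XZY b XZY c XZY d XY) a u) = 1 / 4"
proof -
  note [simp] = distinct4[OF agents] objects quad_apply proper_def
  let ?P = "quad a XZY b XZY c XZY d XY"
  have P: "proper ?P" by simp
  have S1: "(\<Sum>u\<in>{x}. prob ?P d u) = 1 / 4"
    by (rule transfer_take[OF efficient_XZY_XZY_XZY_XZY_share1_XZY[of d a b c] P, where n = 1]) auto
  have O2: "(\<Sum>i\<in>{a, b, c, d}. prob ?P i x) = 1"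
    by (rule object_assigned[OF P, where I = "{a, b, c}" and V = "{x, y, z}"])
      (auto split: if_splits)
  have E: "prob ?P b u = prob ?P a u" "prob ?P c u = prob ?P a u" for u
    by (rule equals[OF P], simp)+
  show ?thesis using S1 O2 E by (simp add: sums; linarith)
qed

lemma efficient_XZY_XZY_XZY_XY_share2_XZY:
  assumes agents: "distinct [a, b, c, d]"
  shows "(\<Sum>u\<in>{x, z}. prob (quad a XZY b XZY c XZY d XY) a u) = 7 / 12"
proof -
  note [simp] = distinct4[OF agents] objects quad_apply proper_def
  let ?P = "quad a XZY b XZY c XZY d XY"
  have P: "proper ?P" by simp
  have S1: "(\<Sum>u\<in>{x}. prob ?P d u) = 1 / 4"
    by (rule transfer_take[OF efficient_XZY_XZY_XZY_XZY_share1_XZY[of d a b c] P, where n = 1]) auto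
  have O2: "(\<Sum>i\<in>{a, b, c, d}. prob ?P i x) = 1"
    by (rule object_assigned[OF P, where I = "{a, b, c}" and V = "{x, y, z}"])
      (auto split: if_splits)
  have O3: "(\<Sum>i\<in>{a, b, c}. prob ?P i z) = 1"
    by (rule object_assigned[OF P, where I = "{a, b, c}" and V = "{x, y, z}"])
      (auto split: if_splits)
  have E: "prob ?P b u = prob ?P a u" "prob ?P c u = prob ?P a u" for u
    by (rule equals[OF P], simp)+
  show ?thesis using S1 O2 O3 E by (simp add: sums; linarith)
qed

lemma efficient_YXZ_YXZ_YXZ_YXZ_share2_YXZ:
  assumes agents: "distinct [a, b, c, d]"
  shows "(\<Sum>u\<in>{x, y}. prob (quad a YXZ b YXZ c YXZ d YXZ) a u) = 1 / 2"
proof -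
  note [simp] = distinct4[OF agents] objects quad_apply proper_def
  let ?P = "quad a YXZ b YXZ c YXZ d YXZ"
  have P: "proper ?P" by simp
  have O1: "(\<Sum>i\<in>{a, b, c, d}. prob ?P i x) = 1"
    by (rule object_assigned[OF P, where I = "{a, b, c}" and V = "{x, y, z}"])
      (auto split: if_splits)
  have O2: "(\<Sum>i\<in>{a, b, c, d}. prob ?P i y) = 1"
    by (rule object_assigned[OF P, where I = "{a, b, c}" and V = "{x, y, z}"])
      (auto split: if_splits)
  have E: "prob ?P b u = prob ?P a u" "prob ?P c u = prob ?P a u" "prob ?P d u = prob ?P a u" for u
    by (rule equals[OF P], simp)+
  show ?thesis using O1 O2 E by (simp add: sums; linarith)
qed

lemma efficient_YXZ_YXZ_YXZ_YXZ_share3_YXZ: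
  assumes agents: "distinct [a, b, c, d]"
  shows "(\<Sum>u\<in>{x, y, z}. prob (quad a YXZ b YXZ c YXZ d YXZ) a u) = 3 / 4"
proof -
  note [simp] = distinct4[OF agents] objects quad_apply proper_def
  let ?P = "quad a YXZ b YXZ c YXZ d YXZ"
  have P: "proper ?P" by simp
  have O1: "(\<Sum>i\<in>{a, b, c, d}. prob ?P i x) = 1"
    by (rule object_assigned[OF P, where I = "{a, b, c}" and V = "{x, y, z}"])
      (auto split: if_splits)
  have O2: "(\<Sum>i\<in>{a, b, c, d}. prob ?P i y) = 1"
    by (rule object_assigned[OF P, where I = "{a, b, c}" and V = "{x, y, z}"])
      (auto split: if_splits)
  have O3: "(\<Sum>i\<in>{a, b, c, d}. prob ?P i z) = 1"
    by (rule object_assigned[OF P, where I = "{a, b, c}" and V = "{x, y, z}"])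
      (auto split: if_splits)
  have E: "prob ?P b u = prob ?P a u" "prob ?P c u = prob ?P a u" "prob ?P d u = prob ?P a u" for u
    by (rule equals[OF P], simp)+
  show ?thesis using O1 O2 O3 E by (simp add: sums; linarith)
qed

lemma efficient_XZY_XZY_XY_YXZ_share1_XZY:
  assumes agents: "distinct [a, b, c, d]"
  shows "(\<Sum>u\<in>{x}. prob (quad a XZY b XZY c XY d YXZ) a u) = 1 / 3"
proof -
  note [simp] = distinct4[OF agents] objects quad_apply proper_def
  let ?P = "quad a XZY b XZY c XY d YXZ"
  have P: "proper ?P" by simp
  have S1: "(\<Sum>u\<in>{x}. prob ?P c u) = 1 / 3"
    by (rule transfer_take[OF efficient_XZY_XZY_XZY_YXZ_share1_XZY[of c a b d] P, where n = 1]) auto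
  have Z2: "prob ?P d x = 0" by (rule never_assigned[OF P, where v = y]) (auto split: if_splits)
  have O3: "(\<Sum>i\<in>{a, b, c, d}. prob ?P i x) = 1"
    by (rule object_assigned[OF P, where I = "{a, b, c}" and V = "{x, y, z}"])
      (auto split: if_splits)
  have E: "prob ?P b u = prob ?P a u" for u by (rule equals[OF P], simp)
  show ?thesis using S1 Z2 O3 E by (simp add: sums; linarith)
qed

lemma efficient_ZYX_YXZ_YXZ_YXZ_share2_YXZ:
  assumes agents: "distinct [a, b, c, d]"
  shows "(\<Sum>u\<in>{x, y}. prob (quad a ZYX b YXZ c YXZ d YXZ) b u) = 2 / 3"
proof -
  note [simp] = distinct4[OF agents] objects quad_apply proper_def
  let ?P = "quad a ZYX b YXZ c YXZ d YXZ"
  have P: "proper ?P" by simp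
  have Z1: "prob ?P a y = 0" by (rule never_assigned[OF P, where v = z]) (auto split: if_splits)
  have Z2: "prob ?P a x = 0" by (rule never_assigned[OF P, where v = z]) (auto split: if_splits)
  have O3: "(\<Sum>i\<in>{a, b, c, d}. prob ?P i x) = 1"
    by (rule object_assigned[OF P, where I = "{a, b, c}" and V = "{x, y, z}"])
      (auto split: if_splits)
  have O4: "(\<Sum>i\<in>{a, b, c, d}. prob ?P i y) = 1"
    by (rule object_assigned[OF P, where I = "{a, b, c}" and V = "{x, y, z}"])
      (auto split: if_splits)
  have E: "prob ?P c u = prob ?P b u" "prob ?P d u = prob ?P b u" for u
    by (rule equals[OF P], simp)+
  show ?thesis using Z1 Z2 O3 O4 E by (simp add: sums; linarith)
qed

lemma efficient_ZYX_YXZ_YXZ_YXZ_share3_YXZ: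
  assumes agents: "distinct [a, b, c, d]"
  shows "(\<Sum>u\<in>{x, y, z}. prob (quad a ZYX b YXZ c YXZ d YXZ) b u) = 3 / 4"
proof -
  note [simp] = distinct4[OF agents] objects quad_apply proper_def
  let ?P = "quad a ZYX b YXZ c YXZ d YXZ"
  have P: "proper ?P" by simp
  have S1: "(\<Sum>u\<in>{x, y, z}. prob ?P a u) = 3 / 4"
    by (rule transfer_take[OF efficient_YXZ_YXZ_YXZ_YXZ_share3_YXZ[of a b c d] P, where n = 3]) auto
  have O2: "(\<Sum>i\<in>{a, b, c, d}. prob ?P i x) = 1"
    by (rule object_assigned[OF P, where I = "{a, b, c}" and V = "{x, y, z}"])
      (auto split: if_splits)
  have O3: "(\<Sum>i\<in>{a, b, c, d}. prob ?P i y) = 1"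
    by (rule object_assigned[OF P, where I = "{a, b, c}" and V = "{x, y, z}"])
      (auto split: if_splits)
  have O4: "(\<Sum>i\<in>{a, b, c, d}. prob ?P i z) = 1"
    by (rule object_assigned[OF P, where I = "{a, b, c}" and V = "{x, y, z}"])
      (auto split: if_splits)
  have E: "prob ?P c u = prob ?P b u" "prob ?P d u = prob ?P b u" for u
    by (rule equals[OF P], simp)+
  show ?thesis using S1 O2 O3 O4 E by (simp add: sums; linarith)
qed

text \<open>\<open>a\<close> never holds \<open>x\<close>, and \<open>c\<close> or \<open>d\<close>
  would trade \<open>x\<close> for \<open>y\<close>. Hence \<open>b\<close> never holds
  \<open>y\<close>, and its share 2/3 is all \<open>x\<close>.\<close>

lemma efficient_ZX_XY_YXZ_YXZ_share1_XY:
  assumes agents: "distinct [a, b, c, d]"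
  shows "(\<Sum>u\<in>{x}. prob (quad a ZX b XY c YXZ d YXZ) b u) = 2 / 3"
proof -
  note [simp] = distinct4[OF agents] objects quad_apply proper_def
  let ?P = "quad a ZX b XY c YXZ d YXZ"
  have P: "proper ?P" by simp
  have S1: "(\<Sum>u\<in>{x, y}. prob ?P b u) = 2 / 3"
    by (rule transfer_take[OF efficient_ZX_YXZ_YXZ_YXZ_share2_YXZ[of a b c d] P, where n = 2]) auto
  have Z2: "prob ?P a x = 0" by (rule never_assigned[OF P, where v = z]) (auto split: if_splits)
  have Z3: "prob ?P b y = 0" by (rule never_assigned[OF P, where v = x])
      (use Z2 in \<open>auto split: if_splits\<close>)
  show ?thesis using S1 Z3 by (simp add: sums; linarith)
qed

text \<open>Totals add up to 3; the three equal agents split 3 - 1/2.\<close>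

lemma efficient_ZX_XZY_XZY_XZY_share3_XZY:
  assumes agents: "distinct [a, b, c, d]"
  shows "(\<Sum>u\<in>{x, y, z}. prob (quad a ZX b XZY c XZY d XZY) b u) = 5 / 6"
proof -
  note [simp] = distinct4[OF agents] objects quad_apply proper_def
  let ?P = "quad a ZX b XZY c XZY d XZY"
  have P: "proper ?P" by simp
  have S1: "(\<Sum>u\<in>{x, z}. prob ?P a u) = 1 / 2"
    by (rule transfer_take[OF efficient_XZY_XZY_XZY_XZY_share2_XZY[of a b c d] P, where n = 2]) auto
  have O2: "(\<Sum>i\<in>{a, b, c, d}. prob ?P i x) = 1"
    by (rule object_assigned[OF P, where I = "{a, b, c}" and V = "{x, y, z}"])
      (auto split: if_splits)
  have O3: "(\<Sum>i\<in>{b, c, d}. prob ?P i y) = 1"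
    by (rule object_assigned[OF P, where I = "{b, c, d}" and V = "{x, y, z}"])
      (auto split: if_splits)
  have O4: "(\<Sum>i\<in>{a, b, c, d}. prob ?P i z) = 1"
    by (rule object_assigned[OF P, where I = "{a, b, c}" and V = "{x, y, z}"])
      (auto split: if_splits)
  have E: "prob ?P c u = prob ?P b u" "prob ?P d u = prob ?P b u" for u
    by (rule equals[OF P], simp)+
  show ?thesis using S1 O2 O3 O4 E by (simp add: sums; linarith)
qed

text \<open>Another owner of \<open>y\<close> would trade it for \<open>z\<close>, so the total 3/4
  of \<open>d\<close> contains no \<open>z\<close>.\<close>

lemma efficient_XZY_XZY_XZY_YXZ_share2_YXZ:
  assumes agents: "distinct [a, b, c, d]"
  shows "(\<Sum>u\<in>{x, y}. prob (quad a XZY b XZY c XZY d YXZ) d u) = 3 / 4"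
proof -
  note [simp] = distinct4[OF agents] objects quad_apply proper_def
  let ?P = "quad a XZY b XZY c XZY d YXZ"
  have P: "proper ?P" by simp
  have S1: "(\<Sum>u\<in>{x, y, z}. prob ?P d u) = 3 / 4"
    by (rule transfer_take[OF efficient_XZY_XZY_XZY_XZY_share3_XZY[of d a b c] P, where n = 3]) auto
  have Z2: "prob ?P d z = 0" by (rule never_assigned[OF P, where v = y]) (auto split: if_splits)
  show ?thesis using S1 Z2 by (simp add: sums; linarith)
qed

lemma efficient_XZY_XZY_XY_XY_share1_XZY:
  assumes agents: "distinct [a, b, c, d]"
  shows "(\<Sum>u\<in>{x}. prob (quad a XZY b XZY c XY d XY) a u) = 1 / 4"
proof -
  note [simp] = distinct4[OF agents] objects quad_apply proper_def
  let ?P = "quad a XZY b XZY c XY d XY"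
  have P: "proper ?P" by simp
  have S1: "(\<Sum>u\<in>{x}. prob ?P c u) = 1 / 4"
    by (rule transfer_take[OF efficient_XZY_XZY_XZY_XY_share1_XZY[of c a b d] P, where n = 1]) auto
  have O2: "(\<Sum>i\<in>{a, b, c, d}. prob ?P i x) = 1"
    by (rule object_assigned[OF P, where I = "{c, d}" and V = "{x, y}"]) (auto split: if_splits)
  have E: "prob ?P b u = prob ?P a u" "prob ?P d u = prob ?P c u" for u
    by (rule equals[OF P], simp)+
  show ?thesis using S1 O2 E by (simp add: sums; linarith)
qed

lemma efficient_XY_YXZ_YXZ_YXZ_share3_YXZ:
  assumes agents: "distinct [a, b, c, d]"
  shows "(\<Sum>u\<in>{x, y, z}. prob (quad a XY b YXZ c YXZ d YXZ) b u) = 5 / 6"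
proof -
  note [simp] = distinct4[OF agents] objects quad_apply proper_def
  let ?P = "quad a XY b YXZ c YXZ d YXZ"
  have P: "proper ?P" by simp
  have S1: "(\<Sum>u\<in>{x, y}. prob ?P a u) = 1 / 2"
    by (rule transfer_take[OF efficient_YXZ_YXZ_YXZ_YXZ_share2_YXZ[of a b c d] P, where n = 2]) auto
  have O2: "(\<Sum>i\<in>{a, b, c, d}. prob ?P i x) = 1"
    by (rule object_assigned[OF P, where I = "{a, b, c}" and V = "{x, y, z}"])
      (auto split: if_splits)
  have O3: "(\<Sum>i\<in>{a, b, c, d}. prob ?P i y) = 1"
    by (rule object_assigned[OF P, where I = "{a, b, c}" and V = "{x, y, z}"])
      (auto split: if_splits)
  have O4: "(\<Sum>i\<in>{b, c, d}. prob ?P i z) = 1"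
    by (rule object_assigned[OF P, where I = "{b, c, d}" and V = "{x, y, z}"])
      (auto split: if_splits)
  have E: "prob ?P c u = prob ?P b u" "prob ?P d u = prob ?P b u" for u
    by (rule equals[OF P], simp)+
  show ?thesis using S1 O2 O3 O4 E by (simp add: sums; linarith)
qed

lemma efficient_ZYX_XY_YXZ_YXZ_share1_ZYX:
  assumes agents: "distinct [a, b, c, d]"
  shows "(\<Sum>u\<in>{z}. prob (quad a ZYX b XY c YXZ d YXZ) a u) = 5 / 6"
proof -
  note [simp] = distinct4[OF agents] objects quad_apply proper_def
  let ?P = "quad a ZYX b XY c YXZ d YXZ"
  have P: "proper ?P" by simp
  have S1: "(\<Sum>u\<in>{x, y, z}. prob ?P a u) = 5 / 6"
    by (rule transfer_take[OF efficient_XY_YXZ_YXZ_YXZ_share3_YXZ[of b a c d] P, where n = 3]) auto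
  have Z2: "prob ?P a y = 0" by (rule never_assigned[OF P, where v = z]) (auto split: if_splits)
  have Z3: "prob ?P a x = 0" by (rule never_assigned[OF P, where v = z]) (auto split: if_splits)
  show ?thesis using S1 Z2 Z3 by (simp add: sums; linarith)
qed

lemma efficient_ZYX_XY_YXZ_YXZ_share2_YXZ:
  assumes agents: "distinct [a, b, c, d]"
  shows "(\<Sum>u\<in>{x, y}. prob (quad a ZYX b XY c YXZ d YXZ) c u) = 2 / 3"
proof -
  note [simp] = distinct4[OF agents] objects quad_apply proper_def
  let ?P = "quad a ZYX b XY c YXZ d YXZ"
  have P: "proper ?P" by simp
  have S1: "(\<Sum>u\<in>{x, y}. prob ?P b u) = 2 / 3"
    by (rule transfer_take[OF efficient_ZYX_YXZ_YXZ_YXZ_share2_YXZ[of a b c d] P, where n = 2]) auto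
  have Z2: "prob ?P a y = 0" by (rule never_assigned[OF P, where v = z]) (auto split: if_splits)
  have Z3: "prob ?P a x = 0" by (rule never_assigned[OF P, where v = z]) (auto split: if_splits)
  have O4: "(\<Sum>i\<in>{a, b, c, d}. prob ?P i x) = 1"
    by (rule object_assigned[OF P, where I = "{a, b, c}" and V = "{x, y, z}"])
      (auto split: if_splits)
  have O5: "(\<Sum>i\<in>{a, b, c, d}. prob ?P i y) = 1"
    by (rule object_assigned[OF P, where I = "{a, b, c}" and V = "{x, y, z}"])
      (auto split: if_splits)
  have E: "prob ?P d u = prob ?P c u" for u by (rule equals[OF P], simp)
  show ?thesis using S1 Z2 Z3 O4 O5 E by (simp add: sums; linarith)
qed

lemma efficient_ZYX_ZYX_YXZ_YXZ_share3_YXZ: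
  assumes agents: "distinct [a, b, c, d]"
  shows "(\<Sum>u\<in>{x, y, z}. prob (quad a ZYX b ZYX c YXZ d YXZ) c u) = 3 / 4"
proof -
  note [simp] = distinct4[OF agents] objects quad_apply proper_def
  let ?P = "quad a ZYX b ZYX c YXZ d YXZ"
  have P: "proper ?P" by simp
  have S1: "(\<Sum>u\<in>{x, y, z}. prob ?P a u) = 3 / 4"
    by (rule transfer_take[OF efficient_ZYX_YXZ_YXZ_YXZ_share3_YXZ[of b a c d] P, where n = 3]) auto
  have O2: "(\<Sum>i\<in>{a, b, c, d}. prob ?P i x) = 1"
    by (rule object_assigned[OF P, where I = "{a, b, c}" and V = "{x, y, z}"])
      (auto split: if_splits)
  have O3: "(\<Sum>i\<in>{a, b, c, d}. prob ?P i y) = 1"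
    by (rule object_assigned[OF P, where I = "{a, b, c}" and V = "{x, y, z}"])
      (auto split: if_splits)
  have O4: "(\<Sum>i\<in>{a, b, c, d}. prob ?P i z) = 1"
    by (rule object_assigned[OF P, where I = "{a, b, c}" and V = "{x, y, z}"])
      (auto split: if_splits)
  have E: "prob ?P b u = prob ?P a u" "prob ?P d u = prob ?P c u" for u
    by (rule equals[OF P], simp)+
  show ?thesis using S1 O2 O3 O4 E by (simp add: sums; linarith)
qed

text \<open>Of \<open>x\<close> and \<open>y\<close> together, \<open>a\<close> has nothing and
  \<open>b\<close> has 2/3; \<open>c\<close> and \<open>d\<close> halve the remaining 4/3.\<close>

lemma efficient_ZX_XZY_YXZ_YXZ_share2_YXZ:
  assumes agents: "distinct [a, b, c, d]"
  shows "(\<Sum>u\<in>{x, y}. prob (quad a ZX b XZY c YXZ d YXZ) c u) = 2 / 3"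
proof -
  note [simp] = distinct4[OF agents] objects quad_apply proper_def
  let ?P = "quad a ZX b XZY c YXZ d YXZ"
  have P: "proper ?P" by simp
  have S1: "(\<Sum>u\<in>{x}. prob ?P b u) = 2 / 3"
    by (rule transfer_take[OF efficient_ZX_XY_YXZ_YXZ_share1_XY[of a b c d] P, where n = 1]) auto
  have Z2: "prob ?P a x = 0" by (rule never_assigned[OF P, where v = z]) (auto split: if_splits)
  have Z3: "prob ?P b y = 0" by (rule never_assigned[OF P, where v = x])
      (use Z2 in \<open>auto split: if_splits\<close>)
  have O4: "(\<Sum>i\<in>{a, b, c, d}. prob ?P i x) = 1"
    by (rule object_assigned[OF P, where I = "{a, b, c}" and V = "{x, y, z}"])
      (auto split: if_splits)
  have O5: "(\<Sum>i\<in>{b, c, d}. prob ?P i y) = 1"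
    by (rule object_assigned[OF P, where I = "{b, c, d}" and V = "{x, y, z}"])
      (auto split: if_splits)
  have E: "prob ?P d u = prob ?P c u" for u by (rule equals[OF P], simp)
  show ?thesis using S1 Z2 Z3 O4 O5 E by (simp add: sums; linarith)
qed

lemma efficient_ZX_XZY_XZY_YXZ_share2_YXZ:
  assumes agents: "distinct [a, b, c, d]"
  shows "(\<Sum>u\<in>{x, y}. prob (quad a ZX b XZY c XZY d YXZ) d u) = 5 / 6"
proof -
  note [simp] = distinct4[OF agents] objects quad_apply proper_def
  let ?P = "quad a ZX b XZY c XZY d YXZ"
  have P: "proper ?P" by simp
  have S1: "(\<Sum>u\<in>{x, y, z}. prob ?P d u) = 5 / 6"
    by (rule transfer_take[OF efficient_ZX_XZY_XZY_XZY_share3_XZY[of a d b c] P, where n = 3]) auto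
  have Z2: "prob ?P d z = 0" by (rule never_assigned[OF P, where v = y]) (auto split: if_splits)
  show ?thesis using S1 Z2 by (simp add: sums; linarith)
qed

lemma efficient_XZY_XZY_XZY_XY_share3_XZY:
  assumes agents: "distinct [a, b, c, d]"
  shows "(\<Sum>u\<in>{x, y, z}. prob (quad a XZY b XZY c XZY d XY) a u) = 3 / 4"
proof -
  note [simp] = distinct4[OF agents] objects quad_apply proper_def
  let ?P = "quad a XZY b XZY c XZY d XY"
  have P: "proper ?P" by simp
  have S1: "(\<Sum>u\<in>{x, y}. prob ?P d u) = 3 / 4"
    by (rule transfer_take[OF efficient_XZY_XZY_XZY_YXZ_share2_YXZ[of a b c d] P, where n = 2]) auto
  have O2: "(\<Sum>i\<in>{a, b, c, d}. prob ?P i x) = 1"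
    by (rule object_assigned[OF P, where I = "{a, b, c}" and V = "{x, y, z}"])
      (auto split: if_splits)
  have O3: "(\<Sum>i\<in>{a, b, c, d}. prob ?P i y) = 1"
    by (rule object_assigned[OF P, where I = "{a, b, c}" and V = "{x, y, z}"])
      (auto split: if_splits)
  have O4: "(\<Sum>i\<in>{a, b, c}. prob ?P i z) = 1"
    by (rule object_assigned[OF P, where I = "{a, b, c}" and V = "{x, y, z}"])
      (auto split: if_splits)
  have E: "prob ?P b u = prob ?P a u" "prob ?P c u = prob ?P a u" for u
    by (rule equals[OF P], simp)+
  show ?thesis using S1 O2 O3 O4 E by (simp add: sums; linarith)
qed

text \<open>Nobody else accepts \<open>z\<close>, so \<open>a\<close> never settles for
  \<open>y\<close>, which the others split: 1/4 + 1/3.\<close>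

lemma efficient_XZY_XY_XY_XY_share2_XY:
  assumes agents: "distinct [a, b, c, d]"
  shows "(\<Sum>u\<in>{x, y}. prob (quad a XZY b XY c XY d XY) b u) = 7 / 12"
proof -
  note [simp] = distinct4[OF agents] objects quad_apply proper_def
  let ?P = "quad a XZY b XY c XY d XY"
  have P: "proper ?P" by simp
  have S1: "(\<Sum>u\<in>{x}. prob ?P b u) = 1 / 4"
    by (rule transfer_take[OF efficient_XZY_XZY_XY_XY_share1_XZY[of b a c d] P, where n = 1]) auto
  have Z2: "prob ?P a y = 0" by (rule never_assigned[OF P, where v = z]) (auto split: if_splits)
  have O3: "(\<Sum>i\<in>{a, b, c, d}. prob ?P i y) = 1"
    by (rule object_assigned[OF P, where I = "{b, c}" and V = "{x, y}"]) (auto split: if_splits)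
  have E: "prob ?P c u = prob ?P b u" "prob ?P d u = prob ?P b u" for u
    by (rule equals[OF P], simp)+
  show ?thesis using S1 Z2 O3 E by (simp add: sums; linarith)
qed

text \<open>Besides 2/3 from \<open>x\<close> and \<open>y\<close>, \<open>c\<close> has half of the
  1/6 of \<open>z\<close> that \<open>a\<close> leaves.\<close>

lemma efficient_ZX_XY_YXZ_YXZ_share3_YXZ:
  assumes agents: "distinct [a, b, c, d]"
  shows "(\<Sum>u\<in>{x, y, z}. prob (quad a ZX b XY c YXZ d YXZ) c u) = 3 / 4"
proof -
  note [simp] = distinct4[OF agents] objects quad_apply proper_def
  let ?P = "quad a ZX b XY c YXZ d YXZ"
  have P: "proper ?P" by simp
  have S1: "(\<Sum>u\<in>{x, y}. prob ?P b u) = 2 / 3"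
    by (rule transfer_take[OF efficient_ZX_YXZ_YXZ_YXZ_share2_YXZ[of a b c d] P, where n = 2]) auto
  have S2: "(\<Sum>u\<in>{z}. prob ?P a u) = 5 / 6"
    by (rule transfer_take[OF efficient_ZYX_XY_YXZ_YXZ_share1_ZYX[of a b c d] P, where n = 1]) auto
  have Z3: "prob ?P a x = 0" by (rule never_assigned[OF P, where v = z]) (auto split: if_splits)
  have O4: "(\<Sum>i\<in>{a, b, c, d}. prob ?P i x) = 1"
    by (rule object_assigned[OF P, where I = "{a, b, c}" and V = "{x, y, z}"])
      (auto split: if_splits)
  have O5: "(\<Sum>i\<in>{b, c, d}. prob ?P i y) = 1"
    by (rule object_assigned[OF P, where I = "{b, c, d}" and V = "{x, y, z}"])
      (auto split: if_splits)
  have O6: "(\<Sum>i\<in>{a, c, d}. prob ?P i z) = 1"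
    by (rule object_assigned[OF P, where I = "{a, c, d}" and V = "{x, y, z}"])
      (auto split: if_splits)
  have E: "prob ?P d u = prob ?P c u" for u by (rule equals[OF P], simp)
  show ?thesis using S1 S2 Z3 O4 O5 O6 E by (simp add: sums; linarith)
qed

lemma efficient_ZYX_ZYX_ZYX_YXZ_share2_YXZ:
  assumes agents: "distinct [a, b, c, d]"
  shows "(\<Sum>u\<in>{x, y}. prob (quad a ZYX b ZYX c ZYX d YXZ) d u) = 3 / 4"
proof -
  note [simp] = distinct4[OF agents] objects quad_apply proper_def
  let ?P = "quad a ZYX b ZYX c ZYX d YXZ"
  have P: "proper ?P" by simp
  have S1: "(\<Sum>u\<in>{x, y, z}. prob ?P a u) = 3 / 4"
    by (rule transfer_take[OF efficient_ZYX_ZYX_YXZ_YXZ_share3_YXZ[of b c a d] P, where n = 3]) auto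
  have Z2: "prob ?P d z = 0" by (rule never_assigned[OF P, where v = y]) (auto split: if_splits)
  have O3: "(\<Sum>i\<in>{a, b, c, d}. prob ?P i x) = 1"
    by (rule object_assigned[OF P, where I = "{a, b, c}" and V = "{x, y, z}"])
      (auto split: if_splits)
  have O4: "(\<Sum>i\<in>{a, b, c, d}. prob ?P i y) = 1"
    by (rule object_assigned[OF P, where I = "{a, b, c}" and V = "{x, y, z}"])
      (auto split: if_splits)
  have O5: "(\<Sum>i\<in>{a, b, c, d}. prob ?P i z) = 1"
    by (rule object_assigned[OF P, where I = "{a, b, c}" and V = "{x, y, z}"])
      (auto split: if_splits)
  have E: "prob ?P b u = prob ?P a u" "prob ?P c u = prob ?P a u" for u
    by (rule equals[OF P], simp)+
  show ?thesis using S1 Z2 O3 O4 O5 E by (simp add: sums; linarith)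
qed

lemma efficient_ZX_XZY_XZY_XY_share3_XZY:
  assumes agents: "distinct [a, b, c, d]"
  shows "(\<Sum>u\<in>{x, y, z}. prob (quad a ZX b XZY c XZY d XY) b u) = 19 / 24"
proof -
  note [simp] = distinct4[OF agents] objects quad_apply proper_def
  let ?P = "quad a ZX b XZY c XZY d XY"
  have P: "proper ?P" by simp
  have S1: "(\<Sum>u\<in>{x, z}. prob ?P a u) = 7 / 12"
    by (rule transfer_take[OF efficient_XZY_XZY_XZY_XY_share2_XZY[of a b c d] P, where n = 2]) auto
  have S2: "(\<Sum>u\<in>{x, y}. prob ?P d u) = 5 / 6"
    by (rule transfer_take[OF efficient_ZX_XZY_XZY_YXZ_share2_YXZ[of a b c d] P, where n = 2]) auto
  have O3: "(\<Sum>i\<in>{a, b, c, d}. prob ?P i x) = 1"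
    by (rule object_assigned[OF P, where I = "{a, b, c}" and V = "{x, y, z}"])
      (auto split: if_splits)
  have O4: "(\<Sum>i\<in>{b, c, d}. prob ?P i y) = 1"
    by (rule object_assigned[OF P, where I = "{b, c, d}" and V = "{x, y, z}"])
      (auto split: if_splits)
  have O5: "(\<Sum>i\<in>{a, b, c}. prob ?P i z) = 1"
    by (rule object_assigned[OF P, where I = "{a, b, c}" and V = "{x, y, z}"])
      (auto split: if_splits)
  have E: "prob ?P c u = prob ?P b u" for u by (rule equals[OF P], simp)
  show ?thesis using S1 S2 O3 O4 O5 E by (simp add: sums; linarith)
qed

lemma efficient_ZYX_ZYX_ZYX_XY_share3_ZYX:
  assumes agents: "distinct [a, b, c, d]"
  shows "(\<Sum>u\<in>{x, y, z}. prob (quad a ZYX b ZYX c ZYX d XY) a u) = 3 / 4"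
proof -
  note [simp] = distinct4[OF agents] objects quad_apply proper_def
  let ?P = "quad a ZYX b ZYX c ZYX d XY"
  have P: "proper ?P" by simp
  have S1: "(\<Sum>u\<in>{x, y}. prob ?P d u) = 3 / 4"
    by (rule transfer_take[OF efficient_ZYX_ZYX_ZYX_YXZ_share2_YXZ[of a b c d] P, where n = 2]) auto
  have O2: "(\<Sum>i\<in>{a, b, c, d}. prob ?P i x) = 1"
    by (rule object_assigned[OF P, where I = "{a, b, c}" and V = "{x, y, z}"])
      (auto split: if_splits)
  have O3: "(\<Sum>i\<in>{a, b, c, d}. prob ?P i y) = 1"
    by (rule object_assigned[OF P, where I = "{a, b, c}" and V = "{x, y, z}"])
      (auto split: if_splits)
  have O4: "(\<Sum>i\<in>{a, b, c}. prob ?P i z) = 1"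
    by (rule object_assigned[OF P, where I = "{a, b, c}" and V = "{x, y, z}"])
      (auto split: if_splits)
  have E: "prob ?P b u = prob ?P a u" "prob ?P c u = prob ?P a u" for u
    by (rule equals[OF P], simp)+
  show ?thesis using S1 O2 O3 O4 E by (simp add: sums; linarith)
qed

text \<open>All four rankings differ here; the totals of the other three agents come from
  neighbouring profiles, and \<open>a\<close> has the remainder of 3.\<close>

lemma efficient_ZX_XZY_XY_YXZ_share2_ZX:
  assumes agents: "distinct [a, b, c, d]"
  shows "(\<Sum>u\<in>{x, z}. prob (quad a ZX b XZY c XY d YXZ) a u) = 19 / 24"
proof -
  note [simp] = distinct4[OF agents] objects quad_apply proper_def
  let ?P = "quad a ZX b XZY c XY d YXZ"
  have P: "proper ?P" by simp
  have S1: "(\<Sum>u\<in>{x, y}. prob ?P c u) = 2 / 3"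
    by (rule transfer_take[OF efficient_ZX_XZY_YXZ_YXZ_share2_YXZ[of a b c d] P, where n = 2]) auto
  have S2: "(\<Sum>u\<in>{x, y, z}. prob ?P b u) = 3 / 4"
    by (rule transfer_take[OF efficient_ZX_XY_YXZ_YXZ_share3_YXZ[of a c b d] P, where n = 3]) auto
  have S3: "(\<Sum>u\<in>{x, y, z}. prob ?P d u) = 19 / 24"
    by (rule transfer_take[OF efficient_ZX_XZY_XZY_XY_share3_XZY[of a d b c] P, where n = 3]) auto
  have O4: "(\<Sum>i\<in>{a, b, c, d}. prob ?P i x) = 1"
    by (rule object_assigned[OF P, where I = "{a, b, c}" and V = "{x, y, z}"])
      (auto split: if_splits)
  have O5: "(\<Sum>i\<in>{b, c, d}. prob ?P i y) = 1"
    by (rule object_assigned[OF P, where I = "{b, c, d}" and V = "{x, y, z}"])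
      (auto split: if_splits)
  have O6: "(\<Sum>i\<in>{a, b, d}. prob ?P i z) = 1"
    by (rule object_assigned[OF P, where I = "{a, b, d}" and V = "{x, y, z}"])
      (auto split: if_splits)
  show ?thesis using S1 S2 S3 O4 O5 O6 by (simp add: sums; linarith)
qed

text \<open>\<open>c\<close> never holds \<open>y\<close>, and \<open>a\<close> or \<open>b\<close>
  would trade \<open>y\<close> for \<open>z\<close>; so the total 3/4 of \<open>d\<close> contains
  no \<open>z\<close>.\<close>

lemma efficient_ZYX_ZYX_XY_YXZ_share2_YXZ:
  assumes agents: "distinct [a, b, c, d]"
  shows "(\<Sum>u\<in>{x, y}. prob (quad a ZYX b ZYX c XY d YXZ) d u) = 3 / 4"
proof -
  note [simp] = distinct4[OF agents] objects quad_apply proper_def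
  let ?P = "quad a ZYX b ZYX c XY d YXZ"
  have P: "proper ?P" by simp
  have S1: "(\<Sum>u\<in>{x, y, z}. prob ?P d u) = 3 / 4"
    by (rule transfer_take[OF efficient_ZYX_ZYX_ZYX_XY_share3_ZYX[of d a b c] P, where n = 3]) auto
  have Z2: "prob ?P c y = 0" by (rule never_assigned[OF P, where v = x]) (auto split: if_splits)
  have Z3: "prob ?P d z = 0" by (rule never_assigned[OF P, where v = y])
      (use Z2 in \<open>auto split: if_splits\<close>)
  show ?thesis using S1 Z3 by (simp add: sums; linarith)
qed

text \<open>\<open>a\<close> and \<open>b\<close> each receive 19/24 - 1/3 = 11/24 of
  \<open>z\<close>, which leaves 1/12 of it in the total 3/4 of \<open>d\<close>.\<close>

lemma efficient_XZY_XZY_XY_YXZ_share2_YXZ: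
  assumes agents: "distinct [a, b, c, d]"
  shows "(\<Sum>u\<in>{x, y}. prob (quad a XZY b XZY c XY d YXZ) d u) = 2 / 3"
proof -
  note [simp] = distinct4[OF agents] objects quad_apply proper_def
  let ?P = "quad a XZY b XZY c XY d YXZ"
  have P: "proper ?P" by simp
  have S1: "(\<Sum>u\<in>{x}. prob ?P c u) = 1 / 3"
    by (rule transfer_take[OF efficient_XZY_XZY_XZY_YXZ_share1_XZY[of c a b d] P, where n = 1]) auto
  have S2: "(\<Sum>u\<in>{x, y, z}. prob ?P d u) = 3 / 4"
    by (rule transfer_take[OF efficient_XZY_XZY_XZY_XY_share3_XZY[of d a b c] P, where n = 3]) auto
  have S3: "(\<Sum>u\<in>{x, z}. prob ?P a u) = 19 / 24"
    by (rule transfer_take[OF efficient_ZX_XZY_XY_YXZ_share2_ZX[of a b c d] P, where n = 2]) auto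
  have Z4: "prob ?P d x = 0" by (rule never_assigned[OF P, where v = y]) (auto split: if_splits)
  have O5: "(\<Sum>i\<in>{a, b, c, d}. prob ?P i x) = 1"
    by (rule object_assigned[OF P, where I = "{a, b, c}" and V = "{x, y, z}"])
      (auto split: if_splits)
  have O6: "(\<Sum>i\<in>{a, b, d}. prob ?P i z) = 1"
    by (rule object_assigned[OF P, where I = "{a, b, d}" and V = "{x, y, z}"])
      (auto split: if_splits)
  have E: "prob ?P b u = prob ?P a u" for u by (rule equals[OF P], simp)
  show ?thesis using S1 S2 S3 Z4 O5 O6 E by (simp add: sums; linarith)
qed

lemma efficient_ZYX_ZYX_XY_XY_share3_ZYX:
  assumes agents: "distinct [a, b, c, d]"
  shows "(\<Sum>u\<in>{x, y, z}. prob (quad a ZYX b ZYX c XY d XY) a u) = 3 / 4"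
proof -
  note [simp] = distinct4[OF agents] objects quad_apply proper_def
  let ?P = "quad a ZYX b ZYX c XY d XY"
  have P: "proper ?P" by simp
  have S1: "(\<Sum>u\<in>{x, y}. prob ?P c u) = 3 / 4"
    by (rule transfer_take[OF efficient_ZYX_ZYX_XY_YXZ_share2_YXZ[of a b d c] P, where n = 2]) auto
  have O2: "(\<Sum>i\<in>{a, b, c, d}. prob ?P i x) = 1"
    by (rule object_assigned[OF P, where I = "{c, d}" and V = "{x, y}"]) (auto split: if_splits)
  have O3: "(\<Sum>i\<in>{a, b, c, d}. prob ?P i y) = 1"
    by (rule object_assigned[OF P, where I = "{c, d}" and V = "{x, y}"]) (auto split: if_splits)
  have O4: "(\<Sum>i\<in>{a, b}. prob ?P i z) = 1"
    by (rule efficient_object_assigned[OF P, where I = "{a}" and V = "{z}"]) (auto split: if_splits)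
  have E: "prob ?P b u = prob ?P a u" "prob ?P d u = prob ?P c u" for u
    by (rule equals[OF P], simp)+
  show ?thesis using S1 O2 O3 O4 E by (simp add: sums; linarith)
qed

lemma efficient_XZY_XZY_XY_XY_share3_XZY:
  assumes agents: "distinct [a, b, c, d]"
  shows "(\<Sum>u\<in>{x, y, z}. prob (quad a XZY b XZY c XY d XY) a u) = 5 / 6"
proof -
  note [simp] = distinct4[OF agents] objects quad_apply proper_def
  let ?P = "quad a XZY b XZY c XY d XY"
  have P: "proper ?P" by simp
  have S1: "(\<Sum>u\<in>{x, y}. prob ?P c u) = 2 / 3"
    by (rule transfer_take[OF efficient_XZY_XZY_XY_YXZ_share2_YXZ[of a b d c] P, where n = 2]) auto
  have O2: "(\<Sum>i\<in>{a, b, c, d}. prob ?P i x) = 1"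
    by (rule object_assigned[OF P, where I = "{c, d}" and V = "{x, y}"]) (auto split: if_splits)
  have O3: "(\<Sum>i\<in>{a, b, c, d}. prob ?P i y) = 1"
    by (rule object_assigned[OF P, where I = "{c, d}" and V = "{x, y}"]) (auto split: if_splits)
  \<comment> \<open>Only \<open>x\<close> stands above \<open>z\<close> for \<open>a\<close> and
    \<open>b\<close>, so they cannot both hold something better than \<open>z\<close>.\<close>
  have O4: "(\<Sum>i\<in>{a, b}. prob ?P i z) = 1"
    by (rule efficient_object_assigned[OF P, where I = "{a, b}" and V = "{x, z}"])
      (auto split: if_splits)
  have E: "prob ?P b u = prob ?P a u" "prob ?P d u = prob ?P c u" for u
    by (rule equals[OF P], simp)+
  show ?thesis using S1 O2 O3 O4 E by (simp add: sums; linarith)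
qed

text \<open>Totals add up to 3, so \<open>a\<close> has 3 - 2 * 2/3 - 3/4.\<close>

lemma efficient_ZYX_XY_XY_YXZ_share3_ZYX:
  assumes agents: "distinct [a, b, c, d]"
  shows "(\<Sum>u\<in>{x, y, z}. prob (quad a ZYX b XY c XY d YXZ) a u) = 11 / 12"
proof -
  note [simp] = distinct4[OF agents] objects quad_apply proper_def
  let ?P = "quad a ZYX b XY c XY d YXZ"
  have P: "proper ?P" by simp
  have S1: "(\<Sum>u\<in>{x, y}. prob ?P b u) = 2 / 3"
    by (rule transfer_take[OF efficient_ZYX_XY_YXZ_YXZ_share2_YXZ[of a c b d] P, where n = 2]) auto
  have S2: "(\<Sum>u\<in>{x, y, z}. prob ?P d u) = 3 / 4"
    by (rule transfer_take[OF efficient_ZYX_ZYX_XY_XY_share3_ZYX[of d a b c] P, where n = 3]) auto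
  have O3: "(\<Sum>i\<in>{a, b, c, d}. prob ?P i x) = 1"
    by (rule object_assigned[OF P, where I = "{b, c}" and V = "{x, y}"]) (auto split: if_splits)
  have O4: "(\<Sum>i\<in>{a, b, c, d}. prob ?P i y) = 1"
    by (rule object_assigned[OF P, where I = "{b, c}" and V = "{x, y}"]) (auto split: if_splits)
  have O5: "(\<Sum>i\<in>{a, d}. prob ?P i z) = 1"
    by (rule efficient_object_assigned[OF P, where I = "{a}" and V = "{z}"]) (auto split: if_splits)
  have E: "prob ?P c u = prob ?P b u" for u by (rule equals[OF P], simp)
  show ?thesis using S1 S2 O3 O4 O5 E by (simp add: sums; linarith)
qed

lemma efficient_wasteful_agent:
  assumes agents: "distinct [a, b, c, d]"
  shows "(\<Sum>u\<in>{x, y, z}. prob (quad a XZY b XY c XY d YXZ) d u) = 5 / 6"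
proof -
  note [simp] = distinct4[OF agents] objects quad_apply proper_def
  let ?P = "quad a XZY b XY c XY d YXZ"
  have P: "proper ?P" by simp
  have S1: "(\<Sum>u\<in>{x, y, z}. prob ?P d u) = 5 / 6"
    by (rule transfer_take[OF efficient_XZY_XZY_XY_XY_share3_XZY[of d a b c] P, where n = 3]) auto
  show ?thesis using S1 by (simp add: sums; linarith)
qed

text \<open>\<open>a\<close>, \<open>b\<close> and \<open>c\<close> each receive 1/3 of
  \<open>x\<close>. As \<open>a\<close> never holds \<open>y\<close> and \<open>d\<close> never
  holds \<open>x\<close>, their shares of \<open>z\<close> are 11/12 - 1/3 = 7/12 and 5/6 - 7/12 =
  1/4.\<close>

lemma efficient_wasteful_object:
  assumes agents: "distinct [a, b, c, d]"
  shows "prob (quad a XZY b XY c XY d YXZ) a z + prob (quad a XZY b XY c XY d YXZ) d z = 5 / 6"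
proof -
  note [simp] = distinct4[OF agents] objects quad_apply proper_def
  let ?P = "quad a XZY b XY c XY d YXZ"
  have P: "proper ?P" by simp
  have S1: "(\<Sum>u\<in>{x}. prob ?P b u) = 1 / 3"
    by (rule transfer_take[OF efficient_XZY_XZY_XY_YXZ_share1_XZY[of b a c d] P, where n = 1]) auto
  have S2: "(\<Sum>u\<in>{x, y}. prob ?P d u) = 7 / 12"
    by (rule transfer_take[OF efficient_XZY_XY_XY_XY_share2_XY[of a d b c] P, where n = 2]) auto
  have S3: "(\<Sum>u\<in>{x, y, z}. prob ?P d u) = 5 / 6"
    by (rule transfer_take[OF efficient_XZY_XZY_XY_XY_share3_XZY[of d a b c] P, where n = 3]) auto
  have S4: "(\<Sum>u\<in>{x, y, z}. prob ?P a u) = 11 / 12"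
    by (rule transfer_take[OF efficient_ZYX_XY_XY_YXZ_share3_ZYX[of a b c d] P, where n = 3]) auto
  have Z5: "prob ?P a y = 0" by (rule never_assigned[OF P, where v = z]) (auto split: if_splits)
  have Z6: "prob ?P d x = 0" by (rule never_assigned[OF P, where v = y]) (auto split: if_splits)
  have O7: "(\<Sum>i\<in>{a, b, c, d}. prob ?P i x) = 1"
    by (rule object_assigned[OF P, where I = "{b, c}" and V = "{x, y}"]) (auto split: if_splits)
  have E: "prob ?P c u = prob ?P b u" for u by (rule equals[OF P], simp)
  show ?thesis using S1 S2 S3 S4 Z5 Z6 O7 E by (simp add: sums; linarith)
qed

end

end

section \<open>Minimality\<close>

lemma prob_none_RSD:
  fixes R :: "('n::finite, 'o::finite) profile"
  shows "assign_prob RSD R i None =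
    card {p \<in> priorities. serial_dictatorship p R i = None} / fact CARD('n)"
  by (simp add: assign_prob_def prob_RSD)

lemma unassigned_prob_RSD:
  fixes R :: "('n::finite, 'o::finite) profile"
  assumes "R \<in> profiles"
  shows "unassigned_prob RSD R w =
    card {p \<in> priorities. \<forall>j. serial_dictatorship p R j \<noteq> Some w} / fact CARD('n)"
  unfolding unassigned_prob_eq[OF is_mechanism_RSD assms] by (rule prob_RSD)

text \<open>Positive waste means that some order leaves \<open>i\<close> unassigned and some order
  leaves \<open>w\<close> over; the configuration built from both also supplies the agents and
  objects for the bad profile.\<close>

lemma wasteful_RSD:
  assumes size: "CARD('n::finite) = 4 \<or> CARD('o::finite) = 3"
    and wasteful: "agent_object_wasteful q (RSD :: ('n, 'o) mechanism)" and q: "q > 0"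
  shows "q \<le> 1 / 6 \<and> (\<exists>x y z :: 'o. distinct [x, y, z]) \<and> (\<exists>a b c d :: 'n. distinct [a, b, c, d])"
proof -
  obtain R :: "('n, 'o) profile" and w i where R: "R \<in> profiles"
    and w: "(Some w, None) \<in> strict (R i)"
    and min: "min (assign_prob RSD R i None) (unassigned_prob RSD R w) \<ge> q"
    using wasteful unfolding agent_object_wasteful_def by blast
  let ?U = "{p \<in> priorities. serial_dictatorship p R i = None}"
  let ?V = "{p \<in> priorities. \<forall>j. serial_dictatorship p R j \<noteq> Some w}"
  have "q \<le> card ?U / fact CARD('n)" "q \<le> card ?V / fact CARD('n)"
    using min by (simp_all add: prob_none_RSD unassigned_prob_RSD[OF R])
  then have le: "q * fact CARD('n) \<le> card ?U" "q * fact CARD('n) \<le> card ?V"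
    by (simp_all add: pos_le_divide_eq)
  moreover have pos: "q * fact CARD('n) > 0" using q by simp
  ultimately have "real (card ?U) > 0" "real (card ?V) > 0" by linarith+
  then have "card ?U > 0" "card ?V > 0" by simp_all
  have U: "?U \<noteq> {}" using \<open>card ?U > 0\<close> by (rule card_gt_0_iff[THEN iffD1, THEN conjunct1])
  have V: "?V \<noteq> {}" using \<open>card ?V > 0\<close> by (rule card_gt_0_iff[THEN iffD1, THEN conjunct1])
  obtain p0 where "p0 \<in> ?U" using ex_in_conv[THEN iffD2, OF U] ..
  moreover obtain q0 where "q0 \<in> ?V" using ex_in_conv[THEN iffD2, OF V] ..
  ultimately have p0: "p0 \<in> priorities" "serial_dictatorship p0 R i = None"
    and q0: "q0 \<in> priorities" "\<And>j. serial_dictatorship q0 R j \<noteq> Some w" by simp_all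
  have bound: "6 * card ?U \<le> fact CARD('n) \<or> 6 * card ?V \<le> fact CARD('n)"
    using size
  proof
    assume "CARD('n) = 4"
    from card_unassigned_four[OF R this q0 w] show ?thesis ..
  next
    assume "CARD('o) = 3"
    from waste_bound_three[OF R this q0 p0 w] show ?thesis .
  qed
  have le_sixth: "q \<le> 1 / 6" if "6 * k \<le> (fact CARD('n) :: nat)" "q * fact CARD('n) \<le> real k" for k
  proof -
    have "real (6 * k) \<le> real (fact CARD('n))" using that(1) by (rule of_nat_mono)
    then have "6 * real k \<le> fact CARD('n)" by simp
    then have "q * fact CARD('n) \<le> 1 / 6 * fact CARD('n)" using that(2) by linarith
    then show ?thesis by (rule mult_right_le_imp_le) simp
  qed
  from bound have "q \<le> 1 / 6"
    by (elim disjE) (erule le_sixth, rule le)+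
  moreover obtain x s :: 'o and a b c where dist: "distinct [a, b, c, i]" "distinct [x, s, w]"
    by (rule waste_configuration[OF R p0 q0 w])
  moreover have "\<exists>x y z :: 'o. distinct [x, y, z]" using dist(2) by (intro exI)
  moreover have "\<exists>a b c d :: 'n. distinct [a, b, c, d]" using dist(1) by (intro exI)
  ultimately show ?thesis by (intro conjI)
qed

context fair_strategy_proof
begin

lemma unassigned_agent_prob:
  assumes T: "proper T"
  shows "assign_prob f (ranked_profile T) i None = 1 - (\<Sum>u\<in>set (fst (T i)). prob T i u)"
proof -
  let ?A = "set (fst (T i))"
  have "assign_prob f (ranked_profile T) i None + (\<Sum>u\<in>?A. prob T i u) =
      (\<Sum>y\<in>insert None (Some ` ?A). assign_prob f (ranked_profile T) i y)"
    by (subst sum.insert) (auto simp: prob_def sum.reindex)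
  also have "\<dots> = measure_pmf.prob (f (ranked_profile T)) {m. m i \<in> insert None (Some ` ?A)}"
    by (rule sum_assign_prob)
  also have "\<dots> = 1"
  proof (rule measure_pmf.prob_eq_1[THEN iffD2])
    show "AE m in measure_pmf (f (ranked_profile T)). m \<in> {m. m i \<in> insert None (Some ` ?A)}"
      unfolding AE_measure_pmf_iff
    proof
      fix m assume "m \<in> set_pmf (f (ranked_profile T))"
      then show "m \<in> {m. m i \<in> insert None (Some ` ?A)}"
        using outcome_acceptable[OF T, of m i] by (cases "m i") (auto simp: outcomes_def)
    qed
  qed simp
  finally show ?thesis by simp
qed

lemma unassigned_object_prob:
  assumes T: "proper T" and J: "\<And>i. u \<in> set (fst (T i)) \<Longrightarrow> i \<in> J"
  shows "unassigned_prob f (ranked_profile T) u = 1 - (\<Sum>i\<in>J. prob T i u)"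
proof -
  have "(\<Sum>i\<in>UNIV. prob T i u) = (\<Sum>i\<in>J. prob T i u)"
    using J outcome_acceptable[OF T] by (intro sum.mono_neutral_right) (auto intro!: prob_zeroI)
  then show ?thesis by (simp add: unassigned_prob_def prob_def)
qed

text \<open>The pair \<open>d\<close> and \<open>z\<close> is wasteful: both probabilities are
  complements of 5/6, as only \<open>a\<close> and \<open>d\<close> accept \<open>z\<close>.\<close>

lemma wastefulI:
  fixes x y z :: 'o and a b c d :: 'n
  defines "T \<equiv> quad a ([x, z, y], []) b ([x, y], [z]) c ([x, y], [z]) d ([y, x, z], [])"
  assumes objects: "distinct [x, y, z]" and agents: "distinct [a, b, c, d]"
    and agent: "(\<Sum>u\<in>{x, y, z}. prob T d u) = 5 / 6"
    and object: "prob T a z + prob T d z = 5 / 6"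
  shows "agent_object_wasteful (1 / 6) f"
proof -
  have T: "proper T" unfolding T_def by (rule proper_quad) (use objects in auto)
  have Td: "fst (T d) = [y, x, z]"
    using distinct4[OF agents] by (simp add: T_def quad_apply)
  have "assign_prob f (ranked_profile T) d None = 1 / 6"
    using unassigned_agent_prob[OF T, of d] agent by (simp add: Td insert_commute)
  moreover have "(\<Sum>i\<in>{a, d}. prob T i z) = 5 / 6"
    using object distinct4[OF agents] by simp
  moreover have "i \<in> {a, d}" if "z \<in> set (fst (T i))" for i
    using that distinct3[OF objects] by (auto simp: T_def quad_apply split: if_splits)
  ultimately have "assign_prob f (ranked_profile T) d None = 1 / 6"
    "unassigned_prob f (ranked_profile T) z = 1 / 6"
    using unassigned_object_prob[OF T, of z "{a, d}"] by simp_all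
  moreover have "(Some z, None) \<in> strict (ranked_profile T d)"
    using strict_linear_order_iff[OF linear_order_profile[OF ranked_profile_in_profiles[OF T]]]
      ranking_acceptable[OF proper_distinct[OF T], of z d] Td
    by (simp add: ranked_profile_def)
  ultimately show ?thesis
    using ranked_profile_in_profiles[OF T] unfolding agent_object_wasteful_def
    by (intro conjI bexI[of _ "ranked_profile T"] exI[of _ z] exI[of _ d]) simp_all
qed

end

text \<open>If \<open>q\<close> is positive, then \<open>q\<close> is at most 1/6 and
  \<open>q'\<close> at least 1/6; otherwise \<open>q'\<close> being nonnegative suffices.\<close>

lemma minimal_waste_boundI:
  assumes size: "CARD('n::finite) = 4 \<or> CARD('o::finite) = 3"
    and RSD: "(RSD :: ('n, 'o) mechanism) \<in> C"
    and C: "\<And>f (x :: 'o) y z (a :: 'n) b c d. f \<in> C \<Longrightarrow> distinct [x, y, z] \<Longrightarrow> distinct [a, b, c, d] \<Longrightarrow>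
      agent_object_wasteful (1 / 6) f"
  shows "attains_minimal_waste_bound (RSD :: ('n, 'o) mechanism) C"
  unfolding attains_minimal_waste_bound_def
proof (intro conjI ballI allI impI RSD)
  fix f q q'
  assume f: "f \<in> C" and q: "at_most_agent_object_wasteful q (RSD :: ('n, 'o) mechanism)"
    and q': "at_most_agent_object_wasteful q' f"
  have "q' \<ge> 0" using q' by (simp add: at_most_agent_object_wasteful_def agent_object_wasteful_def)
  show "q \<le> q'"
  proof (cases "q > 0")
    case True
    then have *: "q \<le> 1 / 6" "\<exists>x y z :: 'o. distinct [x, y, z]" "\<exists>a b c d :: 'n. distinct [a, b, c, d]"
      using wasteful_RSD[OF size] q unfolding at_most_agent_object_wasteful_def by blast+
    then have "agent_object_wasteful (1 / 6) f" using C[OF f] by blast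
    then have "\<not> q' < 1 / 6" using q' unfolding at_most_agent_object_wasteful_def by blast
    then show ?thesis using *(1) by simp
  qed (use \<open>q' \<ge> 0\<close> in simp)
qed

theorem corollary1:
  assumes "CARD('n::finite) = 4 \<or> CARD('o::finite) = 3"
  shows "attains_minimal_waste_bound (RSD :: ('n, 'o) mechanism)
           {f. is_mechanism f \<and> equal_treatment_of_almost_equals f \<and>
               strategy_proof f \<and> ex_post_weakly_nonwasteful f} \<and>
         attains_minimal_waste_bound (RSD :: ('n, 'o) mechanism)
           {f. is_mechanism f \<and> equal_treatment_of_equals f \<and>
               strategy_proof f \<and> ex_post_efficient f}"
proof (intro conjI minimal_waste_boundI[OF assms])
  show "RSD \<in> {f :: ('n, 'o) mechanism. is_mechanism f \<and> equal_treatment_of_almost_equals f \<and>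
      strategy_proof f \<and> ex_post_weakly_nonwasteful f}"
    by (simp add: is_mechanism_RSD equal_treatment_of_almost_equals_RSD strategy_proof_RSD
        ex_post_weakly_nonwasteful_RSD)
  show "RSD \<in> {f :: ('n, 'o) mechanism. is_mechanism f \<and> equal_treatment_of_equals f \<and>
      strategy_proof f \<and> ex_post_efficient f}"
    by (simp add: is_mechanism_RSD strategy_proof_RSD ex_post_efficient_RSD
        equal_treatment_of_equals_if_almost_equals equal_treatment_of_almost_equals_RSD
        ex_post_weakly_nonwasteful_RSD)
next
  fix f :: "('n, 'o) mechanism" and x y z :: 'o and a b c d :: 'n
  assume "f \<in> {f. is_mechanism f \<and> equal_treatment_of_almost_equals f \<and>
      strategy_proof f \<and> ex_post_weakly_nonwasteful f}"
    and dist: "distinct [x, y, z]" "distinct [a, b, c, d]"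
  then interpret fair_strategy_proof_almost f
    by unfold_locales (simp_all add: equal_treatment_of_equals_if_almost_equals)
  show "agent_object_wasteful (1 / 6) f"
    by (rule wastefulI[OF dist almost_wasteful_agent[OF dist] almost_wasteful_object[OF dist]])
next
  fix f :: "('n, 'o) mechanism" and x y z :: 'o and a b c d :: 'n
  assume "f \<in> {f. is_mechanism f \<and> equal_treatment_of_equals f \<and>
      strategy_proof f \<and> ex_post_efficient f}"
    and dist: "distinct [x, y, z]" "distinct [a, b, c, d]"
  then interpret fair_strategy_proof_efficient f
    by unfold_locales (simp_all add: ex_post_efficient_weakly_nonwasteful)
  show "agent_object_wasteful (1 / 6) f"
    by (rule wastefulI[OF dist efficient_wasteful_agent[OF dist] efficient_wasteful_object[OF dist]])
qed

end
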